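(* Let $v=(a_1,\dots,a_\ell,b_0,\dots,b_t)\in\mathbb{N}^{\ell+t+1}$. There exists $D_{v,n}\in\mathbb{N}$ such that for any ideal $I\subseteq R$ of type $v$ with $\alpha(I)\ge D_{v,n}$, there exists a lex plus powers ideal $J=L+(x_1^{\alpha(I)+a_1},\dots,x_\ell^{\alpha(I)+a_\ell})$, with $L$ a lex ideal, that has the same Hilbert function as $I$ in degrees $\le\alpha(I)+t$, i.e. $\dim_K J_d=\dim_K I_d$ for all $d\le\alpha(I)+t$.
   Context: $\mathbb{N}=\{0,1,2,\dots\}$. $K$ is a field of characteristic $0$, $n\ge 3$, $R=K[x_1,\dots,x_n]$ is standard graded, and all ideals are homogeneous. $\alpha(I)$ is the smallest degree of a minimal generator of $I$. Type: let $\ell\ge1$, $t\ge 0$ be integers. An ideal $I$ is of type $v=(a_1,\dots,a_\ell,b_0,\dots,b_t)\in\mathbb{N}^{\ell+t+1}$ if there is a regular sequence of forms $f_1,\dots,f_\ell\in I$ with $\deg f_i=\alpha(I)+a_i$ and $\deg f_i\le\deg f_{i+1}$, and for all $j\in\{0,\dots,t\}$, $I$ has exactly $b_j$ minimal generators in degree $\alpha(I)+j$. Lexicographic order: for monomials of the same degree, $x^p>x^q$ if the first nonzero entry of $p-q$ is positive. A lex ideal is a monomial ideal that, whenever it contains a monomial, contains every lex-larger monomial of the same degree. A lex plus powers (LPP) ideal is an ideal $L+P$ with $L$ a lex ideal and $P=(x_1^{e_1},\dots,x_\ell^{e_\ell})$, $e_1\le\cdots\le e_\ell$, $\ell\le n$.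 *)

theory Defs
  imports Complex_Main
    "HOL-Library.Poly_Mapping"
    "HOL-Algebra.Ideal"
    "HOL-Algebra.AbelCoset"
begin

text \<open>
  Polynomials are elements of the monoid algebra of the finitely supported exponent vectors
  \<^typ>\<open>nat \<Rightarrow>\<^sub>0 nat\<close>; the variable $x_i$ ($1 \le i \le n$) has index \<open>i - 1\<close>.
  The ring $K[x_1,\dots,x_n]$ is the subring of polynomials in the variables with index below \<open>n\<close>.
\<close>

type_synonym expo = "nat \<Rightarrow>\<^sub>0 nat"
type_synonym 'k mpoly = "expo \<Rightarrow>\<^sub>0 'k"

definition expos :: "nat \<Rightarrow> expo set" where
  "expos n = {m. Poly_Mapping.keys m \<subseteq> {..<n}}"

definition poly_ring :: "nat \<Rightarrow> 'k::field mpoly ring" where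
  "poly_ring n =
    \<lparr>carrier = {f. Poly_Mapping.keys f \<subseteq> expos n}, mult = (*), one = 1, zero = 0, add = (+)\<rparr>"

definition monom :: "expo \<Rightarrow> 'k::field mpoly" where
  "monom m = Poly_Mapping.single m 1"

definition mdegree :: "expo \<Rightarrow> nat" where
  "mdegree m = (\<Sum>i\<in>Poly_Mapping.keys m. Poly_Mapping.lookup m i)"

text \<open>Zero is homogeneous of every degree, but it is not a form.\<close>

definition homogeneous :: "nat \<Rightarrow> nat \<Rightarrow> 'k::field mpoly \<Rightarrow> bool" where
  "homogeneous n d f \<longleftrightarrow>
    f \<in> carrier (poly_ring n) \<and> (\<forall>m\<in>Poly_Mapping.keys f. mdegree m = d)"

definition form :: "nat \<Rightarrow> nat \<Rightarrow> 'k::field mpoly \<Rightarrow> bool" where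
  "form n d f \<longleftrightarrow> homogeneous n d f \<and> f \<noteq> 0"

definition homogeneous_ideal :: "nat \<Rightarrow> 'k::field mpoly set \<Rightarrow> bool" where
  "homogeneous_ideal n I \<longleftrightarrow>
    (\<exists>S. (\<forall>f\<in>S. \<exists>d. homogeneous n d f) \<and> I = Idl\<^bsub>poly_ring n\<^esub> S)"

definition scale :: "'k::field \<Rightarrow> 'k mpoly \<Rightarrow> 'k mpoly" where
  "scale c f = Poly_Mapping.single 0 c * f"

definition hilbert :: "nat \<Rightarrow> 'k::field mpoly set \<Rightarrow> nat \<Rightarrow> nat" where
  "hilbert n I d = vector_space.dim scale {f \<in> I. homogeneous n d f}"

definition min_gens :: "nat \<Rightarrow> 'k::field mpoly set \<Rightarrow> 'k mpoly set \<Rightarrow> bool" where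
  "min_gens n I G \<longleftrightarrow>
    finite G \<and> (\<forall>g\<in>G. \<exists>d. form n d g) \<and> Idl\<^bsub>poly_ring n\<^esub> G = I \<and>
    (\<forall>H. H \<subset> G \<longrightarrow> Idl\<^bsub>poly_ring n\<^esub> H \<noteq> I)"

text \<open>Meaningful only for nonzero homogeneous ideals.\<close>

definition initial_degree :: "nat \<Rightarrow> 'k::field mpoly set \<Rightarrow> nat" where
  "initial_degree n I = (LEAST d. \<exists>G g. min_gens n I G \<and> g \<in> G \<and> form n d g)"

definition regular_sequence :: "nat \<Rightarrow> 'k::field mpoly list \<Rightarrow> bool" where
  "regular_sequence n fs \<longleftrightarrow>
    set fs \<subseteq> carrier (poly_ring n) \<and>
    (\<forall>i<length fs. \<forall>g\<in>carrier (poly_ring n).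
      fs ! i * g \<in> Idl\<^bsub>poly_ring n\<^esub> (set (take i fs)) \<longrightarrow>
      g \<in> Idl\<^bsub>poly_ring n\<^esub> (set (take i fs))) \<and>
    Idl\<^bsub>poly_ring n\<^esub> (set fs) \<noteq> carrier (poly_ring n)"

text \<open>
  The type $(a_1,\dots,a_\ell,b_0,\dots,b_t)$ is given by the two lists \<open>[a\<^sub>1, \<dots>, a\<^sub>\<ell>]\<close> and
  \<open>[b\<^sub>0, \<dots>, b\<^sub>t]\<close>. The number of minimal generators in a given degree does not depend on the
  minimal homogeneous generating set \<open>G\<close> used to count them.
\<close>

definition ideal_of_type ::
    "nat \<Rightarrow> nat list \<Rightarrow> nat list \<Rightarrow> 'k::field mpoly set \<Rightarrow> bool" where
  "ideal_of_type n a b I \<longleftrightarrow>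
    (\<exists>fs. length fs = length a \<and> set fs \<subseteq> I \<and> regular_sequence n fs \<and>
      (\<forall>i<length a. form n (initial_degree n I + a ! i) (fs ! i)) \<and>
      sorted (map (\<lambda>ai. initial_degree n I + ai) a)) \<and>
    (\<exists>G. min_gens n I G \<and>
      (\<forall>j<length b. card {g \<in> G. form n (initial_degree n I + j) g} = b ! j))"

definition monomial_ideal :: "nat \<Rightarrow> 'k::field mpoly set \<Rightarrow> bool" where
  "monomial_ideal n L \<longleftrightarrow> (\<exists>M \<subseteq> expos n. L = Idl\<^bsub>poly_ring n\<^esub> (monom ` M))"

text \<open>
  The library order on exponent vectors is lexicographic: \<open>q < p\<close> iff \<open>q\<close> is smaller than \<open>p\<close>
  at the first index where they differ.
\<close>

definition lex_ideal :: "nat \<Rightarrow> 'k::field mpoly set \<Rightarrow> bool" where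
  "lex_ideal n L \<longleftrightarrow> monomial_ideal n L \<and>
    (\<forall>p\<in>expos n. \<forall>q\<in>expos n.
      mdegree p = mdegree q \<and> q < p \<and> monom q \<in> L \<longrightarrow> monom p \<in> L)"

definition powers_ideal :: "nat \<Rightarrow> nat list \<Rightarrow> 'k::field mpoly set" where
  "powers_ideal n e =
    Idl\<^bsub>poly_ring n\<^esub> ((\<lambda>i. monom (Poly_Mapping.single i (e ! i))) ` {..<length e})"

definition lpp_ideal :: "nat \<Rightarrow> nat list \<Rightarrow> 'k::field mpoly set \<Rightarrow> bool" where
  "lpp_ideal n e J \<longleftrightarrow> sorted e \<and> length e \<le> n \<and>
    (\<exists>L. lex_ideal n L \<and> J = L <+>\<^bsub>poly_ring n\<^esub> powers_ideal n e)"

lemma expos_simps: "0 \<in> expos n" "p \<in> expos n \<Longrightarrow> q \<in> expos n \<Longrightarrow> p + q \<in> expos n"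
  using Poly_Mapping.keys_add[of p q] by (auto simp: expos_def)

lemma cring_poly_ring: "cring (poly_ring n :: 'k::field mpoly ring)"
proof -
  let ?R = "poly_ring n :: 'k mpoly ring"
  have mult: "f * g \<in> carrier ?R" if "f \<in> carrier ?R" "g \<in> carrier ?R" for f g
    using that Poly_Mapping.keys_mult[of f g] expos_simps(2)
    by (fastforce simp: poly_ring_def)
  have add: "f + g \<in> carrier ?R" if "f \<in> carrier ?R" "g \<in> carrier ?R" for f g
    using that Poly_Mapping.keys_add[of f g] by (auto simp: poly_ring_def)
  have one: "1 \<in> carrier ?R"
    using expos_simps(1) by (simp add: poly_ring_def)
  have inv: "\<exists>g\<in>carrier ?R. g + f = 0" if "f \<in> carrier ?R" for f
    using that by (intro bexI[of _ "- f"]) (auto simp: poly_ring_def)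
  show ?thesis
    by (intro cringI abelian_groupI comm_monoidI)
       (use mult add one inv in \<open>auto simp: poly_ring_def algebra_simps\<close>)
qed

lemma vector_space_scale: "vector_space (scale :: 'k::field \<Rightarrow> 'k mpoly \<Rightarrow> 'k mpoly)"
  by unfold_locales
     (auto simp: scale_def algebra_simps Poly_Mapping.single_add mult_single
       simp flip: mult.assoc Poly_Mapping.single_one)

lemma less_expo_iff:
  fixes p q :: expo
  shows "q < p \<longleftrightarrow> (\<exists>i. Poly_Mapping.lookup q i < Poly_Mapping.lookup p i \<and>
    (\<forall>j<i. Poly_Mapping.lookup q j = Poly_Mapping.lookup p j))"
  by (simp add: less_poly_mapping.rep_eq less_fun_def)

end

theory Submission
  imports Defs
begin


text \<open>
  Let \<open>\<alpha>\<close> be the initial degree of \<open>I\<close> and \<open>E = \<alpha> + t\<close>. The dimensions of \<open>I\<^sub>d\<close> for \<open>\<alpha> \<le> d \<le> E\<close> are bounded by a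
  number \<open>M\<close> that depends on the type and on \<open>n\<close> only, because \<open>I\<^sub>E\<close> is spanned by the monomial multiples of a
  bounded number of generators. So for large \<open>\<alpha>\<close> the spaces \<open>I\<^sub>d\<close> are tiny compared with the degrees they live in.

  In this range lex segments are easy to survey. A segment of at most \<open>M\<close> monomials of degree \<open>d\<close> consists of
  multiples of \<open>x\<^sub>1\<close> to the power \<open>d - M\<close>; the number of monomials that it generates one degree higher depends on its
  size only (the function \<open>growth\<close>); and it contains no multiple of \<open>x\<^sub>i\<close> to the power \<open>\<alpha> + a\<^sub>i\<close> for \<open>i \<ge> 2\<close>.
  Multiples of two such powers do not meet in degrees up to \<open>E\<close> either. Hence a lex plus powers ideal with the
  Hilbert function of \<open>I\<close> can be written down (\<open>lpp_ideal_with_hilbert\<close>) as soon as the numbers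
  \<open>h\<^sub>d = dim I\<^sub>d - (\<Sum>i\<ge>2. dim R\<^sub>e)\<close>, where \<open>e = d - \<alpha> - a\<^sub>i\<close>, satisfy \<open>growth h\<^sub>d \<le> h\<^bsub>d+1\<^esub>\<close> and are at
  least \<open>dim R\<^sub>e\<close> for the exponent \<open>e\<close> that belongs to \<open>i = 1\<close>.

  If no dimension were subtracted, this inequality would be the theorem of Macaulay on the growth of ideals
  (\<open>macaulay\<close>). To account for the subtracted terms, the regular sequence is used through one consequence:
  \<open>f\<^sub>1, \<dots>, f\<^sub>l\<close> satisfy no relation with coefficients of degree below \<open>\<alpha>\<close>. The members of degree at most \<open>E\<close>,
  multiplied into degree \<open>E\<close>, are extended within \<open>I\<^sub>E\<close> to a family \<open>g\<^sub>1, \<dots>, g\<^sub>k\<close> without relations of low degree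
  that is maximal, so that a common denominator \<open>\<delta>\<close> of low degree turns every element of \<open>I\<^sub>d\<close> into a unique
  combination of the \<open>g\<^sub>i\<close> (\<open>low_degree_presentation\<close>). In low degrees \<open>I\<close> is thus embedded in a free module of
  rank \<open>k\<close>. Passing to leading monomials splits \<open>dim I\<^sub>d\<close> into \<open>k\<close> summands, each of which obeys Macaulay's bound
  and of which the \<open>i\<close>-th is at least \<open>dim R\<^sub>e\<close> whenever \<open>f\<^sub>i\<close> has degree at most \<open>E\<close>, since \<open>f\<^sub>i\<close> is mapped to a
  multiple of a unit vector (\<open>hilbert_decomposition\<close>).

  It remains to merge the \<open>k\<close> summands into one while discarding a copy of \<open>R\<^sub>e\<close> for each \<open>i \<ge> 2\<close>. That is the
  inequality \<open>growth (U + V - r) + r' \<le> growth U + growth V\<close> of \<open>growth_merge\<close>, where \<open>r\<close> and \<open>r'\<close> are the numbers of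
  all monomials in two consecutive degrees. It follows from Macaulay's theorem again, applied to the union of two
  lex segments that are placed in such a way that they overlap in exactly \<open>r\<close> monomials.

  Finally, a lex plus powers ideal with \<open>l\<close> powers needs \<open>l \<le> n\<close>; this holds since regular sequences are
  algebraically independent (\<open>regular_sequence_length\<close>).
\<close>

section \<open>Monomials, lex segments and shadows\<close>

text \<open>
  The variable with index \<open>i\<close> is written \<open>x\<^sub>i\<close> in the comments from here on, so that \<open>x\<^sub>0\<close> is the first one, and
  \<open>xpow i e\<close> is the exponent vector of its \<open>e\<close>-th power.
\<close>

abbreviation supp :: "('a \<Rightarrow>\<^sub>0 'b::zero) \<Rightarrow> 'a set" where "supp \<equiv> Poly_Mapping.keys"
abbreviation xpow :: "nat \<Rightarrow> nat \<Rightarrow> expo" where "xpow \<equiv> Poly_Mapping.single"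
abbreviation lk :: "expo \<Rightarrow> nat \<Rightarrow> nat" where "lk \<equiv> Poly_Mapping.lookup"
abbreviation var :: "nat \<Rightarrow> expo" where "var i \<equiv> xpow i (Suc 0)"

lemma expo_eq_iff: "(m :: expo) = m' \<longleftrightarrow> (\<forall>i. lk m i = lk m' i)"
  by (auto intro: poly_mapping_eqI)

lemma mdegree_eq_sum:
  assumes "finite X" "supp m \<subseteq> X"
  shows "mdegree m = (\<Sum>i\<in>X. lk m i)"
  unfolding mdegree_def
  by (rule sum.mono_neutral_left) (use assms in \<open>auto simp: not_in_keys_iff_lookup_eq_zero\<close>)

lemma mdegree_add [simp]: "mdegree (p + q) = mdegree p + mdegree q"
proof -
  let ?X = "supp p \<union> supp q"
  have "supp (p + q) \<subseteq> ?X" by (rule keys_add)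
  then have "mdegree (p + q) = (\<Sum>i\<in>?X. lk (p + q) i)" by (intro mdegree_eq_sum) auto
  also have "\<dots> = mdegree p + mdegree q"
    by (simp add: lookup_add sum.distrib mdegree_eq_sum[of ?X p] mdegree_eq_sum[of ?X q])
  finally show ?thesis .
qed

lemma mdegree_single [simp]: "mdegree (xpow i e) = e"
  by (simp add: mdegree_def)

lemma mdegree_zero [simp]: "mdegree 0 = 0"
  by (simp add: mdegree_def)

lemma mdegree_0_iff: "mdegree m = 0 \<longleftrightarrow> m = 0"
proof
  assume "mdegree m = 0"
  then have "\<forall>i\<in>supp m. lk m i = 0" by (simp add: mdegree_def)
  then show "m = 0" by (metis in_keys_iff lookup_zero poly_mapping_eqI)
qed simp

lemma lk_le_mdegree: "lk m i \<le> mdegree m"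
proof (cases "i \<in> supp m")
  case True
  then show ?thesis unfolding mdegree_def by (intro member_le_sum) auto
next
  case False
  then show ?thesis by (simp add: not_in_keys_iff_lookup_eq_zero)
qed

lemma lk_sum_le_mdegree: "i \<noteq> j \<Longrightarrow> lk m i + lk m j \<le> mdegree m"
proof -
  assume ij: "i \<noteq> j"
  let ?X = "supp m \<union> {i, j}"
  have "lk m i + lk m j = (\<Sum>k\<in>{i,j}. lk m k)" using ij by simp
  also have "\<dots> \<le> (\<Sum>k\<in>?X. lk m k)" by (rule sum_mono2) auto
  also have "\<dots> = mdegree m" by (rule mdegree_eq_sum[symmetric]) auto
  finally show ?thesis .
qed

lemma keys_plus_expo: "supp (p + q :: expo) = supp p \<union> supp q"
  by (auto simp: in_keys_iff lookup_add)

lemma keys_minus_subset: "supp (m - q :: expo) \<subseteq> supp m"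
  by (auto simp: in_keys_iff lookup_minus)

lemma minus_plus_expo:
  assumes "\<And>i. lk q i \<le> lk m i"
  shows "m - q + q = m"
  by (rule poly_mapping_eqI) (use assms in \<open>simp add: lookup_add lookup_minus\<close>)

lemma minus_plus_single:
  assumes "e \<le> lk m i" shows "m - xpow i e + xpow i e = m"
  by (rule minus_plus_expo) (use assms in \<open>auto simp: lookup_single when_def\<close>)

definition mons :: "nat set \<Rightarrow> nat \<Rightarrow> expo set" where
  "mons X d = {m. supp m \<subseteq> X \<and> mdegree m = d}"

text \<open>
  The upper shadow: for a set of monomials of degree \<open>d\<close>, the monomials of the ideal generated by it in
  degree \<open>d + 1\<close>.
\<close>

definition grow :: "nat set \<Rightarrow> expo set \<Rightarrow> expo set" where
  "grow X A = (\<Union>i\<in>X. (\<lambda>m. m + var i) ` A)"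

text \<open>
  The lex segments of degree \<open>d\<close> in the variables \<open>X\<close>. The set of variables is arbitrary because
  Macaulay's theorem is proved by removing variables one at a time.
\<close>

definition lexset :: "nat set \<Rightarrow> nat \<Rightarrow> expo set \<Rightarrow> bool" where
  "lexset X d L \<longleftrightarrow> L \<subseteq> mons X d \<and> (\<forall>p\<in>L. \<forall>q\<in>mons X d. p < q \<longrightarrow> q \<in> L)"

lemma finite_mons [simp]: assumes "finite X" shows "finite (mons X d)"
proof -
  have "finite {f. \<forall>i. (i \<in> X \<longrightarrow> f i \<in> {..d}) \<and> (i \<notin> X \<longrightarrow> f i = 0)}"
    by (rule finite_set_of_finite_funs) (use assms in auto)
  moreover have "lk ` mons X d \<subseteq> {f. \<forall>i. (i \<in> X \<longrightarrow> f i \<in> {..d}) \<and> (i \<notin> X \<longrightarrow> f i = 0)}"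
    using lk_le_mdegree by (auto simp: mons_def in_keys_iff)
  ultimately have "finite (lk ` mons X d)" by (rule rev_finite_subset)
  then show ?thesis by (rule finite_imageD) (simp add: inj_on_def)
qed

lemma mons_add: "p \<in> mons X c \<Longrightarrow> q \<in> mons X d \<Longrightarrow> p + q \<in> mons X (c + d)"
  by (auto simp: mons_def keys_plus_expo)

lemma mons_add_var: "p \<in> mons X d \<Longrightarrow> i \<in> X \<Longrightarrow> p + var i \<in> mons X (Suc d)"
  by (auto simp: mons_def keys_plus_expo)

lemma mons_single: "i \<in> X \<Longrightarrow> xpow i d \<in> mons X d"
  by (auto simp: mons_def)

lemma mons_0 [simp]: "mons X 0 = {0}"
  by (auto simp: mons_def mdegree_0_iff)

lemma mons_minus_single:
  assumes "m \<in> mons X d" "e \<le> lk m i"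
  shows "m - xpow i e \<in> mons X (d - e)"
proof -
  have "mdegree (m - xpow i e) + e = d"
    using minus_plus_single[OF assms(2)] assms(1) mdegree_add[of "m - xpow i e" "xpow i e"]
    by (simp add: mons_def)
  then show ?thesis using assms(1) keys_minus_subset[of m] by (auto simp: mons_def)
qed

lemma grow_subset_mons: "A \<subseteq> mons X d \<Longrightarrow> grow X A \<subseteq> mons X (Suc d)"
  by (auto simp: grow_def intro: mons_add_var)

lemma grow_mono: "A \<subseteq> B \<Longrightarrow> grow X A \<subseteq> grow X B"
  by (auto simp: grow_def)

lemma finite_grow [simp]: "finite X \<Longrightarrow> finite A \<Longrightarrow> finite (grow X A)"
  by (auto simp: grow_def)

lemma growI: "m \<in> A \<Longrightarrow> i \<in> X \<Longrightarrow> m + var i \<in> grow X A"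
  by (auto simp: grow_def)

lemma growE:
  assumes "v \<in> grow X A" obtains m i where "m \<in> A" "i \<in> X" "v = m + var i"
  using assms by (auto simp: grow_def)

lemma grow_mons: "X \<noteq> {} \<Longrightarrow> grow X (mons X d) = mons X (Suc d)"
proof
  show "grow X (mons X d) \<subseteq> mons X (Suc d)" by (rule grow_subset_mons) simp
  show "mons X (Suc d) \<subseteq> grow X (mons X d)"
  proof
    fix m assume m: "m \<in> mons X (Suc d)"
    then have "m \<noteq> 0" by (auto simp: mons_def)
    then obtain i where i: "i \<in> supp m" by (metis all_not_in_conv keys_eq_empty)
    then have le: "Suc 0 \<le> lk m i" by (simp add: in_keys_iff Suc_le_eq)
    have "m - var i \<in> mons X d" using mons_minus_single[OF m le] by simp
    moreover have "i \<in> X" using i m by (auto simp: mons_def)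
    ultimately show "m \<in> grow X (mons X d)"
      using growI[of "m - var i" "mons X d" i X] minus_plus_single[OF le] by simp
  qed
qed

lemma lexsetD: "lexset X d L \<Longrightarrow> p \<in> L \<Longrightarrow> q \<in> mons X d \<Longrightarrow> p < q \<Longrightarrow> q \<in> L"
  by (simp add: lexset_def)

lemma lexset_mons: "lexset X d L \<Longrightarrow> p \<in> L \<Longrightarrow> p \<in> mons X d"
  by (auto simp: lexset_def)

lemma lexset_nested:
  assumes "lexset X d L" "lexset X d L'" shows "L \<subseteq> L' \<or> L' \<subseteq> L"
proof (rule ccontr)
  assume "\<not> ?thesis"
  then obtain p q where pq: "p \<in> L" "p \<notin> L'" "q \<in> L'" "q \<notin> L" by blast
  then have "p \<noteq> q" by auto
  then consider "p < q" | "q < p" by (rule linorder_neqE)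
  then show False
  proof cases
    case 1
    then show False using lexsetD[OF assms(1) pq(1) lexset_mons[OF assms(2) pq(3)]] pq(4) by simp
  next
    case 2
    then show False using lexsetD[OF assms(2) pq(3) lexset_mons[OF assms(1) pq(1)]] pq(2) by simp
  qed
qed

lemma lexset_finite: "finite X \<Longrightarrow> lexset X d L \<Longrightarrow> finite L"
  by (rule finite_subset[of L "mons X d"]) (simp_all add: lexset_def)

lemma lexset_subset:
  assumes "finite X" "lexset X d L" "lexset X d L'" "card L \<le> card L'"
  shows "L \<subseteq> L'"
proof (rule ccontr)
  assume "\<not> L \<subseteq> L'"
  then have "L' \<subset> L" using lexset_nested[OF assms(2,3)] by blast
  then show False using psubset_card_mono[OF lexset_finite[OF assms(1,2)], of L'] assms(4) by simp
qed

lemma lexset_exists: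
  assumes "finite X" "N \<le> card (mons X d)"
  shows "\<exists>L. lexset X d L \<and> card L = N"
  using assms(2)
proof (induction N)
  case 0
  show ?case by (rule exI[of _ "{}"]) (simp add: lexset_def)
next
  case (Suc N)
  then obtain L where L: "lexset X d L" "card L = N" by auto
  have fin: "finite (mons X d)" using assms(1) by simp
  have "L \<noteq> mons X d" using L Suc.prems by auto
  then have ne: "mons X d - L \<noteq> {}" using lexset_mons[OF L(1)] by auto
  let ?m = "Max (mons X d - L)"
  have m: "?m \<in> mons X d - L" using ne fin by (intro Max_in) auto
  have mx: "q \<le> ?m" if "q \<in> mons X d - L" for q using that fin by (intro Max_ge) auto
  have "lexset X d (insert ?m L)"
    unfolding lexset_def
  proof (intro conjI ballI impI)
    show "insert ?m L \<subseteq> mons X d" using m L(1) by (simp add: lexset_def)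
    fix p q assume p: "p \<in> insert ?m L" and q: "q \<in> mons X d" and pq: "p < q"
    show "q \<in> insert ?m L"
    proof (rule ccontr)
      assume nq: "q \<notin> insert ?m L"
      then have "q \<le> ?m" using mx[of q] q by simp
      then have "p \<noteq> ?m" using pq by auto
      then have "p \<in> L" using p by simp
      then show False using lexsetD[OF L(1) _ q pq] nq by simp
    qed
  qed
  moreover have "card (insert ?m L) = Suc N" using m L lexset_finite[OF assms(1) L(1)] by simp
  ultimately show ?case by blast
qed

lemma less_expoI:
  assumes "\<And>i. i < p \<Longrightarrow> lk q i \<le> lk r i" "lk q p < lk r p"
  shows "q < r"
proof -
  define i where "i = (LEAST i. lk q i \<noteq> lk r i)"
  have ne: "lk q i \<noteq> lk r i" unfolding i_def by (rule LeastI[of _ p]) (use assms(2) in simp)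
  have ip: "i \<le> p" unfolding i_def by (rule Least_le) (use assms(2) in simp)
  have eq: "lk q j = lk r j" if "j < i" for j using not_less_Least that unfolding i_def by blast
  have "lk q i < lk r i" using ne ip assms by (cases "i = p") (auto simp: le_less)
  then show ?thesis unfolding less_expo_iff using eq by blast
qed

text \<open>
  If \<open>v\<close> is the product of \<open>m \<in> L\<close> and a variable, and \<open>u\<close> is lex-larger than \<open>v\<close>, then dividing \<open>u\<close> by its last
  variable leaves a monomial that is still at least \<open>m\<close>: either the exponent where \<open>u\<close> first exceeds \<open>v\<close>
  survives, or it belonged to the last variable of \<open>u\<close>, and then comparing degrees leaves only equality or
  a strict gain.
\<close>

lemma grow_lexset:
  assumes X: "finite X" and L: "lexset X d L"
  shows "lexset X (Suc d) (grow X L)"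
  unfolding lexset_def
proof (intro conjI ballI impI)
  show "grow X L \<subseteq> mons X (Suc d)" by (rule grow_subset_mons) (use L in \<open>simp add: lexset_def\<close>)
  fix v u assume "v \<in> grow X L" and u: "u \<in> mons X (Suc d)" and vu: "v < u"
  then obtain m k where m: "m \<in> L" "k \<in> X" "v = m + var k" by (auto elim: growE)
  have md: "m \<in> mons X d" using lexset_mons[OF L m(1)] .
  obtain p where p: "lk v p < lk u p" "\<forall>j<p. lk v j = lk u j" using vu unfolding less_expo_iff by blast
  have mv: "lk m i \<le> lk v i" for i using m by (simp add: lookup_add)
  define j where "j = Max (supp u)"
  have une: "supp u \<noteq> {}" using p(1) by auto
  then have j: "j \<in> supp u" unfolding j_def by simp
  have jm: "i \<le> j" if "i \<in> supp u" for i unfolding j_def using that by simp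
  have jX: "j \<in> X" using j u by (auto simp: mons_def)
  have le: "Suc 0 \<le> lk u j" using j by (simp add: in_keys_iff Suc_le_eq)
  define m' where "m' = u - var j"
  have um: "u = m' + var j" unfolding m'_def using minus_plus_single[OF le] by simp
  have m'd: "m' \<in> mons X d" unfolding m'_def using mons_minus_single[OF u le] by simp
  have pj: "p \<le> j" using p(1) jm[of p] by (simp add: in_keys_iff)
  have m'l: "lk m' i = (if i = j then lk u i - 1 else lk u i)" for i
    unfolding m'_def by (simp add: lookup_minus lookup_single when_def)
  have "m \<le> m'"
  proof (cases "p < j")
    case True
    have "m < m'"
    proof (rule less_expoI[of p])
      show "lk m p < lk m' p" using p(1) mv[of p] True by (simp add: m'l)
      show "lk m i \<le> lk m' i" if "i < p" for i using p(2) mv[of i] True that by (simp add: m'l)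
    qed
    then show ?thesis by simp
  next
    case False
    then have pj: "p = j" using pj by simp
    have le': "lk m i \<le> lk m' i" if "i \<le> j" for i
      using that mv[of i] p pj by (cases "i = j") (auto simp: m'l)
    have z: "lk m' i = 0" if "\<not> i \<le> j" for i
      using that jm[of i] by (auto simp: m'l in_keys_iff)
    show ?thesis
    proof (cases "\<exists>i\<le>j. lk m i < lk m' i")
      case True
      then obtain i where "i \<le> j" "lk m i < lk m' i" by blast
      then have "m < m'" using le' by (intro less_expoI[of i]) auto
      then show ?thesis by simp
    next
      case False
      have eq: "lk m i = lk m' i" if "i \<le> j" for i using le'[OF that] False that by (auto simp: le_less)
      \<comment> \<open>Here \<open>m\<close> and \<open>m'\<close> agree up to \<open>j\<close> and \<open>m'\<close> ends there, so equal degrees force \<open>m = m'\<close>.\<close>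
      have "mdegree m' = (\<Sum>i\<in>X \<union> {..j}. lk m' i)"
        by (rule mdegree_eq_sum) (use m'd X in \<open>auto simp: mons_def\<close>)
      moreover have "mdegree m = (\<Sum>i\<in>X \<union> {..j}. lk m i)"
        by (rule mdegree_eq_sum) (use md X in \<open>auto simp: mons_def\<close>)
      moreover have "mdegree m' = mdegree m" using m'd md by (simp add: mons_def)
      moreover have "(\<Sum>i\<in>X \<union> {..j}. lk m' i) = (\<Sum>i\<in>{..j}. lk m' i)"
        by (rule sum.mono_neutral_right) (use X z in auto)
      moreover have "(\<Sum>i\<in>X \<union> {..j}. lk m i) = (\<Sum>i\<in>{..j}. lk m i) + (\<Sum>i\<in>X - {..j}. lk m i)"
        using X by (subst sum.union_disjoint[symmetric]) (auto intro: sum.cong)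
      ultimately have "(\<Sum>i\<in>X - {..j}. lk m i) = 0" using eq by simp
      then have mz: "lk m i = 0" if "\<not> i \<le> j" for i
      proof (cases "i \<in> X")
        case True
        then show ?thesis using \<open>(\<Sum>i\<in>X - {..j}. lk m i) = 0\<close> that X by auto
      next
        case False
        then show ?thesis using md by (auto simp: mons_def in_keys_iff)
      qed
      have "m = m'" by (rule poly_mapping_eqI) (metis eq mz z)
      then show ?thesis by simp
    qed
  qed
  then have "m' \<in> L" using lexsetD[OF L m(1) m'd] m(1) by (cases "m = m'") auto
  then show "u \<in> grow X L" unfolding um using jX by (rule growI)
qed

section \<open>Compression along lines\<close>

text \<open>
  A monomial with the exponents of two variables forgotten. In a fixed degree, the monomials with a
  given value form a line on which the exponent of \<open>z\<close> is a coordinate.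
\<close>

definition strip :: "nat \<Rightarrow> nat \<Rightarrow> expo \<Rightarrow> expo" where
  "strip i z m = Poly_Mapping.update i 0 (Poly_Mapping.update z 0 m)"

lemma lookup_strip: "lk (strip i z m) j = (if j = i \<or> j = z then 0 else lk m j)"
  by (simp add: strip_def lookup_update)

lemma strip_eq_iff: "strip i z m = strip i z m' \<longleftrightarrow> (\<forall>j. j \<noteq> i \<longrightarrow> j \<noteq> z \<longrightarrow> lk m j = lk m' j)"
  by (auto simp: expo_eq_iff lookup_strip)

definition line :: "nat \<Rightarrow> nat \<Rightarrow> expo set \<Rightarrow> expo \<Rightarrow> expo set" where
  "line i z A w = {m\<in>A. strip i z m = w}"

text \<open>
  Every line that meets \<open>A\<close> in \<open>c\<close> points receives instead its \<open>c\<close> points with the smallest exponents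
  of \<open>z\<close>, so that weight moves from \<open>z\<close> to \<open>i\<close>.
\<close>

definition compress :: "nat set \<Rightarrow> nat \<Rightarrow> nat \<Rightarrow> nat \<Rightarrow> expo set \<Rightarrow> expo set" where
  "compress X d i z A = {m\<in>mons X d. lk m z < card (line i z A (strip i z m))}"

lemma line_inj:
  assumes "finite X" "i \<noteq> z" "i \<in> X" "z \<in> X" "A \<subseteq> mons X d"
  shows "inj_on (\<lambda>m. lk m z) (line i z A w)"
proof (rule inj_onI)
  fix m m' assume m: "m \<in> line i z A w" and m': "m' \<in> line i z A w" and eq: "lk m z = lk m' z"
  have s: "\<forall>j. j \<noteq> i \<longrightarrow> j \<noteq> z \<longrightarrow> lk m j = lk m' j"
    using m m' by (auto simp: line_def simp flip: strip_eq_iff)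
  have "mdegree m = mdegree m'" using m m' assms(5) by (auto simp: line_def mons_def)
  moreover have "mdegree m = lk m i + (\<Sum>j\<in>X - {i}. lk m j)" "mdegree m' = lk m' i + (\<Sum>j\<in>X - {i}. lk m' j)"
    using m m' assms by (auto simp: line_def mons_def mdegree_eq_sum[of X] sum.remove[of X i])
  moreover have "(\<Sum>j\<in>X - {i}. lk m j) = (\<Sum>j\<in>X - {i}. lk m' j)"
    by (rule sum.cong) (use s eq in auto)
  ultimately have "lk m i = lk m' i" by simp
  then show "m = m'" using s eq by (intro poly_mapping_eqI) metis
qed

lemma line_subset: "line i z A w \<subseteq> A" by (auto simp: line_def)

text \<open>
  A line with \<open>c\<close> points in \<open>A\<close> has one whose exponent of \<open>z\<close> is at least \<open>c - 1\<close>; trading \<open>z\<close> for \<open>i\<close> from there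
  reaches every smaller exponent, so compression loses no point.
\<close>

lemma line_compress:
  assumes "finite X" "i \<noteq> z" "i \<in> X" "z \<in> X" "A \<subseteq> mons X d"
  shows "(\<lambda>m. lk m z) ` line i z (compress X d i z A) w = {..<card (line i z A w)}"
proof
  show "(\<lambda>m. lk m z) ` line i z (compress X d i z A) w \<subseteq> {..<card (line i z A w)}"
    by (auto simp: line_def compress_def)
  show "{..<card (line i z A w)} \<subseteq> (\<lambda>m. lk m z) ` line i z (compress X d i z A) w"
  proof
    fix q assume q: "q \<in> {..<card (line i z A w)}"
    have "\<exists>m\<in>line i z A w. q \<le> lk m z"
    proof (rule ccontr)
      assume "\<not> ?thesis"
      then have "(\<lambda>m. lk m z) ` line i z A w \<subseteq> {..<q}" by auto
      then have "card ((\<lambda>m. lk m z) ` line i z A w) \<le> q" using card_mono[of "{..<q}"] by fastforce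
      then show False using q card_image[OF line_inj[OF assms]] by simp
    qed
    then obtain m where m: "m \<in> line i z A w" "q \<le> lk m z" by blast
    then have mX: "m \<in> mons X d" using assms(5) by (auto simp: line_def)
    define m' where "m' = m - xpow z (lk m z - q) + xpow i (lk m z - q)"
    have "m - xpow z (lk m z - q) \<in> mons X (d - (lk m z - q))"
      using mX by (intro mons_minus_single) auto
    then have "m' \<in> mons X (d - (lk m z - q) + (lk m z - q))"
      unfolding m'_def using assms(3) by (intro mons_add mons_single)
    moreover have "lk m z \<le> d" using lk_le_mdegree[of m z] mX by (simp add: mons_def)
    ultimately have m'X: "m' \<in> mons X d" by simp
    have mq: "lk m' z = q" using m(2) assms(2) by (simp add: m'_def lookup_add lookup_minus lookup_single)
    have "strip i z m' = strip i z m"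
      unfolding strip_eq_iff by (auto simp: m'_def lookup_add lookup_minus lookup_single when_def)
    then have sw: "strip i z m' = w" using m by (simp add: line_def)
    have "m' \<in> line i z (compress X d i z A) w"
      using m'X mq sw q by (simp add: line_def compress_def)
    then show "q \<in> (\<lambda>m. lk m z) ` line i z (compress X d i z A) w" using mq by blast
  qed
qed

lemma compress_subset: "compress X d i z A \<subseteq> mons X d"
  by (auto simp: compress_def)

lemma sum_lines:
  fixes h :: "expo \<Rightarrow> nat"
  assumes "finite X" "A \<subseteq> mons X d"
  shows "sum h A = (\<Sum>w\<in>strip i z ` mons X d. sum h (line i z A w))"
  unfolding line_def
  by (rule sum.group[symmetric])
     (use assms finite_subset[OF assms(2) finite_mons[OF assms(1)]] in auto)

lemma card_compress:
  assumes "finite X" "i \<noteq> z" "i \<in> X" "z \<in> X" "A \<subseteq> mons X d"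
  shows "card (compress X d i z A) = card A"
proof -
  have inj: "inj_on (\<lambda>m. lk m z) (line i z (compress X d i z A) w)" for w
    by (rule line_inj[OF assms(1-4) compress_subset])
  have "card (line i z (compress X d i z A) w) = card (line i z A w)" for w
    using line_compress[OF assms, of w] card_image[OF inj[of w]] by simp
  moreover have "card A = (\<Sum>w\<in>strip i z ` mons X d. card (line i z A w))"
    using sum_lines[OF assms(1,5), of "\<lambda>_. 1" i z] by simp
  moreover have "card (compress X d i z A) = (\<Sum>w\<in>strip i z ` mons X d. card (line i z (compress X d i z A) w))"
    using sum_lines[OF assms(1) compress_subset[of X d i z A], of "\<lambda>_. 1" i z] by simp
  ultimately show ?thesis by simp
qed

text \<open>
  Makes the total exponent of \<open>z\<close> a potential that compression decreases strictly unless it does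
  nothing.
\<close>

lemma sum_nat_set:
  fixes Q :: "nat set"
  assumes "finite Q"
  shows "\<Sum>{..<card Q} \<le> \<Sum>Q \<and> (\<Sum>{..<card Q} = \<Sum>Q \<longrightarrow> Q = {..<card Q})"
  using assms
proof (induction Q rule: finite_linorder_max_induct)
  case empty
  show ?case by simp
next
  case (insert b Q)
  have b: "b \<notin> Q" using insert by auto
  have "Q \<subseteq> {..<b}" using insert by auto
  then have cb: "card Q \<le> b" using card_mono[of "{..<b}" Q] by simp
  show ?case using insert b cb by (auto simp: lessThan_Suc)
qed

lemma compress_potential:
  assumes "finite X" "i \<noteq> z" "i \<in> X" "z \<in> X" "A \<subseteq> mons X d" "compress X d i z A \<noteq> A"
  shows "(\<Sum>m\<in>compress X d i z A. lk m z) < (\<Sum>m\<in>A. lk m z)"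
proof -
  let ?C = "compress X d i z A"
  have fin: "finite (line i z A w)" for w
    by (rule finite_subset[OF line_subset finite_subset[OF assms(5) finite_mons[OF assms(1)]]])
  have A: "(\<Sum>m\<in>line i z A w. lk m z) = \<Sum>((\<lambda>m. lk m z) ` line i z A w)" for w
    by (simp add: sum.reindex[OF line_inj[OF assms(1-5)]])
  have cA: "card ((\<lambda>m. lk m z) ` line i z A w) = card (line i z A w)" for w
    by (rule card_image[OF line_inj[OF assms(1-5)]])
  have injC: "inj_on (\<lambda>m. lk m z) (line i z ?C w)" for w
    by (rule line_inj[OF assms(1-4) compress_subset])
  have C: "(\<Sum>m\<in>line i z ?C w. lk m z) = \<Sum>{..<card (line i z A w)}" for w
    using line_compress[OF assms(1-5), of w] sum.reindex[OF injC[of w], of id] by simp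
  have le: "(\<Sum>m\<in>line i z ?C w. lk m z) \<le> (\<Sum>m\<in>line i z A w. lk m z)" for w
    unfolding A C using sum_nat_set[OF finite_imageI[OF fin[of w]], of "\<lambda>m. lk m z"] unfolding cA[of w] by blast
  have tot: "(\<Sum>m\<in>?C. lk m z) = (\<Sum>w\<in>strip i z ` mons X d. \<Sum>m\<in>line i z ?C w. lk m z)"
     "(\<Sum>m\<in>A. lk m z) = (\<Sum>w\<in>strip i z ` mons X d. \<Sum>m\<in>line i z A w. lk m z)"
    by (rule sum_lines[OF assms(1) compress_subset] sum_lines[OF assms(1,5)])+
  show ?thesis
  proof (rule ccontr)
    assume "\<not> ?thesis"
    then have "(\<Sum>w\<in>strip i z ` mons X d. \<Sum>m\<in>line i z ?C w. lk m z) =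
        (\<Sum>w\<in>strip i z ` mons X d. \<Sum>m\<in>line i z A w. lk m z)"
      using tot sum_mono[of "strip i z ` mons X d" "\<lambda>w. \<Sum>m\<in>line i z ?C w. lk m z" "\<lambda>w. \<Sum>m\<in>line i z A w. lk m z", OF le]
      by linarith
    then have eq: "(\<Sum>m\<in>line i z ?C w. lk m z) = (\<Sum>m\<in>line i z A w. lk m z)"
      if "w \<in> strip i z ` mons X d" for w
      using sum_mono_inv[of "\<lambda>w. \<Sum>m\<in>line i z ?C w. lk m z" "strip i z ` mons X d" "\<lambda>w. \<Sum>m\<in>line i z A w. lk m z" w] le that assms(1)
      by simp
    have sub: "A \<subseteq> ?C"
    proof
      fix m assume m: "m \<in> A"
      let ?w = "strip i z m"
      have "?w \<in> strip i z ` mons X d" using m assms(5) by auto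
      then have "\<Sum>{..<card (line i z A ?w)} = \<Sum>((\<lambda>m. lk m z) ` line i z A ?w)"
        using trans[OF trans[OF C[of ?w, symmetric] eq[of ?w]] A[of ?w]] by blast
      then have "(\<lambda>m. lk m z) ` line i z A ?w = {..<card (line i z A ?w)}"
        using sum_nat_set[OF finite_imageI[OF fin[of ?w]], of "\<lambda>m. lk m z"] unfolding cA[of ?w] by blast
      moreover have "m \<in> line i z A ?w" using m by (simp add: line_def)
      ultimately have "lk m z < card (line i z A ?w)" by blast
      then show "m \<in> ?C" using m assms(5) by (auto simp: compress_def)
    qed
    have "finite ?C" using finite_subset[OF compress_subset finite_mons[OF assms(1)]] .
    then have "A = ?C" using sub card_compress[OF assms(1-5)] by (metis card_subset_eq)
    then show False using assms(6) by simp
  qed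
qed

lemma strip_add: "strip i z (m + p) = strip i z m + strip i z p"
  by (rule poly_mapping_eqI) (simp add: lookup_strip lookup_add)

lemma strip_var: "strip i z (var j) = (if j = i \<or> j = z then 0 else var j)"
  by (rule poly_mapping_eqI) (auto simp: lookup_strip lookup_single when_def)

text \<open>
  Both sides are compressed, hence compared line by line through the number of their points. A
  variable other than \<open>i\<close> and \<open>z\<close> carries the \<open>c\<close> points of one line of \<open>A\<close> into another line, whereas
  \<open>i\<close> and \<open>z\<close> together produce at least \<open>c + 1\<close> points: the line multiplied by \<open>z\<close>, and its lowest point
  multiplied by \<open>i\<close>. A compressed line needs no more than these numbers.
\<close>

lemma grow_compress:
  assumes "finite X" "i \<noteq> z" "i \<in> X" "z \<in> X" "A \<subseteq> mons X d"
  shows "grow X (compress X d i z A) \<subseteq> compress X (Suc d) i z (grow X A)"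
proof
  fix v assume "v \<in> grow X (compress X d i z A)"
  then obtain m j where m: "m \<in> compress X d i z A" "j \<in> X" and v: "v = m + var j" by (auto elim: growE)
  let ?F = "line i z A (strip i z m)" and ?G = "line i z (grow X A) (strip i z v)"
  have finA: "finite A" by (rule finite_subset[OF assms(5) finite_mons[OF assms(1)]])
  have finF: "finite ?F" by (rule finite_subset[OF line_subset finA])
  have finG: "finite ?G" by (rule finite_subset[OF line_subset finite_grow[OF assms(1) finA]])
  have mz: "lk m z < card ?F" using m by (simp add: compress_def)
  have vX: "v \<in> mons X (Suc d)" using m v by (auto simp: compress_def intro: mons_add_var)
  have img: "(\<lambda>m'. m' + var j) ` ?F \<subseteq> ?G"
    using m(2) v by (auto simp: line_def strip_add intro: growI)
  have cimg: "card ((\<lambda>m'. m' + var j) ` ?F) = card ?F"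
    by (rule card_image) (simp add: inj_on_def)
  have "lk v z < card ?G"
  proof (cases "j = z")
    case False
    then have "lk v z = lk m z" using v by (simp add: lookup_add lookup_single)
    also have "\<dots> < card ?F" by (rule mz)
    also have "\<dots> \<le> card ?G" using card_mono[OF finG img] cimg by simp
    finally show ?thesis .
  next
    case True
    have ne: "?F \<noteq> {}" using mz by auto
    define q where "q = Min ((\<lambda>m. lk m z) ` ?F)"
    have "q \<in> (\<lambda>m. lk m z) ` ?F" unfolding q_def using ne finF by (intro Min_in) auto
    then obtain p where p: "p \<in> ?F" "lk p z = q" by auto
    have qm: "q \<le> lk m' z" if "m' \<in> ?F" for m' unfolding q_def using that finF by (intro Min_le) auto
    have "strip i z v = strip i z m" using v True by (simp add: strip_add strip_var)
    then have "p + var i \<in> ?G"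
      using p assms(3) by (auto simp: line_def strip_add strip_var intro: growI)
    moreover have "p + var i \<notin> (\<lambda>m'. m' + var j) ` ?F"
    proof
      assume "p + var i \<in> (\<lambda>m'. m' + var j) ` ?F"
      then obtain m' where m': "m' \<in> ?F" "p + var i = m' + var j" by auto
      have "lk (p + var i) z = q" using p assms(2) by (simp add: lookup_add lookup_single)
      moreover have "lk (m' + var j) z = Suc (lk m' z)" using True by (simp add: lookup_add)
      ultimately show False using m' qm[of m'] by simp
    qed
    ultimately have "card (insert (p + var i) ((\<lambda>m'. m' + var j) ` ?F)) \<le> card ?G"
      using img finG by (intro card_mono) auto
    moreover have "card (insert (p + var i) ((\<lambda>m'. m' + var j) ` ?F)) = Suc (card ?F)"
      using \<open>p + var i \<notin> _\<close> finF cimg by simp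
    moreover have "lk v z = Suc (lk m z)" using v True by (simp add: lookup_add)
    ultimately show ?thesis using mz by simp
  qed
  then show "v \<in> compress X (Suc d) i z (grow X A)" using vX by (simp add: compress_def)
qed

text \<open>
  The exchange property of strongly stable sets, demanded for the variable \<open>z\<close> only.
\<close>

definition exch_stable :: "nat set \<Rightarrow> nat \<Rightarrow> expo set \<Rightarrow> bool" where
  "exch_stable X z A \<longleftrightarrow> (\<forall>m. \<forall>i\<in>X. m + var z \<in> A \<longrightarrow> m + var i \<in> A)"

text \<open>
  Compress along the lines of \<open>i\<close> and \<open>z\<close>, for varying \<open>i\<close>, until nothing moves; the potential makes
  this terminate. A set that is fixed by all these compressions has the exchange property.
\<close>

lemma stable_exists:
  assumes X: "finite X" "z \<in> X" and "A \<subseteq> mons X d"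
  shows "\<exists>A'. A' \<subseteq> mons X d \<and> card A' = card A \<and> card (grow X A') \<le> card (grow X A) \<and> exch_stable X z A'"
  using assms(3)
proof (induction "\<Sum>m\<in>A. lk m z" arbitrary: A rule: less_induct)
  case less
  show ?case
  proof (cases "\<exists>i\<in>X. i \<noteq> z \<and> compress X d i z A \<noteq> A")
    case True
    then obtain i where i: "i \<in> X" "i \<noteq> z" "compress X d i z A \<noteq> A" by blast
    let ?C = "compress X d i z A"
    have "(\<Sum>m\<in>?C. lk m z) < (\<Sum>m\<in>A. lk m z)" using compress_potential[OF X(1) i(2,1) X(2) less.prems i(3)] .
    from less.hyps[OF this compress_subset] obtain A' where A': "A' \<subseteq> mons X d" "card A' = card ?C"
      "card (grow X A') \<le> card (grow X ?C)" "exch_stable X z A'" by blast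
    have "card (grow X ?C) \<le> card (compress X (Suc d) i z (grow X A))"
      using grow_compress[OF X(1) i(2,1) X(2) less.prems] finite_subset[OF compress_subset finite_mons[OF X(1)]]
      by (intro card_mono)
    also have "\<dots> = card (grow X A)"
      by (rule card_compress[OF X(1) i(2,1) X(2) grow_subset_mons[OF less.prems]])
    finally show ?thesis using A' card_compress[OF X(1) i(2,1) X(2) less.prems] by (metis order_trans)
  next
    case False
    have "exch_stable X z A"
      unfolding exch_stable_def
    proof (intro allI ballI impI)
      fix m i assume i: "i \<in> X" and m: "m + var z \<in> A"
      show "m + var i \<in> A"
      proof (cases "i = z")
        case True then show ?thesis using m by simp
      next
        case iz: False
        then have C: "compress X d i z A = A" using False i by blast
        have "m + var z \<in> mons X d" using m less.prems by blast
        then have mX: "m + var i \<in> mons X d" using i by (auto simp: mons_def keys_plus_expo)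
        have "lk (m + var z) z < card (line i z A (strip i z (m + var z)))"
          using m C by (auto simp: compress_def)
        then have "lk (m + var i) z < card (line i z A (strip i z (m + var i)))"
          using iz by (auto simp: strip_add strip_var lookup_add lookup_single)
        then have "m + var i \<in> compress X d i z A" using mX by (simp add: compress_def)
        then show ?thesis using C by simp
      qed
    qed
    then show ?thesis using less.prems by blast
  qed
qed

text \<open>
  By exchange, whatever in the shadow arises from a multiple of \<open>z\<close> is \<open>z\<close> times an element of \<open>A\<close>, so only
  the \<open>z\<close>-free elements contribute new monomials. This reduces the counting of shadows to one variable
  fewer.
\<close>

lemma card_grow_stable:
  assumes X: "finite X" "z \<in> X" and A: "A \<subseteq> mons X d" "exch_stable X z A"
  shows "card (grow X A) = card A + card (grow (X - {z}) {m\<in>A. lk m z = 0})"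
proof -
  let ?B = "grow (X - {z}) {m\<in>A. lk m z = 0}" and ?Z = "(\<lambda>m. m + var z) ` A"
  have fin: "finite A" by (rule finite_subset[OF A(1) finite_mons[OF X(1)]])
  have "grow X A = ?Z \<union> ?B"
  proof
    show "?Z \<union> ?B \<subseteq> grow X A" using X(2) by (auto simp: grow_def)
    show "grow X A \<subseteq> ?Z \<union> ?B"
    proof
      fix v assume "v \<in> grow X A"
      then obtain m i where m: "m \<in> A" "i \<in> X" "v = m + var i" by (auto elim: growE)
      show "v \<in> ?Z \<union> ?B"
      proof (cases "i = z \<or> lk m z = 0")
        case True
        then show ?thesis using m by (auto intro!: growI)
      next
        case False
        then have "m - var z + var z = m" by (intro minus_plus_single) simp
        moreover have "m - var z + var i \<in> A"
          using A(2) m \<open>m - var z + var z = m\<close> unfolding exch_stable_def by metis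
        ultimately have "v = (m - var z + var i) + var z" using m(3) by (metis add.assoc add.commute)
        then show ?thesis using \<open>m - var z + var i \<in> A\<close> by blast
      qed
    qed
  qed
  moreover have "?Z \<inter> ?B = {}"
  proof (rule equals0I)
    fix v assume "v \<in> ?Z \<inter> ?B"
    then have vZ: "v \<in> ?Z" and vB: "v \<in> ?B" by auto
    from vZ have "lk v z \<noteq> 0" by (auto simp: lookup_add)
    moreover from vB have "lk v z = 0" by (elim growE) (auto simp: lookup_add lookup_single)
    ultimately show False by simp
  qed
  moreover have "card ?Z = card A" by (rule card_image) (simp add: inj_on_def)
  moreover have "finite ?B" using X(1) fin by simp
  ultimately show ?thesis using fin by (simp add: card_Un_disjoint)
qed

section \<open>Macaulay's theorem\<close>

lemma card_image_plus: "card ((\<lambda>m. m + p) ` A) = card (A :: expo set)"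
  by (rule card_image) (simp add: inj_on_def)

lemma card_layers:
  fixes F :: "nat \<Rightarrow> expo set"
  assumes "finite E" "\<And>e. e \<in> E \<Longrightarrow> finite (F e)" and z: "\<And>e v. e \<in> E \<Longrightarrow> v \<in> F e \<Longrightarrow> lk v z = 0"
  shows "card (\<Union>e\<in>E. (\<lambda>m. m + xpow z e) ` F e) = (\<Sum>e\<in>E. card (F e))"
proof -
  have lz: "lk u z = e" if "e \<in> E" "u \<in> (\<lambda>m. m + xpow z e) ` F e" for u e
    using that z[of e] by (auto simp: lookup_add)
  have "card (\<Union>e\<in>E. (\<lambda>m. m + xpow z e) ` F e)
      = (\<Sum>e\<in>E. card ((\<lambda>m. m + xpow z e) ` F e))"
  proof (rule card_UN_disjoint[OF assms(1)])
    show "\<forall>e\<in>E. finite ((\<lambda>m. m + xpow z e) ` F e)" using assms(2) by simp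
    show "\<forall>e\<in>E. \<forall>e'\<in>E. e \<noteq> e' \<longrightarrow>
      (\<lambda>m. m + xpow z e) ` F e \<inter> (\<lambda>m. m + xpow z e') ` F e' = {}"
    proof (intro ballI impI equals0I)
      fix e e' v assume "e \<in> E" "e' \<in> E" "e \<noteq> e'"
        "v \<in> (\<lambda>m. m + xpow z e) ` F e \<inter> (\<lambda>m. m + xpow z e') ` F e'"
      then show False using lz[of e v] lz[of e' v] by simp
    qed
  qed
  then show ?thesis by (simp add: card_image_plus)
qed

lemma stable_lexset:
  assumes "finite X" "lexset X d L" "z \<in> X" "\<And>i. i \<in> X \<Longrightarrow> i \<le> z"
  shows "exch_stable X z L"
  unfolding exch_stable_def
proof (intro allI ballI impI)
  fix m i assume i: "i \<in> X" and m: "m + var z \<in> L"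
  show "m + var i \<in> L"
  proof (cases "i = z")
    case True
    then show ?thesis using m by simp
  next
    case False
    then have iz: "i < z" using assms(4)[OF i] by simp
    have "m + var z < m + var i"
      by (rule less_expoI[of i]) (use iz in \<open>auto simp: lookup_add lookup_single\<close>)
    moreover have "m + var i \<in> mons X d"
      using lexset_mons[OF assms(2) m] i by (auto simp: mons_def keys_plus_expo)
    ultimately show ?thesis using lexsetD[OF assms(2) m] by simp
  qed
qed

lemma lexset_free_part:
  assumes "lexset X d L"
  shows "lexset (X - {z}) d {m\<in>L. lk m z = 0}"
  unfolding lexset_def
proof (intro conjI ballI impI)
  show "{m\<in>L. lk m z = 0} \<subseteq> mons (X - {z}) d"
    using lexset_mons[OF assms] by (auto simp: mons_def in_keys_iff)
  fix p q assume p: "p \<in> {m\<in>L. lk m z = 0}" and q: "q \<in> mons (X - {z}) d" and pq: "p < q"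
  have "q \<in> mons X d" "lk q z = 0" using q by (auto simp: mons_def in_keys_iff)
  then show "q \<in> {m\<in>L. lk m z = 0}" using lexsetD[OF assms _ _ pq] p by simp
qed

text \<open>
  Slice \<open>A\<close> by the exponent of \<open>z\<close> and replace every slice by a lex segment \<open>B e\<close> of the same size. The
  exchange property and Macaulay's theorem for the remaining variables (the hypothesis \<open>IH\<close>) keep the
  slices nested, in the sense that multiplying an element of \<open>B e\<close> by \<open>e\<close> variables leads into \<open>B 0\<close>. If
  \<open>B 0\<close> were smaller than the \<open>z\<close>-free part of \<open>L\<close>, it would miss some \<open>z\<close>-free \<open>w \<in> L\<close>. Then each monomial of the
  new set \<open>T\<close> is lex-larger than \<open>w\<close>, as can be tested after replacing \<open>z\<close> by the last remaining variable. So
  \<open>L\<close> contains \<open>T\<close> and \<open>w\<close>, which is one element too many.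
\<close>

lemma stable_free_part_card:
  assumes X: "finite X" "z \<in> X" "\<And>i. i \<in> X \<Longrightarrow> i \<le> z"
    and IH: "\<And>A L d. A \<subseteq> mons (X - {z}) d \<Longrightarrow> lexset (X - {z}) d L \<Longrightarrow> card L \<le> card A \<Longrightarrow>
          card (grow (X - {z}) L) \<le> card (grow (X - {z}) A)"
    and A: "A \<subseteq> mons X d" "exch_stable X z A"
    and L: "lexset X d L" "card L \<le> card A"
  shows "card {m\<in>L. lk m z = 0} \<le> card {m\<in>A. lk m z = 0}"
proof (rule ccontr)
  assume "\<not> ?thesis"
  then have less: "card {m\<in>A. lk m z = 0} < card {m\<in>L. lk m z = 0}" by simp
  define Y where "Y = X - {z}"
  have finY: "finite Y" using X by (simp add: Y_def)
  have zY: "z \<notin> Y" by (simp add: Y_def)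
  have finA: "finite A" by (rule finite_subset[OF A(1) finite_mons[OF X(1)]])
  define S where "S e = {m. lk m z = 0 \<and> m + xpow z e \<in> A}" for e
  have S_mons: "S e \<subseteq> mons Y (d - e)" if "e \<le> d" for e
  proof
    fix m assume m: "m \<in> S e"
    then have "m + xpow z e \<in> mons X d" using A(1) by (auto simp: S_def)
    moreover have "z \<notin> supp m" using m by (simp add: S_def in_keys_iff)
    ultimately show "m \<in> mons Y (d - e)" by (auto simp: mons_def Y_def keys_plus_expo)
  qed
  have S_grow: "grow Y (S (Suc e)) \<subseteq> S e" for e
  proof
    fix v assume "v \<in> grow Y (S (Suc e))"
    then obtain m i where m: "m \<in> S (Suc e)" "i \<in> Y" "v = m + var i" by (auto elim: growE)
    have "m + xpow z e + var z \<in> A"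
      using m(1) by (simp add: S_def add.assoc flip: single_add)
    then have "m + xpow z e + var i \<in> A"
      using A(2) m(2) unfolding exch_stable_def Y_def by blast
    then have "v + xpow z e \<in> A" using m(3) by (simp add: ac_simps)
    moreover have "i \<noteq> z" using m(2) zY by auto
    ultimately show "v \<in> S e" using m by (simp add: S_def lookup_add lookup_single)
  qed
  have "\<exists>B. lexset Y (d - e) B \<and> card B = card (S e)" if "e \<le> d" for e
    by (rule lexset_exists[OF finY card_mono[OF finite_mons[OF finY] S_mons[OF that]]])
  then obtain B where B: "\<And>e. e \<le> d \<Longrightarrow> lexset Y (d - e) (B e)" "\<And>e. e \<le> d \<Longrightarrow> card (B e) = card (S e)"
    by metis
  have B_grow: "grow Y (B (Suc e)) \<subseteq> B e" if e: "Suc e \<le> d" for e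
  proof (rule lexset_subset[OF finY])
    have sd: "Suc (d - Suc e) = d - e" using e by simp
    show "lexset Y (d - e) (grow Y (B (Suc e)))" using grow_lexset[OF finY B(1)[OF e]] sd by simp
    show "lexset Y (d - e) (B e)" using B(1)[of e] e by simp
    have "card (grow Y (B (Suc e))) \<le> card (grow Y (S (Suc e)))"
      unfolding Y_def by (rule IH) (use S_mons[OF e] B(1)[OF e] B(2)[OF e] in \<open>auto simp: Y_def\<close>)
    also have "\<dots> \<le> card (S e)"
    proof (rule card_mono[OF _ S_grow])
      show "finite (S e)" using finite_subset[OF S_mons finite_mons[OF finY], of e] e by simp
    qed
    finally show "card (grow Y (B (Suc e))) \<le> card (B e)" using B(2)[of e] e by simp
  qed
  have B_down: "v + xpow y e \<in> B 0" if "e \<le> d" "v \<in> B e" "y \<in> Y" for v y e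
    using that
  proof (induction e arbitrary: v)
    case 0
    then show ?case by simp
  next
    case (Suc e)
    have "v + var y \<in> B e" using B_grow[OF Suc.prems(1)] growI[OF Suc.prems(2,3)] by blast
    then have "v + var y + xpow y e \<in> B 0" using Suc by simp
    then show ?case by (simp add: add.assoc flip: single_add)
  qed
  have B_mons: "v \<in> mons Y (d - e)" if "e \<le> d" "v \<in> B e" for v e
    by (rule lexset_mons[OF B(1)[OF that(1)] that(2)])
  have L0: "lexset Y d {m\<in>L. lk m z = 0}" unfolding Y_def by (rule lexset_free_part[OF L(1)])
  have "card (S 0) = card {m\<in>A. lk m z = 0}" by (rule arg_cong[of _ _ card]) (auto simp: S_def)
  then have "card (B 0) < card {m\<in>L. lk m z = 0}" using less B(2)[of 0] by simp
  then have "\<not> {m\<in>L. lk m z = 0} \<subseteq> B 0"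
    using card_mono[OF lexset_finite[OF finY B(1)[of 0]], of "{m\<in>L. lk m z = 0}"] by linarith
  then obtain w where w: "w \<in> L" "lk w z = 0" "w \<notin> B 0" by blast
  have wY: "w \<in> mons Y d" using lexset_mons[OF L0] w by simp
  have gt: "w < v + xpow z e" if e: "e \<le> d" and v: "v \<in> B e" for e v
  proof (cases "e = 0")
    case True
    then have "v \<in> B 0" using v by simp
    then have "\<not> v < w" "v \<noteq> w" using lexsetD[OF B(1)[of 0], of v w] wY w(3) by auto
    then show ?thesis using True by simp
  next
    case False
    then have "d \<noteq> 0" using e by simp
    then have "w \<noteq> 0" using wY by (auto simp: mons_def)
    then have "Y \<noteq> {}" using wY keys_eq_empty[of w] by (auto simp: mons_def)
    define y where "y = Max Y"
    have y: "y \<in> Y" "\<And>i. i \<in> Y \<Longrightarrow> i \<le> y" unfolding y_def using finY \<open>Y \<noteq> {}\<close> by auto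
    have yz: "y < z" using X(3)[of y] y(1) zY by (cases "y = z") (auto simp: Y_def)
    let ?u = "v + xpow y e"
    have u: "?u \<in> B 0" by (rule B_down[OF e v y(1)])
    then have "\<not> ?u < w" "?u \<noteq> w" using lexsetD[OF B(1)[of 0], of ?u w] wY w(3) by auto
    then have "w < ?u" by simp
    then obtain p where p: "lk w p < lk ?u p" "\<forall>j<p. lk w j = lk ?u j" unfolding less_expo_iff by blast
    have uY: "?u \<in> mons Y d" using B_mons[of 0, OF _ u] by simp
    have pY: "p \<in> Y" using p(1) uY by (auto simp: mons_def in_keys_iff subset_iff)
    \<comment> \<open>A first difference at the last variable \<open>y\<close> would contradict the equality of degrees.\<close>
    have "p \<noteq> y"
    proof
      assume py: "p = y"
      have "mdegree w = (\<Sum>i\<in>Y. lk w i)"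
        by (rule mdegree_eq_sum[OF finY]) (use wY in \<open>simp add: mons_def\<close>)
      moreover have "mdegree ?u = (\<Sum>i\<in>Y. lk ?u i)"
        by (rule mdegree_eq_sum[OF finY]) (use uY in \<open>simp add: mons_def\<close>)
      moreover have "(\<Sum>i\<in>Y. lk w i) < (\<Sum>i\<in>Y. lk ?u i)"
      proof (rule sum_strict_mono_ex1[OF finY])
        show "\<forall>i\<in>Y. lk w i \<le> lk ?u i" using p py y(2) by (metis le_less order_refl)
        show "\<exists>i\<in>Y. lk w i < lk ?u i" using p(1) pY by blast
      qed
      ultimately show False using wY uY by (simp add: mons_def)
    qed
    then have "p < y" using y(2)[OF pY] by simp
    then show ?thesis unfolding less_expo_iff using p yz
      by (intro exI[of _ p]) (auto simp: lookup_add lookup_single)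
  qed
  define T where "T = (\<Union>e\<in>{..d}. (\<lambda>m. m + xpow z e) ` B e)"
  have vz: "lk v z = 0" if "e \<le> d" "v \<in> B e" for v e
    using B_mons[OF that] zY by (auto simp: mons_def in_keys_iff subset_iff)
  have vz': "lk v z = 0" if "v \<in> S e" for v e using that by (simp add: S_def)
  have "card T = (\<Sum>e\<in>{..d}. card (B e))"
    unfolding T_def by (rule card_layers) (use lexset_finite[OF finY B(1)] vz in auto)
  also have "\<dots> = (\<Sum>e\<in>{..d}. card (S e))" using B(2) by (intro sum.cong) auto
  also have "\<dots> = card (\<Union>e\<in>{..d}. (\<lambda>m. m + xpow z e) ` S e)"
    by (rule card_layers[symmetric]) (use finite_subset[OF S_mons finite_mons[OF finY]] vz' in auto)
  also have "(\<Union>e\<in>{..d}. (\<lambda>m. m + xpow z e) ` S e) = A"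
  proof
    show "(\<Union>e\<in>{..d}. (\<lambda>m. m + xpow z e) ` S e) \<subseteq> A" by (auto simp: S_def)
    show "A \<subseteq> (\<Union>e\<in>{..d}. (\<lambda>m. m + xpow z e) ` S e)"
    proof
      fix m assume m: "m \<in> A"
      let ?e = "lk m z" and ?m = "m - xpow z (lk m z)"
      have m1: "?m + xpow z ?e = m" by (rule minus_plus_single) simp
      have e: "?e \<in> {..d}" using lk_le_mdegree[of m z] m A(1) by (auto simp: mons_def)
      have "?m \<in> S ?e" using m unfolding S_def m1 mem_Collect_eq by (simp add: lookup_minus m1)
      then have "m \<in> (\<lambda>m. m + xpow z ?e) ` S ?e"
        by (rule image_eqI[rotated]) (rule m1[symmetric])
      then show "m \<in> (\<Union>e\<in>{..d}. (\<lambda>m. m + xpow z e) ` S e)"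
        using e by (rule UN_I[rotated])
    qed
  qed
  finally have cT: "card T = card A" .
  have "T \<subseteq> L"
  proof
    fix u assume "u \<in> T"
    then obtain e v where e: "e \<le> d" "v \<in> B e" "u = v + xpow z e" by (auto simp: T_def)
    have "u \<in> mons X d"
      using B_mons[OF e(1,2)] e X(2) by (auto simp: mons_def Y_def keys_plus_expo)
    then show "u \<in> L" using lexsetD[OF L(1) w(1)] gt[OF e(1,2)] e(3) by simp
  qed
  moreover have "w \<notin> T" using gt by (auto simp: T_def)
  ultimately have "insert w T \<subseteq> L" using w(1) by simp
  then have "card (insert w T) \<le> card L" using lexset_finite[OF X(1) L(1)] by (rule card_mono[rotated])
  moreover have "finite T" using \<open>T \<subseteq> L\<close> lexset_finite[OF X(1) L(1)] by (rule finite_subset)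
  ultimately show False using cT L(2) \<open>w \<notin> T\<close> by simp
qed

text \<open>
  Macaulay's theorem: lex segments have the smallest shadows. Replace \<open>A\<close> by a set with the exchange
  property for the last variable \<open>z\<close>. Lex segments have it as well, so both shadows are counted by
  \<open>card_grow_stable\<close>, and the \<open>z\<close>-free parts are compared by induction on the number of variables.
\<close>

theorem macaulay:
  assumes "finite X" "A \<subseteq> mons X d" "lexset X d L" "card L \<le> card A"
  shows "card (grow X L) \<le> card (grow X A)"
  using assms
proof (induction "card X" arbitrary: X A L d)
  case 0
  then show ?case by (simp add: grow_def)
next
  case (Suc k)
  define z where "z = Max X"
  have "X \<noteq> {}" using Suc.hyps(2) by auto
  then have z: "z \<in> X" "\<And>i. i \<in> X \<Longrightarrow> i \<le> z" unfolding z_def using Suc.prems(1) by auto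
  have k: "k = card (X - {z})" using Suc.hyps(2) z(1) Suc.prems(1) by simp
  have IH: "card (grow (X - {z}) L) \<le> card (grow (X - {z}) A)"
    if "A \<subseteq> mons (X - {z}) d" "lexset (X - {z}) d L" "card L \<le> card A" for A L d
    by (rule Suc.hyps(1)[OF k]) (use that Suc.prems(1) in auto)
  obtain A' where A': "A' \<subseteq> mons X d" "card A' = card A" "card (grow X A') \<le> card (grow X A)" "exch_stable X z A'"
    using stable_exists[OF Suc.prems(1) z(1) Suc.prems(2)] by blast
  have stL: "exch_stable X z L" by (rule stable_lexset[OF Suc.prems(1,3) z])
  have c0: "card {m\<in>L. lk m z = 0} \<le> card {m\<in>A'. lk m z = 0}"
    by (rule stable_free_part_card[OF Suc.prems(1) z IH A'(1,4) Suc.prems(3)])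
       (use A'(2) Suc.prems(4) in auto)
  have "card (grow X L) = card L + card (grow (X - {z}) {m\<in>L. lk m z = 0})"
    by (rule card_grow_stable[where d = d, OF Suc.prems(1) z(1) _ stL]) (use Suc.prems(3) in \<open>simp add: lexset_def\<close>)
  also have "\<dots> \<le> card A' + card (grow (X - {z}) {m\<in>A'. lk m z = 0})"
  proof (rule add_mono)
    show "card L \<le> card A'" using A'(2) Suc.prems(4) by simp
    show "card (grow (X - {z}) {m\<in>L. lk m z = 0}) \<le> card (grow (X - {z}) {m\<in>A'. lk m z = 0})"
      by (rule IH[OF _ lexset_free_part[OF Suc.prems(3)] c0])
         (use A'(1) in \<open>auto simp: mons_def in_keys_iff subset_iff\<close>)
  qed
  also have "\<dots> = card (grow X A')"
    by (rule card_grow_stable[OF Suc.prems(1) z(1) A'(1,4), symmetric])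
  finally show ?case using A'(3) by simp
qed

section \<open>The growth function of lex segments\<close>

text \<open>
  The number of monomials of degree \<open>k - 1\<close>, and 0 for \<open>k = 0\<close>. With this shift, \<open>pcount n (Suc d - e)\<close> counts the
  multiples of the \<open>e\<close>-th power of a variable in degree \<open>d\<close>, also when \<open>e > d\<close>.
\<close>

definition pcount :: "nat \<Rightarrow> nat \<Rightarrow> nat" where
  "pcount n k = (case k of 0 \<Rightarrow> 0 | Suc j \<Rightarrow> card (mons {..<n} j))"

text \<open>
  The smallest shadow of \<open>N\<close> monomials of equal degree. The minimum ranges over all degrees, which makes
  it a function of \<open>N\<close> alone; it is attained by lex segments of any degree that has room for them
  (\<open>growth_lexset\<close>).
\<close>

definition growth :: "nat \<Rightarrow> nat \<Rightarrow> nat" where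
  "growth n N = (LEAST c. \<exists>d A. A \<subseteq> mons {..<n} d \<and> card A = N \<and> c = card (grow {..<n} A))"

lemma pcount_0 [simp]: "pcount n 0 = 0" and pcount_Suc [simp]: "pcount n (Suc j) = card (mons {..<n} j)"
  by (simp_all add: pcount_def)

lemma card_mons_ge:
  assumes "n \<ge> 2" shows "Suc d \<le> card (mons {..<n} d)"
proof -
  let ?f = "\<lambda>i. xpow (0::nat) (d - i) + xpow 1 i"
  have "inj_on ?f {..d}"
  proof (rule inj_onI)
    fix i j assume "?f i = ?f j"
    then have "lk (?f i) 1 = lk (?f j) 1" by simp
    then show "i = j" by (simp add: lookup_add lookup_single)
  qed
  moreover have "?f ` {..d} \<subseteq> mons {..<n} d"
  proof
    fix m assume "m \<in> ?f ` {..d}"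
    then obtain i where i: "i \<le> d" "m = ?f i" by auto
    have "?f i \<in> mons {..<n} ((d - i) + i)" by (intro mons_add mons_single) (use assms in auto)
    then show "m \<in> mons {..<n} d" using i by simp
  qed
  ultimately have "card {..d} \<le> card (mons {..<n} d)" by (intro card_inj_on_le) auto
  then show ?thesis by simp
qed

lemma card_mons_pos: "n \<ge> 1 \<Longrightarrow> 1 \<le> card (mons {..<n} d)"
proof -
  assume "n \<ge> 1"
  then have "xpow 0 d \<in> mons {..<n} d" by (intro mons_single) auto
  then have "mons {..<n} d \<noteq> {}" by blast
  then show ?thesis using finite_mons[of "{..<n}" d] by (simp add: Suc_le_eq card_gt_0_iff)
qed

lemma card_mons_mono:
  assumes "n \<ge> 1" "c \<le> d" shows "card (mons {..<n} c) \<le> card (mons {..<n} d)"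
proof -
  have "(\<lambda>m. m + xpow 0 (d - c)) ` mons {..<n} c \<subseteq> mons {..<n} d"
  proof
    fix v assume "v \<in> (\<lambda>m. m + xpow 0 (d - c)) ` mons {..<n} c"
    then obtain m where m: "m \<in> mons {..<n} c" "v = m + xpow 0 (d - c)" by auto
    have "m + xpow 0 (d - c) \<in> mons {..<n} (c + (d - c))"
      using m assms by (intro mons_add mons_single) auto
    then show "v \<in> mons {..<n} d" using m assms by simp
  qed
  then have "card ((\<lambda>m. m + xpow 0 (d - c)) ` mons {..<n} c) \<le> card (mons {..<n} d)"
    by (intro card_mono) auto
  then show ?thesis by (simp add: card_image_plus)
qed

lemma pcount_mono: "n \<ge> 1 \<Longrightarrow> j \<le> k \<Longrightarrow> pcount n j \<le> pcount n k"
  by (cases j; cases k) (auto intro: card_mons_mono)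

lemma pcount_eq_0: "n \<ge> 1 \<Longrightarrow> pcount n k = 0 \<longleftrightarrow> k = 0"
proof (cases k)
  case (Suc j)
  assume "n \<ge> 1"
  then have "card (mons {..<n} j) \<noteq> 0" using card_mons_pos[of n j] by linarith
  then show ?thesis unfolding Suc pcount_Suc by simp
qed simp

lemma grow_shift: "grow X ((\<lambda>m. m + p) ` A) = (\<lambda>m. m + p) ` grow X A"
  unfolding grow_def image_UN image_image by (simp add: ac_simps)

text \<open>
  A monomial that is lex-larger than a multiple of a power of \<open>x\<^sub>0\<close> is itself such a multiple. This is why
  lex segments of different degrees can be compared.
\<close>

lemma lexset_shift:
  assumes "lexset {..<n} d L" "n \<ge> 1"
  shows "lexset {..<n} (d + e) ((\<lambda>m. m + xpow 0 e) ` L)"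
  unfolding lexset_def
proof (intro conjI ballI impI)
  show "(\<lambda>m. m + xpow 0 e) ` L \<subseteq> mons {..<n} (d + e)"
    using lexset_mons[OF assms(1)] assms(2) by (auto intro!: mons_add mons_single)
  fix p q assume "p \<in> (\<lambda>m. m + xpow 0 e) ` L" and q: "q \<in> mons {..<n} (d + e)" and pq: "p < q"
  then obtain m where m: "m \<in> L" "p = m + xpow 0 e" by auto
  obtain i where i: "lk p i < lk q i" "\<forall>j<i. lk p j = lk q j" using pq unfolding less_expo_iff by blast
  have "lk p 0 \<le> lk q 0" using i by (cases "i = 0") auto
  then have e: "e \<le> lk q 0" using m by (simp add: lookup_add)
  let ?q = "q - xpow 0 e"
  have qe: "?q + xpow 0 e = q" by (rule minus_plus_single[OF e])
  have "?q \<in> mons {..<n} d" using mons_minus_single[OF q e] by simp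
  moreover have "m < ?q" using pq m(2) qe add_less_cancel_right[of m "xpow 0 e" ?q] by simp
  ultimately have "?q \<in> L" using lexsetD[OF assms(1) m(1)] by simp
  then show "q \<in> (\<lambda>m. m + xpow 0 e) ` L" by (rule image_eqI[rotated]) (rule qe[symmetric])
qed

lemma growth_le:
  assumes "A \<subseteq> mons {..<n} d" shows "growth n (card A) \<le> card (grow {..<n} A)"
  unfolding growth_def by (rule Least_le) (use assms in blast)

text \<open>
  Powers of \<open>x\<^sub>0\<close> bring a segment and an optimal set to a common degree without changing their shadows, and
  the segment remains one. There Macaulay's theorem applies.
\<close>

lemma growth_lexset:
  assumes n: "n \<ge> 1" and L: "lexset {..<n} d L"
  shows "growth n (card L) = card (grow {..<n} L)"
proof (rule antisym)
  show "growth n (card L) \<le> card (grow {..<n} L)"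
    by (rule growth_le[of _ _ d]) (use L in \<open>simp add: lexset_def\<close>)
  have "\<exists>c d A. A \<subseteq> mons {..<n} d \<and> card A = card L \<and> c = card (grow {..<n} A)"
    using L unfolding lexset_def by blast
  then have "\<exists>d A. A \<subseteq> mons {..<n} d \<and> card A = card L \<and> growth n (card L) = card (grow {..<n} A)"
    unfolding growth_def by (rule LeastI_ex)
  then obtain d' A where A: "A \<subseteq> mons {..<n} d'" "card A = card L" "growth n (card L) = card (grow {..<n} A)"
    by blast
  let ?L = "(\<lambda>m. m + xpow 0 d') ` L" and ?A = "(\<lambda>m. m + xpow 0 d) ` A"
  have A': "?A \<subseteq> mons {..<n} (d + d')"
  proof
    fix v assume "v \<in> ?A"
    then obtain m where m: "m \<in> A" "v = m + xpow 0 d" by auto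
    have "m + xpow 0 d \<in> mons {..<n} (d' + d)"
      using m A(1) n by (intro mons_add mons_single) auto
    then show "v \<in> mons {..<n} (d + d')" using m by (simp add: add.commute)
  qed
  have "card (grow {..<n} ?L) \<le> card (grow {..<n} ?A)"
    by (rule macaulay[OF _ A' lexset_shift[OF L n]]) (simp_all add: card_image_plus A(2))
  then show "card (grow {..<n} L) \<le> growth n (card L)"
    unfolding grow_shift card_image_plus A(3) .
qed

lemma growth_mono:
  assumes "n \<ge> 2" "a \<le> b" shows "growth n a \<le> growth n b"
proof -
  have n: "n \<ge> 1" using assms by simp
  have b: "b \<le> card (mons {..<n} b)" using card_mons_ge[OF assms(1), of b] by simp
  obtain L where L: "lexset {..<n} b L" "card L = b" using lexset_exists[OF _ b] by auto
  obtain L' where L': "lexset {..<n} b L'" "card L' = a" using lexset_exists[of "{..<n}" a b] b assms(2) by auto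
  have "L' \<subseteq> L" by (rule lexset_subset[OF _ L'(1) L(1)]) (use L L' assms in auto)
  then have "card (grow {..<n} L') \<le> card (grow {..<n} L)"
    using lexset_finite[OF _ L(1)] by (intro card_mono grow_mono) auto
  then show ?thesis using growth_lexset[OF n L(1)] growth_lexset[OF n L'(1)] L(2) L'(2) by simp
qed

lemma growth_0 [simp]: "growth n 0 = 0"
  using growth_le[of "{}" n 0] by (simp add: grow_def)

text \<open>
  The exchange of the first two variables turns a segment anchored at a power of \<open>x\<^sub>0\<close> into a set anchored at
  a power of \<open>x\<^sub>1\<close>. It is written as a sum so that its degree can be read off.
\<close>

definition swap01 :: "expo \<Rightarrow> expo" where
  "swap01 m = m - xpow 0 (lk m 0) - xpow 1 (lk m 1)
     + xpow 0 (lk m 1) + xpow 1 (lk m 0)"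

lemma lookup_swap01: "lk (swap01 m) i = (if i = 0 then lk m 1 else if i = 1 then lk m 0 else lk m i)"
  by (simp add: swap01_def lookup_add lookup_minus lookup_single)

lemma swap01_add: "swap01 (p + q) = swap01 p + swap01 q"
  by (simp add: expo_eq_iff lookup_swap01 lookup_add)

lemma swap01_swap01: "swap01 (swap01 p) = p"
  by (simp add: expo_eq_iff lookup_swap01)

lemma swap01_var: "swap01 (xpow i e) = xpow (if i = 0 then 1 else if i = 1 then 0 else i) e"
  by (auto simp: expo_eq_iff lookup_swap01 lookup_single when_def)

lemma mdegree_swap01: "mdegree (swap01 m) = mdegree m"
proof -
  let ?a = "xpow 0 (lk m 0)" and ?b = "xpow (1::nat) (lk m 1)"
  have "m = m - ?a - ?b + ?a + ?b" by (auto simp: expo_eq_iff lookup_add lookup_minus lookup_single when_def)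
  then have "mdegree m = mdegree (m - ?a - ?b) + lk m 0 + lk m 1"
    by (metis mdegree_add mdegree_single)
  then show ?thesis by (simp add: swap01_def)
qed

lemma swap01_mons:
  assumes "n \<ge> 2" "m \<in> mons {..<n} d" shows "swap01 m \<in> mons {..<n} d"
proof -
  have "supp (swap01 m) \<subseteq> {..<n}"
  proof
    fix i assume "i \<in> supp (swap01 m)"
    then have "lk (swap01 m) i \<noteq> 0" by (simp add: in_keys_iff)
    then have "i = 0 \<or> i = 1 \<or> i \<in> supp m" by (auto simp: lookup_swap01 in_keys_iff split: if_splits)
    then show "i \<in> {..<n}" using assms by (auto simp: mons_def)
  qed
  then show ?thesis using assms(2) by (simp add: mons_def mdegree_swap01)
qed

lemma grow_swap01:
  assumes "n \<ge> 2" shows "grow {..<n} (swap01 ` A) = swap01 ` grow {..<n} A"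
proof -
  have sub: "swap01 ` grow {..<n} B \<subseteq> grow {..<n} (swap01 ` B)" for B
  proof
    fix v assume "v \<in> swap01 ` grow {..<n} B"
    then obtain m i where m: "m \<in> B" "i < n" "v = swap01 (m + var i)" by (auto elim!: growE)
    have "v = swap01 m + var (if i = 0 then 1 else if i = 1 then 0 else i)"
      using m by (simp add: swap01_add swap01_var)
    moreover have "(if i = 0 then 1 else if i = 1 then 0 else i) \<in> {..<n}" using m assms by auto
    ultimately show "v \<in> grow {..<n} (swap01 ` B)" using m(1) growI by blast
  qed
  have "grow {..<n} (swap01 ` A) = swap01 ` swap01 ` grow {..<n} (swap01 ` A)"
    by (simp add: image_image swap01_swap01)
  also have "\<dots> \<subseteq> swap01 ` grow {..<n} (swap01 ` swap01 ` A)" using sub[of "swap01 ` A"] by (rule image_mono)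
  also have "\<dots> = swap01 ` grow {..<n} A" by (simp add: image_image swap01_swap01)
  finally show ?thesis using sub[of A] by blast
qed

lemma card_swap01: "card (swap01 ` A) = card A"
  by (rule card_image, rule inj_on_inverseI[of _ swap01]) (rule swap01_swap01)

lemma card_mons_divisible:
  assumes "i < n" "i' < n" "i \<noteq> i'"
  shows "card {m\<in>mons {..<n} d. e \<le> lk m i \<and> e' \<le> lk m i'} = pcount n (Suc d - (e + e'))"
proof (cases "e + e' \<le> d")
  case False
  have "{m\<in>mons {..<n} d. e \<le> lk m i \<and> e' \<le> lk m i'} = {}"
  proof (rule equals0I)
    fix m assume "m \<in> {m\<in>mons {..<n} d. e \<le> lk m i \<and> e' \<le> lk m i'}"
    then have "mdegree m = d" "e + e' \<le> lk m i + lk m i'" by (auto simp: mons_def)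
    then show False using lk_sum_le_mdegree[OF assms(3), of m] False by simp
  qed
  then show ?thesis using False by simp
next
  case True
  let ?p = "xpow i e + xpow i' e'"
  have "{m\<in>mons {..<n} d. e \<le> lk m i \<and> e' \<le> lk m i'} = (\<lambda>m. m + ?p) ` mons {..<n} (d - (e + e'))"
  proof
    show "(\<lambda>m. m + ?p) ` mons {..<n} (d - (e + e')) \<subseteq> {m\<in>mons {..<n} d. e \<le> lk m i \<and> e' \<le> lk m i'}"
    proof
      fix v assume "v \<in> (\<lambda>m. m + ?p) ` mons {..<n} (d - (e + e'))"
      then obtain m where m: "m \<in> mons {..<n} (d - (e + e'))" "v = m + ?p" by auto
      have "m + ?p \<in> mons {..<n} (d - (e + e') + (e + e'))"
        using m assms by (intro mons_add mons_single) auto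
      then show "v \<in> {m\<in>mons {..<n} d. e \<le> lk m i \<and> e' \<le> lk m i'}"
        using True m by (simp add: lookup_add)
    qed
    show "{m\<in>mons {..<n} d. e \<le> lk m i \<and> e' \<le> lk m i'} \<subseteq> (\<lambda>m. m + ?p) ` mons {..<n} (d - (e + e'))"
    proof
      fix m assume "m \<in> {m\<in>mons {..<n} d. e \<le> lk m i \<and> e' \<le> lk m i'}"
      then have m: "m \<in> mons {..<n} d" "e \<le> lk m i" "e' \<le> lk m i'" by auto
      let ?q = "m - xpow i e"
      have q: "?q \<in> mons {..<n} (d - e)" by (rule mons_minus_single[OF m(1,2)])
      have l: "e' \<le> lk ?q i'" using m assms(3) by (simp add: lookup_minus lookup_single)
      have "?q - xpow i' e' \<in> mons {..<n} (d - e - e')" by (rule mons_minus_single[OF q l])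
      moreover have "?q - xpow i' e' + ?p = m"
          using arg_cong[OF minus_plus_single[OF l], of "\<lambda>q. q + xpow i e"] minus_plus_single[OF m(2)]
        by (simp add: ac_simps)
      ultimately show "m \<in> (\<lambda>m. m + ?p) ` mons {..<n} (d - (e + e'))"
        by (intro image_eqI[of _ _ "?q - xpow i' e'"]) simp_all
    qed
  qed
  moreover have "Suc d - (e + e') = Suc (d - (e + e'))" using True by simp
  ultimately show ?thesis by (simp add: card_image_plus)
qed

text \<open>
  The multiples of a fixed power of \<open>x\<^sub>0\<close> form a lex segment.
\<close>

lemma lexset_top_block:
  assumes "n \<ge> 1" "lexset {..<n} d L" "card (mons {..<n} j) \<le> card L" "j \<le> d" "m \<in> mons {..<n} j"
  shows "m + xpow 0 (d - j) \<in> L"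
proof -
  have all: "lexset {..<n} j (mons {..<n} j)" by (simp add: lexset_def)
  have "lexset {..<n} (j + (d - j)) ((\<lambda>m. m + xpow 0 (d - j)) ` mons {..<n} j)"
    by (rule lexset_shift[OF all assms(1)])
  then have "lexset {..<n} d ((\<lambda>m. m + xpow 0 (d - j)) ` mons {..<n} j)"
    using assms(4) by simp
  then have "(\<lambda>m. m + xpow 0 (d - j)) ` mons {..<n} j \<subseteq> L"
    by (rule lexset_subset[rotated, OF _ assms(2)]) (simp_all add: card_image_plus assms(3))
  then show ?thesis using assms(5) by blast
qed

text \<open>
  Take lex segments \<open>P\<close> and \<open>Q\<close> of sizes \<open>U\<close> and \<open>V\<close> in a large degree \<open>d\<close>, anchored at powers of \<open>x\<^sub>0\<close> and, after
  a swap, of \<open>x\<^sub>1\<close>. Multiply the first by \<open>x\<^sub>1\<^sup>e\<close> and the second by \<open>x\<^sub>0\<^sup>e\<close>. A common monomial is a multiple of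
  \<open>x\<^sub>0\<^sup>e x\<^sub>1\<^sup>e\<close>, so for \<open>e = d + 1 - k\<close> the two sets share at most \<open>pcount n k\<close> monomials, whereas their shadows
  share all the \<open>pcount n (Suc k)\<close> multiples one degree higher. Bounding the shadow of the union from below
  by \<open>growth\<close> gives the claim.
\<close>

lemma growth_merge:
  assumes n: "n \<ge> 2" and U: "1 \<le> U" "pcount n k \<le> U" and V: "1 \<le> V" "pcount n k \<le> V"
  shows "growth n (U + V - pcount n k) + pcount n (Suc k) \<le> growth n U + growth n V"
proof -
  define d where "d = U + V + k"
  define e where "e = Suc d - k"
  have n1: "n \<ge> 1" and n01: "0 < n" "1 < n" using n by auto
  have ek: "e + k = Suc d" unfolding e_def d_def by simp
  let ?X = "{..<n}"
  have "U \<le> card (mons ?X d)" "V \<le> card (mons ?X d)"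
    using card_mons_ge[OF n, of d] by (simp_all add: d_def)
  then obtain P Q where P: "lexset ?X d P" "card P = U" and Q: "lexset ?X d Q" "card Q = V"
    using lexset_exists[of ?X U d] lexset_exists[of ?X V d] by auto
  let ?x = "xpow (0::nat) e" and ?y = "xpow (1::nat) e"
  let ?A = "(\<lambda>m. m + ?y) ` P" and ?B = "(\<lambda>m. m + ?x) ` (swap01 ` Q)"
  have Pm: "P \<subseteq> mons ?X d" and Qm: "Q \<subseteq> mons ?X d" using P Q by (simp_all add: lexset_def)
  have finP: "finite P" and finQ: "finite Q" using P Q lexset_finite[of ?X] by auto
  have A: "?A \<subseteq> mons ?X (d + e)"
    using Pm n by (auto intro!: mons_add mons_single)
  have B: "?B \<subseteq> mons ?X (d + e)"
    using Qm n by (auto intro!: mons_add mons_single swap01_mons)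
  have cA: "card ?A = U" by (simp add: card_image_plus P(2))
  have cB: "card ?B = V" by (simp add: card_image_plus card_swap01 Q(2))
  \<comment> \<open>Each segment contains all multiples of its anchor with a cofactor of degree \<open>k - 1\<close>, or just its
    first monomial if \<open>k = 0\<close>; in either case its shadow contains all cofactors of degree \<open>k\<close>.\<close>
  have block: "u + xpow 0 e \<in> grow ?X L"
    if L: "lexset ?X d L" "1 \<le> card L" "pcount n k \<le> card L" and u: "u \<in> mons ?X k" for L u
  proof (cases k)
    case 0
    have "0 + xpow 0 (d - 0) \<in> L"
      by (rule lexset_top_block[OF n1 L(1)]) (use L(2) in auto)
    then have "xpow 0 d + var 0 \<in> grow ?X L" using n by (intro growI) auto
    moreover have "xpow 0 d + var 0 = xpow 0 e" using 0 ek by (simp flip: single_add)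
    ultimately show ?thesis using u 0 by simp
  next
    case (Suc j)
    have "u \<in> grow ?X (mons ?X j)" using u Suc grow_mons[of ?X j] n1 by (simp add: lessThan_empty_iff)
    then obtain u' i where u': "u' \<in> mons ?X j" "i \<in> ?X" "u = u' + var i" by (rule growE)
    have "u' + xpow 0 (d - j) \<in> L"
      by (rule lexset_top_block[OF n1 L(1) _ _ u'(1)]) (use L(3) Suc in \<open>auto simp: d_def\<close>)
    then have "u' + xpow 0 (d - j) + var i \<in> grow ?X L" using u'(2) by (rule growI)
    moreover have "d - j = e" using ek Suc by simp
    ultimately show ?thesis using u'(3) by (simp add: ac_simps)
  qed
  have "?A \<inter> ?B \<subseteq> {m\<in>mons ?X (d + e). e \<le> lk m 0 \<and> e \<le> lk m 1}"
  proof
    fix m assume m: "m \<in> ?A \<inter> ?B"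
    then have "m \<in> mons ?X (d + e)" using A by blast
    moreover from m obtain p where "m = p + ?y" by blast
    then have "e \<le> lk m 1" by (simp add: lookup_add)
    moreover from m obtain q where "m = q + ?x" by blast
    then have "e \<le> lk m 0" by (simp add: lookup_add)
    ultimately show "m \<in> {m\<in>mons ?X (d + e). e \<le> lk m 0 \<and> e \<le> lk m 1}" by simp
  qed
  then have "card (?A \<inter> ?B) \<le> card {m\<in>mons ?X (d + e). e \<le> lk m 0 \<and> e \<le> lk m 1}"
    by (intro card_mono) auto
  also have "\<dots> = pcount n (Suc (d + e) - (e + e))"
    by (rule card_mons_divisible) (use n in auto)
  also have "Suc (d + e) - (e + e) = k" using ek by simp
  finally have cap: "card (?A \<inter> ?B) \<le> pcount n k" .
  have cup: "card (?A \<union> ?B) + card (?A \<inter> ?B) = U + V"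
    using card_Un_Int[of ?A ?B] finP finQ cA cB by simp
  have "growth n (U + V - pcount n k) \<le> growth n (card (?A \<union> ?B))"
    by (rule growth_mono[OF n]) (use cap cup in simp)
  also have "\<dots> \<le> card (grow ?X (?A \<union> ?B))"
    by (rule growth_le[of _ _ "d + e"]) (use A B in blast)
  finally have 1: "growth n (U + V - pcount n k) \<le> card (grow ?X (?A \<union> ?B))" .
  have gU: "grow ?X (?A \<union> ?B) = grow ?X ?A \<union> grow ?X ?B" by (auto simp: grow_def)
  have gA: "grow ?X ?A = (\<lambda>m. m + ?y) ` grow ?X P" by (rule grow_shift)
  have gB: "grow ?X ?B = (\<lambda>m. m + ?x) ` (swap01 ` grow ?X Q)"
    by (simp only: grow_shift grow_swap01[OF n])
  have cgA: "card (grow ?X ?A) = growth n U"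
    unfolding gA card_image_plus using growth_lexset[OF n1 P(1)] P(2) by simp
  have cgB: "card (grow ?X ?B) = growth n V"
    unfolding gB card_image_plus card_swap01 using growth_lexset[OF n1 Q(1)] Q(2) by simp
  have "(\<lambda>m. m + (?x + ?y)) ` mons ?X k \<subseteq> grow ?X ?A \<inter> grow ?X ?B"
  proof
    fix v assume "v \<in> (\<lambda>m. m + (?x + ?y)) ` mons ?X k"
    then obtain u where u: "u \<in> mons ?X k" "v = u + (?x + ?y)" by auto
    have "u + ?x \<in> grow ?X P" by (rule block[OF P(1)]) (use P(2) U u in auto)
    then have "(u + ?x) + ?y \<in> grow ?X ?A" unfolding gA by (rule imageI)
    moreover have "swap01 u + ?x \<in> grow ?X Q"
      by (rule block[OF Q(1)]) (use Q(2) V u swap01_mons[OF n] in auto)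
    then have "swap01 (swap01 u + ?x) + ?x \<in> grow ?X ?B" unfolding gB by (intro imageI)
    moreover have "swap01 (swap01 u + ?x) + ?x = v"
      using u(2) by (simp add: swap01_add swap01_swap01 swap01_var ac_simps)
    ultimately show "v \<in> grow ?X ?A \<inter> grow ?X ?B" using u(2) by (simp add: ac_simps)
  qed
  then have "card ((\<lambda>m. m + (?x + ?y)) ` mons ?X k) \<le> card (grow ?X ?A \<inter> grow ?X ?B)"
    using finP by (intro card_mono) auto
  then have 2: "pcount n (Suc k) \<le> card (grow ?X ?A \<inter> grow ?X ?B)"
    unfolding card_image_plus pcount_Suc .
  have "card (grow ?X ?A \<union> grow ?X ?B) + card (grow ?X ?A \<inter> grow ?X ?B) = growth n U + growth n V"
    using card_Un_Int[of "grow ?X ?A" "grow ?X ?B"] finP finQ cgA cgB by simp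
  then show ?thesis using 1 2 gU by simp
qed

text \<open>
  Merge the components with index 1, 2, \<open>\<dots>\<close> into component 0 one after the other by \<open>growth_merge\<close>. The
  lower bound of component 0 is the largest and is inherited by the merged component, so the overlap that
  is discarded is always available. In applications \<open>u\<close> and \<open>e\<close> belong to one degree, \<open>u'\<close> and \<open>e'\<close> to the next.
\<close>

lemma growth_sum:
  fixes u u' e e' :: "nat \<Rightarrow> nat"
  assumes n: "n \<ge> 2" and "0 < k"
    and g: "\<And>i. i < k \<Longrightarrow> growth n (u i) \<le> u' i"
    and lo: "\<And>i. i < k \<Longrightarrow> pcount n (e i) \<le> u i" "\<And>i. i < k \<Longrightarrow> pcount n (e' i) \<le> u' i"
    and ord: "\<And>i. i < k \<Longrightarrow> e i \<le> e 0" "\<And>i. i < k \<Longrightarrow> e' i \<le> e' 0"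
    and e': "\<And>i. i < k \<Longrightarrow> e' i = Suc (e i) \<or> e i = 0 \<and> e' i = 0"
  shows "\<exists>H H'. H + (\<Sum>i\<in>{1..<k}. pcount n (e i)) = (\<Sum>i<k. u i) \<and>
      H' + (\<Sum>i\<in>{1..<k}. pcount n (e' i)) = (\<Sum>i<k. u' i) \<and>
      growth n H \<le> H' \<and> pcount n (e 0) \<le> H \<and> pcount n (e' 0) \<le> H'"
  using assms(2-)
proof (induction k)
  case 0
  then show ?case by simp
next
  case (Suc k)
  show ?case
  proof (cases "k = 0")
    case True
    show ?thesis
      by (rule exI[of _ "u 0"], rule exI[of _ "u' 0"]) (use Suc.prems True in auto)
  next
    case False
    have n1: "n \<ge> 1" using n by simp
    obtain H H' where H: "H + (\<Sum>i\<in>{1..<k}. pcount n (e i)) = (\<Sum>i<k. u i)"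
      "H' + (\<Sum>i\<in>{1..<k}. pcount n (e' i)) = (\<Sum>i<k. u' i)"
      "growth n H \<le> H'" "pcount n (e 0) \<le> H" "pcount n (e' 0) \<le> H'"
      using Suc.IH Suc.prems False by (auto simp: less_Suc_eq)
    let ?p = "pcount n (e k)" and ?p' = "pcount n (e' k)"
    have pH: "?p \<le> H" using pcount_mono[OF n1 Suc.prems(5)[of k]] H(4) by simp
    have pH': "?p' \<le> H'" using pcount_mono[OF n1 Suc.prems(6)[of k]] H(5) by simp
    have pu: "?p \<le> u k" "?p' \<le> u' k" using Suc.prems by auto
    have gu: "growth n (u k) \<le> u' k" using Suc.prems by simp
    \<comment> \<open>An empty component has no anchor to overlap with, but then at most one monomial is discarded, and
      it is one that appears only in the next degree.\<close>
    have main: "growth n (u k + H - ?p) + ?p' \<le> u' k + H'"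
    proof (cases "u k = 0 \<or> H = 0")
      case True
      then have "?p = 0" using pu pH by auto
      then have ek: "e k = 0" using pcount_eq_0[OF n1] by simp
      then have "e' k = 1 \<or> e' k = 0" using Suc.prems(7)[of k] by auto
      then have "?p' \<le> 1" by auto
      show ?thesis using True
      proof
        assume "u k = 0"
        then show ?thesis using H(3) pu(2) ek by simp
      next
        assume "H = 0"
        then show ?thesis using gu pH' ek by simp
      qed
    next
      case nz: False
      show ?thesis
      proof (cases "e' k = Suc (e k)")
        case True
        then show ?thesis
          using growth_merge[OF n, of "u k" "e k" H] nz pu pH gu H(3) by simp
      next
        case False
        then have "e k = 0" "e' k = 0" using Suc.prems(7)[of k] by auto
        then show ?thesis
          using growth_merge[OF n, of "u k" 0 H] nz gu H(3) by simp
      qed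
    qed
    have k1: "{1..<Suc k} = insert k {1..<k}" using False by auto
    show ?thesis
    proof (intro exI conjI)
      show "u k + H - ?p + (\<Sum>i\<in>{1..<Suc k}. pcount n (e i)) = (\<Sum>i<Suc k. u i)"
        using H(1) pu pH k1 by simp
      show "u' k + H' - ?p' + (\<Sum>i\<in>{1..<Suc k}. pcount n (e' i)) = (\<Sum>i<Suc k. u' i)"
        using H(2) pu pH' k1 by simp
      show "growth n (u k + H - ?p) \<le> u' k + H' - ?p'" using main by simp
      show "pcount n (e 0) \<le> u k + H - ?p" using pu H(4) by simp
      show "pcount n (e' 0) \<le> u' k + H' - ?p'" using pu H(5) by simp
    qed
  qed
qed

section \<open>Polynomials, ideals and leading monomials\<close>

interpretation mp: vector_space "scale :: 'k::field \<Rightarrow> 'k mpoly \<Rightarrow> 'k mpoly"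
  by (rule vector_space_scale)

abbreviation polys :: "nat \<Rightarrow> 'k::field mpoly set" where "polys n \<equiv> carrier (poly_ring n)"
abbreviation idl :: "nat \<Rightarrow> 'k::field mpoly set \<Rightarrow> 'k mpoly set" where "idl n S \<equiv> Idl\<^bsub>poly_ring n\<^esub> S"
abbreviation cf :: "'k::field mpoly \<Rightarrow> expo \<Rightarrow> 'k" where "cf \<equiv> Poly_Mapping.lookup"

lemma mons_expos: "m \<in> mons {..<n} d \<Longrightarrow> m \<in> expos n"
  by (simp add: expos_def mons_def)

lemma poly_ring_simps [simp]:
  "mult (poly_ring n) = (*)" "one (poly_ring n) = 1" "zero (poly_ring n) = 0" "add (poly_ring n) = (+)"
  by (simp_all add: poly_ring_def)

lemma carrier_iff: "f \<in> polys n \<longleftrightarrow> supp f \<subseteq> expos n"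
  by (simp add: poly_ring_def)

lemma homogeneous_iff: "homogeneous n d f \<longleftrightarrow> supp f \<subseteq> mons {..<n} d"
  by (auto simp: homogeneous_def carrier_iff mons_def expos_def)

lemma poly_sum_monomials: "f = (\<Sum>m\<in>supp f. Poly_Mapping.single m (cf f m))"
proof (rule poly_mapping_eqI)
  fix w
  have "cf (\<Sum>m\<in>supp f. Poly_Mapping.single m (cf f m)) w
      = (\<Sum>m\<in>supp f. if m = w then cf f w else 0)"
    by (auto simp: lookup_sum lookup_single when_def intro!: sum.cong)
  also have "\<dots> = cf f w" by (simp add: sum.delta' not_in_keys_iff_lookup_eq_zero)
  finally show "cf f w = cf (\<Sum>m\<in>supp f. Poly_Mapping.single m (cf f m)) w" by simp
qed

lemma single_mult_expand: "Poly_Mapping.single u c * f = (\<Sum>m\<in>supp f. Poly_Mapping.single (u + m) (c * cf f m))"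
  for f :: "'k::field mpoly"
  by (subst poly_sum_monomials) (simp add: sum_distrib_left mult_single)

lemma cf_single_mult_add: "cf (Poly_Mapping.single u c * f) (u + m) = c * cf f m"
proof -
  have "cf (Poly_Mapping.single u c * f) (u + m)
      = (\<Sum>m'\<in>supp f. if m' = m then c * cf f m else 0)"
    unfolding single_mult_expand by (auto simp: lookup_sum lookup_single when_def intro!: sum.cong)
  also have "\<dots> = c * cf f m" by (simp add: sum.delta' not_in_keys_iff_lookup_eq_zero)
  finally show ?thesis .
qed

lemma cf_single_mult_other:
  assumes "\<And>m. w \<noteq> u + m" shows "cf (Poly_Mapping.single u c * f) w = 0"
  unfolding single_mult_expand lookup_sum
  by (rule sum.neutral) (use assms in \<open>metis lookup_single_not_eq\<close>)

lemma cf_scale [simp]: "cf (scale c f) m = c * cf f m"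
  using cf_single_mult_add[of 0 c f m] by (simp add: scale_def)

lemma scale_0 [simp]: "scale c 0 = 0" by (rule mp.scale_zero_right)

lemma scale_mult: "scale c f * g = scale c (f * g)" "f * scale c g = scale c (f * g)"
  by (simp_all add: scale_def ac_simps)

lemma keys_monom_mult: "supp (monom u * f) = (\<lambda>m. u + m) ` supp f"
proof
  show "(\<lambda>m. u + m) ` supp f \<subseteq> supp (monom u * f)"
    by (auto simp: in_keys_iff monom_def cf_single_mult_add)
  show "supp (monom u * f) \<subseteq> (\<lambda>m. u + m) ` supp f"
  proof
    fix w assume w: "w \<in> supp (monom u * f)"
    then obtain m where m: "w = u + m"
      using cf_single_mult_other[of w u 1 f] by (auto simp: in_keys_iff monom_def)
    then have "m \<in> supp f" using w by (simp add: in_keys_iff monom_def cf_single_mult_add)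
    then show "w \<in> (\<lambda>m. u + m) ` supp f" using m by simp
  qed
qed

lemma monom_nz [simp]: "monom u \<noteq> (0 :: 'k::field mpoly)"
  by (metis monom_def lookup_single_eq lookup_zero zero_neq_one)

lemma monom_mult: "monom u * monom v = monom (u + v)"
  by (simp add: monom_def mult_single)

lemma monom_0 [simp]: "monom 0 = 1"
  by (simp add: monom_def)

lemma keys_monom [simp]: "supp (monom u :: 'k::field mpoly) = {u}"
  by (simp add: monom_def)

lemma keys_scale_subset: "supp (scale c f) \<subseteq> supp f"
  by (auto simp: in_keys_iff)

lemma poly_expand_scale: "f = (\<Sum>m\<in>supp f. scale (cf f m) (monom m))"
  using poly_sum_monomials[of f] by (simp add: scale_def monom_def mult_single)

lemma homogeneous_0 [simp]: "homogeneous n d 0" by (simp add: homogeneous_iff)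

lemma homogeneous_add: "homogeneous n d f \<Longrightarrow> homogeneous n d g \<Longrightarrow> homogeneous n d (f + g)"
  using Poly_Mapping.keys_add[of f g] by (auto simp: homogeneous_iff)

lemma homogeneous_scale: "homogeneous n d f \<Longrightarrow> homogeneous n d (scale c f)"
  using keys_scale_subset[of c f] by (auto simp: homogeneous_iff)

lemma homogeneous_mult:
  assumes "homogeneous n c f" "homogeneous n d g" shows "homogeneous n (c + d) (f * g)"
  unfolding homogeneous_iff
proof
  fix m assume "m \<in> supp (f * g)"
  then obtain p q where "m = p + q" "p \<in> supp f" "q \<in> supp g"
    using Poly_Mapping.keys_mult[of f g] by blast
  then show "m \<in> mons {..<n} (c + d)" using assms unfolding homogeneous_iff by (auto intro: mons_add)
qed

lemma homogeneous_monom: "u \<in> mons {..<n} d \<Longrightarrow> homogeneous n d (monom u)"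
  by (simp add: homogeneous_iff)

lemma homogeneous_carrier: "homogeneous n d f \<Longrightarrow> f \<in> polys n"
  by (simp add: homogeneous_def)

lemma subspace_homogeneous: "mp.subspace {f \<in> I. homogeneous n d f}"
  if "0 \<in> I" "\<And>f g. f \<in> I \<Longrightarrow> g \<in> I \<Longrightarrow> f + g \<in> I" "\<And>c f. f \<in> I \<Longrightarrow> scale c f \<in> I"
  using that by (auto simp: mp.subspace_def intro: homogeneous_add homogeneous_scale)

text \<open>
  Ring elements are finite sums of scaled monomials, so these are the only multipliers to be checked.
\<close>

lemma ideal_poly_ringI:
  fixes J :: "'k::field mpoly set"
  assumes sub: "J \<subseteq> polys n" and z: "0 \<in> J"
    and add: "\<And>f g. f \<in> J \<Longrightarrow> g \<in> J \<Longrightarrow> f + g \<in> J"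
    and sc: "\<And>c f. f \<in> J \<Longrightarrow> scale c f \<in> J"
    and mon: "\<And>u f. u \<in> expos n \<Longrightarrow> f \<in> J \<Longrightarrow> monom u * f \<in> J"
  shows "ideal J (poly_ring n)"
proof -
  interpret cring "poly_ring n :: 'k mpoly ring" by (rule cring_poly_ring)
  have sumJ: "sum h S \<in> J" if "\<And>i. i \<in> S \<Longrightarrow> h i \<in> J" for h and S :: "expo set"
    using that by (induction S rule: infinite_finite_induct) (auto intro: z add)
  have mul: "r * f \<in> J" if "r \<in> polys n" "f \<in> J" for r f
  proof -
    have "r * f = (\<Sum>m\<in>supp r. scale (cf r m) (monom m * f))"
      by (subst poly_expand_scale[of r]) (simp add: sum_distrib_right scale_mult)
    moreover have "scale (cf r m) (monom m * f) \<in> J" if "m \<in> supp r" for m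
      using that \<open>r \<in> _\<close> \<open>f \<in> J\<close> by (intro sc mon) (auto simp: carrier_iff)
    ultimately show ?thesis using sumJ by simp
  qed
  have mul': "f * r \<in> J" if "r \<in> polys n" "f \<in> J" for r f
    using mul[OF that] by (simp add: ac_simps)
  have neg: "- f \<in> J" if "f \<in> J" for f
    using mul[of "- 1" f] that by (simp add: carrier_iff expos_simps)
  have "\<ominus>\<^bsub>poly_ring n\<^esub> f = - f" if "f \<in> polys n" for f :: "'k mpoly"
    by (rule minus_equality) (use that in \<open>auto simp: carrier_iff\<close>)
  then have "subgroup J (add_monoid (poly_ring n))"
    using sub z add neg by (intro add.subgroupI) (auto simp: a_inv_def[symmetric])
  then show ?thesis
    using mul mul' by (intro idealI) (auto simp: ring_axioms)
qed

lemma
  fixes S :: "'k::field mpoly set"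
  assumes S: "S \<subseteq> polys n"
  shows Idl_carrier: "f \<in> idl n S \<Longrightarrow> f \<in> polys n"
    and Idl_0: "0 \<in> idl n S"
    and Idl_incl: "f \<in> S \<Longrightarrow> f \<in> idl n S"
    and Idl_add: "f \<in> idl n S \<Longrightarrow> g \<in> idl n S \<Longrightarrow> f + g \<in> idl n S"
    and Idl_mult: "r \<in> polys n \<Longrightarrow> f \<in> idl n S \<Longrightarrow> r * f \<in> idl n S"
    and Idl_scale: "f \<in> idl n S \<Longrightarrow> scale c f \<in> idl n S"
proof -
  interpret R: cring "poly_ring n :: 'k mpoly ring" by (rule cring_poly_ring)
  interpret ideal "idl n S" "poly_ring n" by (rule R.genideal_ideal[OF S])
  show "f \<in> idl n S \<Longrightarrow> f \<in> polys n" by (rule a_Hcarr)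
  show "0 \<in> idl n S" using zero_closed by simp
  show "f \<in> S \<Longrightarrow> f \<in> idl n S" using R.genideal_self[OF S] by blast
  show "f \<in> idl n S \<Longrightarrow> g \<in> idl n S \<Longrightarrow> f + g \<in> idl n S"
    using a_closed by simp
  show mult: "r \<in> polys n \<Longrightarrow> f \<in> idl n S \<Longrightarrow> r * f \<in> idl n S" for r
    using I_l_closed by simp
  show "f \<in> idl n S \<Longrightarrow> scale c f \<in> idl n S"
    unfolding scale_def by (rule mult) (auto simp: carrier_iff expos_simps)
qed

lemma Idl_uminus:
  fixes S :: "'k::field mpoly set"
  assumes "S \<subseteq> polys n" "f \<in> idl n S"
  shows "- f \<in> idl n S"
  using Idl_mult[OF assms(1) _ assms(2), of "- 1"] by (simp add: carrier_iff expos_simps)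

lemma Idl_sum:
  fixes S :: "'k::field mpoly set"
  assumes "S \<subseteq> polys n" "\<And>i. i \<in> T \<Longrightarrow> h i \<in> idl n S"
  shows "sum h T \<in> idl n S"
  using assms(2) by (induction T rule: infinite_finite_induct) (auto intro: Idl_0[OF assms(1)] Idl_add[OF assms(1)])

lemma Idl_least:
  fixes S :: "'k::field mpoly set"
  assumes "ideal J (poly_ring n)" "S \<subseteq> J" shows "idl n S \<subseteq> J"
proof -
  interpret R: cring "poly_ring n :: 'k mpoly ring" by (rule cring_poly_ring)
  show ?thesis by (rule R.genideal_minimal[OF assms])
qed

lemma carrier_closed:
  "f \<in> polys n \<Longrightarrow> g \<in> polys n \<Longrightarrow> f + g \<in> polys n"
  "f \<in> polys n \<Longrightarrow> g \<in> polys n \<Longrightarrow> f * g \<in> polys n"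
  "f \<in> polys n \<Longrightarrow> scale c f \<in> polys n"
  "u \<in> expos n \<Longrightarrow> (monom u :: 'k mpoly) \<in> polys n"
  "f \<in> polys n \<Longrightarrow> f ^ k \<in> polys n"
  "(0 :: 'k mpoly) \<in> polys n" "(1 :: 'k mpoly) \<in> polys n"
  for f g :: "'k::field mpoly"
proof -
  interpret R: cring "poly_ring n :: 'k mpoly ring" by (rule cring_poly_ring)
  show "(0 :: 'k mpoly) \<in> polys n" and one: "(1 :: 'k mpoly) \<in> polys n"
    using R.zero_closed R.one_closed by simp_all
  show "f \<in> polys n \<Longrightarrow> g \<in> polys n \<Longrightarrow> f + g \<in> polys n"
    using R.a_closed by simp
  have m: "f \<in> polys n \<Longrightarrow> g \<in> polys n \<Longrightarrow> f * g \<in> polys n"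
    for f g :: "'k mpoly" using R.m_closed by simp
  then show "f \<in> polys n \<Longrightarrow> g \<in> polys n \<Longrightarrow> f * g \<in> polys n" .
  show "f \<in> polys n \<Longrightarrow> scale c f \<in> polys n"
    using keys_scale_subset[of c f] by (auto simp: carrier_iff)
  show "u \<in> expos n \<Longrightarrow> (monom u :: 'k mpoly) \<in> polys n" by (simp add: carrier_iff)
  show "f \<in> polys n \<Longrightarrow> f ^ k \<in> polys n"
    by (induction k) (auto intro: m one)
qed

definition lm :: "'k::field mpoly \<Rightarrow> expo" where
  "lm f = Max (supp f)"

lemma lm_in_keys: "f \<noteq> 0 \<Longrightarrow> lm f \<in> supp f"
  unfolding lm_def by (intro Max_in) auto

lemma cf_lm: "f \<noteq> 0 \<Longrightarrow> cf f (lm f) \<noteq> 0"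
  using lm_in_keys by (simp add: in_keys_iff)

lemma lm_ge: "m \<in> supp f \<Longrightarrow> m \<le> lm f"
  unfolding lm_def by (intro Max_ge) auto

lemma lm_monom_mult:
  assumes "f \<noteq> 0" shows "lm (monom u * f) = u + lm f"
proof -
  have "lm (monom u * f) = Max ((\<lambda>m. u + m) ` supp f)"
    by (simp add: lm_def keys_monom_mult)
  also have "\<dots> = u + lm f"
    unfolding lm_def by (rule mono_Max_commute[symmetric]) (use assms in \<open>auto intro: monoI add_left_mono\<close>)
  finally show ?thesis .
qed

text \<open>
  Gaussian elimination: choose one element of \<open>V\<close> for every leading monomial. They are independent, and
  subtracting multiples of them lowers leading monomials until nothing is left. The injection \<open>\<Phi>\<close> allows
  the leading monomials to be taken in another space of polynomials.
\<close>

lemma dim_eq_card_lm: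
  fixes V :: "'k::field mpoly set" and \<Phi> :: "'k mpoly \<Rightarrow> 'k mpoly"
  assumes V: "mp.subspace V"
    and add: "\<And>f g. f \<in> V \<Longrightarrow> g \<in> V \<Longrightarrow> \<Phi> (f + g) = \<Phi> f + \<Phi> g"
    and sc: "\<And>c f. f \<in> V \<Longrightarrow> \<Phi> (scale c f) = scale c (\<Phi> f)"
    and inj: "\<And>f. f \<in> V \<Longrightarrow> \<Phi> f = 0 \<Longrightarrow> f = 0"
    and fin: "finite ((\<lambda>f. lm (\<Phi> f)) ` (V - {0}))"
  shows "mp.dim V = card ((\<lambda>f. lm (\<Phi> f)) ` (V - {0}))"
proof -
  let ?L = "(\<lambda>f. lm (\<Phi> f)) ` (V - {0})"
  have "\<exists>f. f \<in> V \<and> f \<noteq> 0 \<and> lm (\<Phi> f) = a" if "a \<in> ?L" for a using that by auto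
  then obtain b where b: "\<And>a. a \<in> ?L \<Longrightarrow> b a \<in> V \<and> b a \<noteq> 0 \<and> lm (\<Phi> (b a)) = a" by metis
  have bnz: "\<Phi> (b a) \<noteq> 0" if "a \<in> ?L" for a using b[OF that] inj by blast
  have \<Phi>0: "\<Phi> 0 = 0" using sc[of 0 0] mp.subspace_0[OF V] by simp
  have injb: "inj_on b ?L" by (rule inj_onI) (metis b)
  have V0: "0 \<in> V" and Vadd: "\<And>x y. x \<in> V \<Longrightarrow> y \<in> V \<Longrightarrow> x + y \<in> V" and Vsc: "\<And>c x. x \<in> V \<Longrightarrow> scale c x \<in> V"
    using V by (auto simp: mp.subspace_def)
  have span: "f \<in> mp.span (b ` ?L)" if "f \<in> V" for f
    using that
  proof (induction "card {a\<in>?L. a < lm (\<Phi> f)}" arbitrary: f rule: less_induct)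
    case less
    show ?case
    proof (cases "f = 0")
      case True then show ?thesis by (simp add: mp.span_zero)
    next
      case False
      define a where "a = lm (\<Phi> f)"
      have a: "a \<in> ?L" using less.prems False by (auto simp: a_def)
      have nz: "\<Phi> f \<noteq> 0" using inj less.prems False by blast
      define c where "c = - (cf (\<Phi> f) a / cf (\<Phi> (b a)) a)"
      define f' where "f' = f + scale c (b a)"
      have f'V: "f' \<in> V" unfolding f'_def using b[OF a] less.prems by (intro Vadd Vsc) auto
      have \<Phi>f': "\<Phi> f' = \<Phi> f + scale c (\<Phi> (b a))"
        unfolding f'_def using b[OF a] less.prems by (simp add: add sc Vsc)
      have "cf (\<Phi> (b a)) a \<noteq> 0" using cf_lm[OF bnz[OF a]] b[OF a] by simp
      then have za: "cf (\<Phi> f') a = 0" unfolding \<Phi>f' c_def by (simp add: lookup_add lookup_minus)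
      have "f' \<in> mp.span (b ` ?L)"
      proof (cases "f' = 0")
        case True then show ?thesis by (simp add: mp.span_zero)
      next
        case f'nz: False
        then have \<Phi>nz: "\<Phi> f' \<noteq> 0" using inj f'V by blast
        have "lm (\<Phi> f') \<in> supp (\<Phi> f) \<union> supp (\<Phi> (b a))"
          using lm_in_keys[OF \<Phi>nz] Poly_Mapping.keys_add[of "\<Phi> f" "scale c (\<Phi> (b a))"]
            keys_scale_subset[of c "\<Phi> (b a)"] unfolding \<Phi>f' by blast
        then have "lm (\<Phi> f') \<le> a"
          using lm_ge[of "lm (\<Phi> f')" "\<Phi> f"] lm_ge[of "lm (\<Phi> f')" "\<Phi> (b a)"] b[OF a] by (auto simp: a_def)
        moreover have "lm (\<Phi> f') \<noteq> a" using cf_lm[OF \<Phi>nz] za by auto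
        ultimately have lt: "lm (\<Phi> f') < a" by simp
        have "{x\<in>?L. x < lm (\<Phi> f')} \<subset> {x\<in>?L. x < a}"
        proof
          show "{x\<in>?L. x < lm (\<Phi> f')} \<subseteq> {x\<in>?L. x < a}" using lt by (auto intro: less_trans)
          have "lm (\<Phi> f') \<in> {x\<in>?L. x < a}" using lt f'V f'nz by auto
          then show "{x\<in>?L. x < lm (\<Phi> f')} \<noteq> {x\<in>?L. x < a}" by auto
        qed
        then have "card {x\<in>?L. x < lm (\<Phi> f')} < card {x\<in>?L. x < lm (\<Phi> f)}"
          unfolding a_def[symmetric] using fin by (intro psubset_card_mono) auto
        then show ?thesis using less.hyps f'V by blast
      qed
      moreover have "scale (- c) (b a) \<in> mp.span (b ` ?L)"
        using a by (intro mp.span_scale mp.span_base) blast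
      moreover have "f = f' + scale (- c) (b a)" by (simp add: f'_def)
      ultimately show ?thesis using mp.span_add by metis
    qed
  qed
  have indep: "mp.independent (b ` ?L)"
  proof (rule mp.independent_if_scalars_zero)
    show "finite (b ` ?L)" using fin by simp
    fix c x assume sum0: "(\<Sum>x\<in>b ` ?L. scale (c x) x) = 0" and x: "x \<in> b ` ?L"
    show "c x = 0"
    proof (rule ccontr)
      assume cx: "c x \<noteq> 0"
      let ?N = "{a\<in>?L. c (b a) \<noteq> 0}"
      have finN: "finite ?N" using fin by simp
      have "?N \<noteq> {}" using cx x by blast
      define a where "a = Max ?N"
      have aN: "a \<in> ?N" unfolding a_def using finN \<open>?N \<noteq> {}\<close> by (rule Max_in)
      have amax: "a' \<le> a" if "a' \<in> ?N" for a' unfolding a_def using finN that by (rule Max_ge)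
      have "\<Phi> (\<Sum>a\<in>S. scale (c (b a)) (b a)) = (\<Sum>a\<in>S. scale (c (b a)) (\<Phi> (b a))) \<and>
          (\<Sum>a\<in>S. scale (c (b a)) (b a)) \<in> V" if "finite S" "S \<subseteq> ?L" for S
        using that
      proof (induction S rule: finite_induct)
        case empty then show ?case using \<Phi>0 V0 by simp
      next
        case (insert s S)
        then have bs: "b s \<in> V" using b[of s] by simp
        have sumV: "(\<Sum>a\<in>S. scale (c (b a)) (b a)) \<in> V"
          and IH: "\<Phi> (\<Sum>a\<in>S. scale (c (b a)) (b a)) = (\<Sum>a\<in>S. scale (c (b a)) (\<Phi> (b a)))"
          using insert.IH insert.prems by auto
        have "\<Phi> (scale (c (b s)) (b s) + (\<Sum>a\<in>S. scale (c (b a)) (b a)))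
            = scale (c (b s)) (\<Phi> (b s)) + (\<Sum>a\<in>S. scale (c (b a)) (\<Phi> (b a)))"
          unfolding add[OF Vsc[OF bs] sumV] sc[OF bs] IH ..
        then show ?case
          unfolding sum.insert[OF insert.hyps] using Vadd[OF Vsc[OF bs] sumV] by blast
      qed
      from this[OF fin order_refl]
      have "\<Phi> (\<Sum>a\<in>?L. scale (c (b a)) (b a)) = (\<Sum>a\<in>?L. scale (c (b a)) (\<Phi> (b a)))" by simp
      moreover have "(\<Sum>a\<in>?L. scale (c (b a)) (b a)) = 0"
        using sum0 by (simp add: sum.reindex[OF injb])
      ultimately have "(\<Sum>a\<in>?L. scale (c (b a)) (\<Phi> (b a))) = 0" using \<Phi>0 by simp
      then have "(\<Sum>a'\<in>?L. c (b a') * cf (\<Phi> (b a')) a) = 0"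
        by (metis (mono_tags, lifting) cf_scale lookup_sum lookup_zero sum.cong)
      moreover have "(\<Sum>a'\<in>?L. c (b a') * cf (\<Phi> (b a')) a) = (\<Sum>a'\<in>{a}. c (b a') * cf (\<Phi> (b a')) a)"
      proof (rule sum.mono_neutral_right[OF fin])
        show "{a} \<subseteq> ?L" using aN by simp
        show "\<forall>a'\<in>?L - {a}. c (b a') * cf (\<Phi> (b a')) a = 0"
        proof
          fix a' assume a': "a' \<in> ?L - {a}"
          show "c (b a') * cf (\<Phi> (b a')) a = 0"
          proof (cases "c (b a') = 0")
            case False
            then have "a' \<in> ?N" using a' by simp
            then have "a' < a" using amax[of a'] a' by auto
            then have "\<not> a \<le> lm (\<Phi> (b a'))" using b[of a'] a' by auto
            then have "a \<notin> supp (\<Phi> (b a'))" using lm_ge by blast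
            then show ?thesis by (simp add: in_keys_iff)
          qed simp
        qed
      qed
      ultimately have "c (b a) * cf (\<Phi> (b a)) a = 0" by simp
      moreover have "cf (\<Phi> (b a)) a \<noteq> 0" using cf_lm[OF bnz, of a] b[of a] aN by simp
      ultimately show False using aN by simp
    qed
  qed
  have "card (b ` ?L) = mp.dim V"
  proof (rule mp.basis_card_eq_dim[OF _ _ indep])
    show "b ` ?L \<subseteq> V" using b by blast
    show "V \<subseteq> mp.span (b ` ?L)" using span by blast
  qed
  then show ?thesis using card_image[OF injb] by simp
qed

section \<open>Homogeneous components and monomial ideals\<close>

definition hcomp :: "nat \<Rightarrow> 'k::field mpoly \<Rightarrow> 'k mpoly" where
  "hcomp d f = (\<Sum>m\<in>{m\<in>supp f. mdegree m = d}. scale (cf f m) (monom m))"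

lemma cf_monom: "cf (monom u :: 'k::field mpoly) w = (if u = w then 1 else 0)"
  by (simp add: monom_def lookup_single when_def)

lemma cf_hcomp: "cf (hcomp d f) w = (if mdegree w = d then cf f w else 0)"
proof -
  have "cf (hcomp d f) w = (\<Sum>m\<in>{m\<in>supp f. mdegree m = d}. if m = w then cf f w else 0)"
    unfolding hcomp_def lookup_sum by (intro sum.cong) (auto simp: cf_monom)
  also have "\<dots> = (if w \<in> supp f \<and> mdegree w = d then cf f w else 0)"
    by (simp add: sum.delta')
  finally show ?thesis by (auto simp: in_keys_iff)
qed

lemma hcomp_0 [simp]: "hcomp d 0 = 0"
  by (simp add: hcomp_def)

lemma hcomp_add: "hcomp d (f + g) = hcomp d f + hcomp d g"
  by (rule poly_mapping_eqI) (simp add: cf_hcomp lookup_add)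

lemma hcomp_scale: "hcomp d (scale c f) = scale c (hcomp d f)"
  by (rule poly_mapping_eqI) (simp add: cf_hcomp)

lemma hcomp_homogeneous: "homogeneous n e f \<Longrightarrow> hcomp d f = (if d = e then f else 0)"
  by (rule poly_mapping_eqI) (auto simp: cf_hcomp homogeneous_def in_keys_iff)

lemma cf_monom_mult: "cf (monom u * f) (u + m) = cf f m"
  using cf_single_mult_add[of u 1 f m] by (simp add: monom_def)

lemma cf_monom_mult_other: "(\<And>m. w \<noteq> u + m) \<Longrightarrow> cf (monom u * f) w = 0"
  unfolding monom_def by (rule cf_single_mult_other)

lemma hcomp_monom_mult:
  "hcomp d (monom u * f) = (if mdegree u \<le> d then monom u * hcomp (d - mdegree u) f else 0)"
proof (rule poly_mapping_eqI)
  fix w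
  show "cf (hcomp d (monom u * f)) w = cf (if mdegree u \<le> d then monom u * hcomp (d - mdegree u) f else 0) w"
  proof (cases "\<exists>m. w = u + m")
    case True
    then obtain m where w: "w = u + m" by blast
    show ?thesis unfolding w by (auto simp: cf_hcomp cf_monom_mult)
  next
    case False
    then show ?thesis by (simp add: cf_hcomp cf_monom_mult_other)
  qed
qed

text \<open>
  The products in degree \<open>d\<close> that span the degree-\<open>d\<close> part of the ideal generated by the forms \<open>G\<close>.
\<close>

definition monomial_multiples :: "nat \<Rightarrow> 'k::field mpoly set \<Rightarrow> nat \<Rightarrow> 'k mpoly set" where
  "monomial_multiples n G d = {monom u * g | u g e. u \<in> expos n \<and> g \<in> G \<and> form n e g \<and> mdegree u + e = d}"

text \<open>
  The polynomials all of whose homogeneous components lie in these spans form an ideal that contains \<open>G\<close>.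
\<close>

lemma Idl_homogeneous_span:
  fixes G :: "'k::field mpoly set"
  assumes G: "\<And>g. g \<in> G \<Longrightarrow> \<exists>e. form n e g"
    and f: "f \<in> idl n G" "homogeneous n d f"
  shows "f \<in> mp.span (monomial_multiples n G d)"
proof -
  let ?J = "{f \<in> polys n. \<forall>d. hcomp d f \<in> mp.span (monomial_multiples n G d)}"
  have "ideal ?J (poly_ring n)"
  proof (rule ideal_poly_ringI)
    fix u and f :: "'k mpoly" assume u: "u \<in> expos n" and f: "f \<in> ?J"
    have shift: "monom u * p \<in> mp.span (monomial_multiples n G d)"
      if "mdegree u \<le> d" "p \<in> mp.span (monomial_multiples n G (d - mdegree u))" for p d
      using that(2)
    proof (induction rule: mp.span_induct_alt)
      case base then show ?case by (simp add: mp.span_zero)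
    next
      case (step c x y)
      then obtain v g e where x: "x = monom v * g" "v \<in> expos n" "g \<in> G" "form n e g" "mdegree v + e = d - mdegree u"
        by (auto simp: monomial_multiples_def)
      have "monom u * x = monom (u + v) * g" using x by (simp add: monom_mult flip: mult.assoc)
      moreover have "monom (u + v) * g \<in> monomial_multiples n G d"
        unfolding monomial_multiples_def using x u that(1) by (auto intro!: exI[of _ "u + v"] exI[of _ g] expos_simps)
      ultimately have "scale c (monom u * x) + monom u * y \<in> mp.span (monomial_multiples n G d)"
        using step by (intro mp.span_add mp.span_scale) (auto intro: mp.span_base)
      then show ?case by (simp add: algebra_simps scale_mult)
    qed
    show "monom u * f \<in> ?J"
      using f u shift by (auto simp: hcomp_monom_mult mp.span_zero intro!: carrier_closed)
  qed (auto simp: hcomp_add hcomp_scale intro!: carrier_closed mp.span_zero mp.span_add mp.span_scale)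
  moreover have "G \<subseteq> ?J"
  proof
    fix g assume g: "g \<in> G"
    then obtain e where e: "form n e g" using G by blast
    have "g = monom 0 * g \<and> 0 \<in> expos n \<and> g \<in> G \<and> form n e g \<and> mdegree 0 + e = e"
      using g e by (simp add: expos_simps)
    then have "g \<in> monomial_multiples n G e" unfolding monomial_multiples_def by blast
    then show "g \<in> ?J" using e
      by (auto simp: form_def hcomp_homogeneous mp.span_zero homogeneous_carrier intro: mp.span_base)
  qed
  ultimately have "f \<in> ?J" using Idl_least f(1) by blast
  then have "hcomp d f \<in> mp.span (monomial_multiples n G d)" by blast
  then show ?thesis using hcomp_homogeneous[OF f(2), of d] by simp
qed

lemma Idl_monomials:
  assumes M: "M \<subseteq> expos n"
  shows "idl n (monom ` M :: 'k::field mpoly set)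
    = {f. supp f \<subseteq> {u + m | u m. u \<in> expos n \<and> m \<in> M}}"
    (is "_ = ?J")
proof
  have car: "monom ` M \<subseteq> polys n" using M by (auto intro: carrier_closed)
  show "idl n (monom ` M) \<subseteq> ?J"
  proof (rule Idl_least)
    show "ideal ?J (poly_ring n)"
    proof (rule ideal_poly_ringI)
      have "{u + m | u m. u \<in> expos n \<and> m \<in> M} \<subseteq> expos n" using M by (auto intro: expos_simps)
      then show "?J \<subseteq> polys n" by (auto simp: carrier_iff)
      fix f g :: "'k mpoly" and c u
      show "f + g \<in> ?J" if "f \<in> ?J" "g \<in> ?J" using that Poly_Mapping.keys_add[of f g] by blast
      show "scale c f \<in> ?J" if "f \<in> ?J" using that keys_scale_subset[of c f] by blast
      show "monom u * f \<in> ?J" if "u \<in> expos n" "f \<in> ?J"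
      proof -
        have "u + w \<in> {u + m | u m. u \<in> expos n \<and> m \<in> M}" if w: "w \<in> supp f" for w
        proof -
          obtain v m where v: "w = v + m" "v \<in> expos n" "m \<in> M" using w \<open>f \<in> ?J\<close> by blast
          then have "u + w = (u + v) + m" "u + v \<in> expos n" using \<open>u \<in> expos n\<close> by (auto simp: ac_simps intro: expos_simps)
          then show ?thesis using v(3) by blast
        qed
        then show ?thesis by (auto simp: keys_monom_mult)
      qed
    qed simp
    show "monom ` M \<subseteq> ?J"
    proof
      fix f :: "'k mpoly" assume "f \<in> monom ` M"
      then obtain m where m: "m \<in> M" "f = monom m" by blast
      have "m = 0 + m" by simp
      then have "m \<in> {u + m | u m. u \<in> expos n \<and> m \<in> M}" using m(1) expos_simps(1) by blast
      then show "f \<in> ?J" using m(2) by simp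
    qed
  qed
  show "?J \<subseteq> idl n (monom ` M)"
  proof
    fix f :: "'k mpoly" assume f: "f \<in> ?J"
    have "scale (cf f w) (monom w) \<in> idl n (monom ` M)" if w: "w \<in> supp f" for w
    proof -
      obtain v m where v: "w = v + m" "v \<in> expos n" "m \<in> M" using w f by blast
      have "monom v * monom m \<in> idl n (monom ` M :: 'k mpoly set)"
        using v by (intro Idl_mult[OF car] Idl_incl[OF car] carrier_closed) auto
      then show ?thesis using v(1) by (intro Idl_scale[OF car]) (simp add: monom_mult)
    qed
    then show "f \<in> idl n (monom ` M)"
      by (subst poly_expand_scale[of f]) (rule Idl_sum[OF car])
  qed
qed

section \<open>Regular sequences\<close>

lemma Idl_degree_ge:
  fixes S :: "'k::field mpoly set"
  assumes "S \<subseteq> polys n" "\<And>f m. f \<in> S \<Longrightarrow> m \<in> supp f \<Longrightarrow> d \<le> mdegree m"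
    and "f \<in> idl n S" "m \<in> supp f"
  shows "d \<le> mdegree m"
proof -
  let ?J = "{f \<in> carrier (poly_ring n :: 'k mpoly ring). \<forall>m\<in>supp f. d \<le> mdegree m}"
  have "ideal ?J (poly_ring n)"
  proof (rule ideal_poly_ringI)
    fix f g :: "'k mpoly" and c u
    show "f + g \<in> ?J" if "f \<in> ?J" "g \<in> ?J"
      using that Poly_Mapping.keys_add[of f g] by (auto intro: carrier_closed)
    show "scale c f \<in> ?J" if "f \<in> ?J"
      using that keys_scale_subset[of c f] by (auto intro: carrier_closed)
    show "monom u * f \<in> ?J" if "u \<in> expos n" "f \<in> ?J"
      using that by (auto simp: keys_monom_mult intro: carrier_closed trans_le_add2)
  qed (auto intro: carrier_closed)
  moreover have "S \<subseteq> ?J" using assms(1,2) by blast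
  ultimately have "f \<in> ?J" using Idl_least assms(3) by blast
  then show ?thesis using assms(4) by blast
qed

text \<open>
  In a relation with coefficients of degree below \<open>d\<close>, the last coefficient belongs to the ideal of the
  earlier members, all of whose monomials have degree at least \<open>d\<close>. So it is zero, and the relation becomes
  shorter.
\<close>

lemma regular_sequence_low_syzygy:
  fixes fs :: "'k::field mpoly list"
  assumes reg: "regular_sequence n fs"
    and deg: "\<And>i m. i < k \<Longrightarrow> m \<in> supp (fs ! i) \<Longrightarrow> d \<le> mdegree m"
    and k: "k \<le> length fs"
    and p: "\<And>i. i < k \<Longrightarrow> p i \<in> polys n"
      "\<And>i m. i < k \<Longrightarrow> m \<in> supp (p i) \<Longrightarrow> mdegree m < d"
    and sum0: "(\<Sum>i<k. p i * fs ! i) = 0"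
    and i: "i < k"
  shows "p i = 0"
  using deg k p sum0 i
proof (induction k arbitrary: i)
  case 0
  then show ?case by simp
next
  case (Suc k)
  have car: "set fs \<subseteq> polys n" using reg by (simp add: regular_sequence_def)
  then have cark: "set (take k fs) \<subseteq> polys n" using set_take_subset[of k fs] by blast
  have mem: "fs ! j \<in> set (take k fs)" if "j < k" for j
    using that Suc.prems(2) by (auto simp: in_set_conv_nth intro!: exI[of _ j])
  have "fs ! k * p k = - (\<Sum>i<k. p i * fs ! i)"
    using Suc.prems(5) by (simp add: add_eq_0_iff mult.commute)
  moreover have "(\<Sum>i<k. p i * fs ! i) \<in> idl n (set (take k fs))"
    using Suc.prems(3) mem by (intro Idl_sum[OF cark] Idl_mult[OF cark] Idl_incl[OF cark]) auto
  ultimately have "fs ! k * p k \<in> idl n (set (take k fs))" using Idl_uminus[OF cark] by simp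
  then have pk: "p k \<in> idl n (set (take k fs))"
    using reg Suc.prems(2,3) unfolding regular_sequence_def by auto
  have "p k = 0"
  proof (rule ccontr)
    assume "p k \<noteq> 0"
    then have m: "lm (p k) \<in> supp (p k)" by (rule lm_in_keys)
    have "d \<le> mdegree (lm (p k))"
    proof (rule Idl_degree_ge[OF cark _ pk m])
      fix f m assume "f \<in> set (take k fs)" and m: "m \<in> supp f"
      then obtain j where j: "j < k" "f = fs ! j" using Suc.prems(2) by (auto simp: in_set_conv_nth)
      then show "d \<le> mdegree m" using Suc.prems(1)[of j m] m by simp
    qed
    then show False using Suc.prems(4)[of k, OF _ m] by simp
  qed
  moreover have "p i = 0" if "i < k" for i
  proof (rule Suc.IH)
    show "d \<le> mdegree m" if "j < k" "m \<in> supp (fs ! j)" for j m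
      using Suc.prems(1)[of j m] that by simp
    show "mdegree m < d" if "j < k" "m \<in> supp (p j)" for j m
      using Suc.prems(4)[of j m] that by simp
  qed (use Suc.prems(2,3,5) \<open>p k = 0\<close> that in auto)
  ultimately show ?case using Suc.prems(6) by (auto simp: less_Suc_eq)
qed

text \<open>
  Regularity modulo the ideal generated by \<open>Q\<close>. In this relative form the head of the sequence can be moved
  into \<open>Q\<close>, which is how inductions on the sequence proceed.
\<close>

definition regular_over :: "nat \<Rightarrow> 'k::field mpoly set \<Rightarrow> 'k mpoly list \<Rightarrow> bool" where
  "regular_over n Q fs \<longleftrightarrow> Q \<subseteq> polys n \<and> set fs \<subseteq> polys n \<and>
    (\<forall>i<length fs. \<forall>g\<in>polys n.
      fs ! i * g \<in> idl n (Q \<union> set (take i fs)) \<longrightarrow>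
      g \<in> idl n (Q \<union> set (take i fs))) \<and>
    1 \<notin> idl n (Q \<union> set fs)"

lemma regular_over_Cons:
  assumes "regular_over n Q (f # fs)"
  shows "regular_over n (insert f Q) fs"
    and "g \<in> polys n \<Longrightarrow> f * g \<in> idl n Q \<Longrightarrow> g \<in> idl n Q"
proof -
  note r = assms[unfolded regular_over_def]
  show "regular_over n (insert f Q) fs"
    unfolding regular_over_def
  proof (intro conjI allI impI ballI)
    fix i g assume "i < length fs" "g \<in> polys n"
      "fs ! i * g \<in> idl n (insert f Q \<union> set (take i fs))"
    then show "g \<in> idl n (insert f Q \<union> set (take i fs))"
      using r[THEN conjunct2, THEN conjunct2, THEN conjunct1, THEN spec, of "Suc i"] by simp
  qed (use r in auto)
  show "g \<in> idl n Q" if "g \<in> polys n" "f * g \<in> idl n Q"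
    using r[THEN conjunct2, THEN conjunct2, THEN conjunct1, THEN spec, of 0] that by simp
qed

fun fpow :: "'k::field mpoly list \<Rightarrow> nat list \<Rightarrow> 'k mpoly" where
  "fpow (f # fs) (k # ks) = f ^ k * fpow fs ks"
| "fpow _ _ = 1"

text \<open>
  The exponent vectors of the products whose independence bounds the length of a regular sequence.
\<close>

definition box :: "nat \<Rightarrow> nat \<Rightarrow> nat list set" where
  "box l s = {ks. length ks = l \<and> set ks \<subseteq> {..s}}"

lemma finite_box [simp]: "finite (box l s)"
  using finite_lists_length_eq[of "{..s}" l] by (simp add: box_def conj_commute)

lemma card_box: "card (box l s) = Suc s ^ l"
  using card_lists_length_eq[of "{..s}" l] by (simp add: box_def conj_commute)

lemma box_0: "box 0 s = {[]}" by (auto simp: box_def)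

lemma box_Suc: "box (Suc l) s = (\<lambda>x. fst x # snd x) ` ({..s} \<times> box l s)"
  by (auto simp: box_def length_Suc_conv image_iff)

lemma fpow_carrier: "set fs \<subseteq> polys n \<Longrightarrow> fpow fs ks \<in> polys n"
  by (induction fs ks rule: fpow.induct) (auto intro!: carrier_closed)

lemma carrier_sum: "(\<And>i. i \<in> S \<Longrightarrow> f i \<in> polys n) \<Longrightarrow> sum f S \<in> polys n"
  for f :: "'a \<Rightarrow> 'k::field mpoly"
  by (induction S rule: infinite_finite_induct) (auto intro!: carrier_closed)

text \<open>
  Expand a relation by powers of the first member \<open>f\<close>. Modulo \<open>f\<close>, the lowest coefficient that is not known
  to vanish becomes a relation between the other members, so it vanishes by induction; what remains is
  divisible by \<open>f\<close>, which may be cancelled.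
\<close>

lemma regular_over_algebraically_independent:
  fixes fs :: "'k::field mpoly list"
  assumes "regular_over n Q fs"
    and "(\<Sum>ks\<in>box (length fs) s. scale (c ks) (fpow fs ks)) \<in> idl n Q"
    and "ks \<in> box (length fs) s"
  shows "c ks = 0"
  using assms
proof (induction fs arbitrary: Q c ks)
  case Nil
  show ?case
  proof (rule ccontr)
    assume nz: "c ks \<noteq> 0"
    have ks: "ks = []" using Nil.prems(3) by (simp add: box_0)
    have Q: "Q \<subseteq> polys n" "1 \<notin> idl n Q"
      using Nil.prems(1) by (simp_all add: regular_over_def)
    have "scale (c []) 1 \<in> idl n Q" using Nil.prems(2) by (simp add: box_0)
    then have "scale (inverse (c [])) (scale (c []) 1) \<in> idl n Q" by (rule Idl_scale[OF Q(1)])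
    then show False using nz ks Q(2) by simp
  qed
next
  case (Cons f fs)
  have Q: "Q \<subseteq> polys n" and fcar: "f \<in> polys n"
    and fscar: "set fs \<subseteq> polys n"
    using Cons.prems(1) by (auto simp: regular_over_def)
  have fQ: "insert f Q \<subseteq> polys n" using Q fcar by simp
  define g where "g k = (\<Sum>ks\<in>box (length fs) s. scale (c (k # ks)) (fpow fs ks))" for k
  have gcar: "g k \<in> polys n" for k
    unfolding g_def by (intro carrier_sum carrier_closed fpow_carrier fscar)
  have inj: "inj_on (\<lambda>x. fst x # snd x) ({..s} \<times> box (length fs) s)" by (auto simp: inj_on_def)
  have "(\<Sum>ks\<in>box (length (f # fs)) s. scale (c ks) (fpow (f # fs) ks))
      = (\<Sum>(k, ks)\<in>{..s} \<times> box (length fs) s. scale (c (k # ks)) (f ^ k * fpow fs ks))"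
    by (simp add: box_Suc sum.reindex[OF inj] case_prod_unfold del: fpow.simps) simp
  also have "\<dots> = (\<Sum>k\<le>s. f ^ k * g k)"
    by (simp add: sum.cartesian_product[symmetric] g_def sum_distrib_left scale_mult)
  finally have sumQ: "(\<Sum>k\<le>s. f ^ k * g k) \<in> idl n Q" using Cons.prems(2) by simp
  have cz: "\<forall>ks\<in>box (length fs) s. c (k # ks) = 0" if "k \<le> s" for k
    using that
  proof (induction k rule: less_induct)
    case (less k)
    have gz: "g j = 0" if "j < k" for j
      unfolding g_def using less.IH[of j] that less.prems by (intro sum.neutral) auto
    \<comment> \<open>The part of the relation above \<open>f ^ k\<close> is \<open>f ^ k * (f * h)\<close>.\<close>
    define h where "h = (\<Sum>j\<in>{Suc k..s}. f ^ (j - Suc k) * g j)"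
    have hcar: "h \<in> polys n"
      unfolding h_def by (intro carrier_sum carrier_closed fcar gcar)
    have "{..s} = {..<k} \<union> {k..s}" "{..<k} \<inter> {k..s} = {}" using less.prems by auto
    then have "(\<Sum>j\<le>s. f ^ j * g j) = (\<Sum>j\<in>{..<k}. f ^ j * g j) + (\<Sum>j\<in>{k..s}. f ^ j * g j)"
      using sum.union_disjoint[of "{..<k}" "{k..s}" "\<lambda>j. f ^ j * g j"] by simp
    also have "(\<Sum>j\<in>{..<k}. f ^ j * g j) = 0" using gz by (intro sum.neutral) auto
    also have "(\<Sum>j\<in>{k..s}. f ^ j * g j) = f ^ k * g k + (\<Sum>j\<in>{Suc k..s}. f ^ j * g j)"
      using less.prems by (subst sum.atLeast_Suc_atMost) auto
    also have "(\<Sum>j\<in>{Suc k..s}. f ^ j * g j) = f ^ k * (f * h)"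
    proof -
      have "f ^ j * g j = f ^ k * (f * (f ^ (j - Suc k) * g j))" if "j \<in> {Suc k..s}" for j
      proof -
        have "f ^ j = f ^ (k + (1 + (j - Suc k)))" using that by simp
        also have "\<dots> = f ^ k * (f * f ^ (j - Suc k))" by (simp only: power_add power_one_right)
        finally show ?thesis by (simp add: ac_simps)
      qed
      then show ?thesis unfolding h_def sum_distrib_left by (intro sum.cong) auto
    qed
    finally have fk: "f ^ k * (g k + f * h) \<in> idl n Q" using sumQ by (simp add: distrib_left)
    have nzd: "f ^ i * p \<in> idl n Q \<Longrightarrow> p \<in> polys n \<Longrightarrow> p \<in> idl n Q" for i p
    proof (induction i)
      case (Suc i)
      have "f * (f ^ i * p) \<in> idl n Q" using Suc.prems(1) by (simp add: ac_simps)
      then have "f ^ i * p \<in> idl n Q"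
        by (rule regular_over_Cons(2)[OF Cons.prems(1), rotated]) (intro carrier_closed fcar Suc.prems(2))
      then show ?case using Suc by blast
    qed simp
    have "g k + f * h \<in> idl n Q"
      by (rule nzd[OF fk]) (intro carrier_closed gcar hcar fcar)
    moreover have "idl n Q \<subseteq> idl n (insert f Q)"
    proof -
      interpret R: cring "poly_ring n :: 'k mpoly ring" by (rule cring_poly_ring)
      show ?thesis
        by (rule Idl_least[OF R.genideal_ideal[OF fQ]]) (use Idl_incl[OF fQ] in blast)
    qed
    ultimately have "g k + f * h \<in> idl n (insert f Q)" by blast
    moreover have "h * f \<in> idl n (insert f Q)"
      by (rule Idl_mult[OF fQ hcar Idl_incl[OF fQ]]) simp
    then have "- (h * f) \<in> idl n (insert f Q)" by (rule Idl_uminus[OF fQ])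
    ultimately have "g k + f * h + - (h * f) \<in> idl n (insert f Q)"
      by (rule Idl_add[OF fQ])
    then have "g k \<in> idl n (insert f Q)" by (simp add: mult.commute)
    then show ?case
      unfolding g_def using Cons.IH[OF regular_over_Cons(1)[OF Cons.prems(1)], of "\<lambda>ks. c (k # ks)"] by blast
  qed
  obtain k ks' where "ks = k # ks'" "k \<le> s" "ks' \<in> box (length fs) s"
    using Cons.prems(3) by (auto simp: box_Suc)
  then show ?case using cz by blast
qed

lemma regular_sequence_over: "regular_sequence n fs \<Longrightarrow> regular_over n {} fs"
  for fs :: "'k::field mpoly list"
proof -
  interpret R: cring "poly_ring n :: 'k mpoly ring" by (rule cring_poly_ring)
  assume r: "regular_sequence n fs"
  then have car: "set fs \<subseteq> polys n" by (simp add: regular_sequence_def)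
  have "1 \<notin> idl n (set fs)"
  proof
    assume one: "1 \<in> idl n (set fs)"
    have "g \<in> idl n (set fs)" if "g \<in> polys n" for g
      using Idl_mult[OF car that one] by simp
    then show False using r Idl_carrier[OF car] unfolding regular_sequence_def by blast
  qed
  then show ?thesis using r unfolding regular_over_def regular_sequence_def by simp
qed

lemma fpow_exponents:
  assumes "\<And>f m i. f \<in> set fs \<Longrightarrow> m \<in> supp f \<Longrightarrow> lk m i \<le> c"
    and "ks \<in> box (length fs) s" "m \<in> supp (fpow fs ks)"
  shows "lk m i \<le> length fs * (s * c)"
  using assms
proof (induction fs arbitrary: ks m)
  case Nil
  then show ?case by (simp add: box_0)
next
  case (Cons f fs)
  obtain k ks' where ks: "ks = k # ks'" "k \<le> s" "ks' \<in> box (length fs) s"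
    using Cons.prems(2) by (auto simp: box_Suc)
  have pow: "lk m i \<le> j * c" if "m \<in> supp (f ^ j)" for j m
    using that
  proof (induction j arbitrary: m)
    case (Suc j)
    then obtain p q where "m = p + q" "p \<in> supp f" "q \<in> supp (f ^ j)"
      using Poly_Mapping.keys_mult[of f "f ^ j"] by auto
    then show ?case using Suc.IH[of q] Cons.prems(1)[of f p i] by (simp add: lookup_add)
  qed simp
  obtain p q where pq: "m = p + q" "p \<in> supp (f ^ k)" "q \<in> supp (fpow fs ks')"
    using Cons.prems(3) Poly_Mapping.keys_mult[of "f ^ k" "fpow fs ks'"] ks(1) by auto
  have "lk p i \<le> s * c" using pow[OF pq(2)] mult_le_mono1[OF ks(2), of c] by linarith
  moreover have "lk q i \<le> length fs * (s * c)"
    by (rule Cons.IH[OF _ ks(3) pq(3)]) (use Cons.prems(1) in auto)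
  ultimately show ?case using pq(1) by (simp add: lookup_add)
qed

lemma card_bounded_expos:
  "finite {m\<in>expos n. \<forall>i. lk m i \<le> b}" "card {m\<in>expos n. \<forall>i. lk m i \<le> b} \<le> Suc b ^ n"
proof -
  let ?A = "{m\<in>expos n. \<forall>i. lk m i \<le> b}" and ?f = "\<lambda>m. map (lk m) [0..<n]"
  have sub: "?f ` ?A \<subseteq> box n b" by (auto simp: box_def)
  have inj: "inj_on ?f ?A"
  proof (rule inj_onI)
    fix p q assume p: "p \<in> ?A" and q: "q \<in> ?A" and "?f p = ?f q"
    then have eq: "lk p i = lk q i" if "i < n" for i using that by (simp add: map_eq_conv)
    have "lk p i = 0" "lk q i = 0" if "\<not> i < n" for i
      using p q that by (auto simp: expos_def in_keys_iff)
    then show "p = q" using eq by (intro poly_mapping_eqI) metis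
  qed
  show "finite ?A" by (rule inj_on_finite[OF inj sub finite_box])
  show "card ?A \<le> Suc b ^ n" using card_inj_on_le[OF inj sub finite_box] by (simp add: card_box)
qed

text \<open>
  The products with exponents up to \<open>s\<close> are \<open>(s + 1)\<^sup>l\<close> independent polynomials, and the exponents of their
  monomials are at most \<open>b = l s c\<close> if \<open>c\<close> bounds those of the members. Hence \<open>(s + 1)\<^sup>l \<le> (b + 1)\<^sup>n\<close> for all \<open>s\<close>,
  which fails for large \<open>s\<close> if \<open>l > n\<close>.
\<close>

theorem regular_sequence_length:
  fixes fs :: "'k::field mpoly list"
  assumes reg: "regular_sequence n fs"
  shows "length fs \<le> n"
proof (rule ccontr)
  assume "\<not> ?thesis"
  then have n: "Suc n \<le> length fs" by simp
  let ?l = "length fs"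
  have car: "set fs \<subseteq> polys n" using reg by (simp add: regular_sequence_def)
  define c where "c = Max (insert 0 (mdegree ` (\<Union>f\<in>set fs. supp f)))"
  have c: "lk m i \<le> c" if "f \<in> set fs" "m \<in> supp f" for f m i
  proof -
    have "mdegree m \<le> c" unfolding c_def using that by (intro Max_ge) auto
    then show ?thesis using lk_le_mdegree[of m i] by simp
  qed
  \<comment> \<open>Then \<open>?l * (s * c) + 1 \<le> C * (s + 1)\<close>, and \<open>s\<close> is chosen to violate \<open>s + 1 \<le> C ^ n\<close>.\<close>
  define C where "C = Suc (?l * c)"
  define s where "s = C ^ n"
  let ?b = "?l * (s * c)"
  let ?T = "monom ` {m\<in>expos n. \<forall>i. lk m i \<le> ?b} :: 'k mpoly set"
  have indep0: "d ks = 0"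
    if "(\<Sum>ks\<in>box ?l s. scale (d ks) (fpow fs ks)) = 0" "ks \<in> box ?l s" for d ks
    using regular_over_algebraically_independent[OF regular_sequence_over[OF reg], of d s ks] that
      Idl_0[of "{}" n] by simp
  have inj: "inj_on (fpow fs) (box ?l s)"
  proof (rule inj_onI, rule ccontr)
    fix x y assume xy: "x \<in> box ?l s" "y \<in> box ?l s" "fpow fs x = fpow fs y" "x \<noteq> y"
    let ?d = "\<lambda>ks. if ks = x then 1 else if ks = y then -1 else (0::'k)"
    have "(\<Sum>ks\<in>box ?l s. scale (?d ks) (fpow fs ks)) = (\<Sum>ks\<in>{x, y}. scale (?d ks) (fpow fs ks))"
      by (rule sum.mono_neutral_right) (use xy in auto)
    also have "\<dots> = 0" using xy by simp
    finally show False using indep0[of ?d x] xy(1) by simp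
  qed
  have "mp.independent (fpow fs ` box ?l s)"
  proof (rule mp.independent_if_scalars_zero)
    fix d x assume "(\<Sum>x\<in>fpow fs ` box ?l s. scale (d x) x) = 0" and x: "x \<in> fpow fs ` box ?l s"
    then have "(\<Sum>ks\<in>box ?l s. scale (d (fpow fs ks)) (fpow fs ks)) = 0" by (simp add: sum.reindex[OF inj])
    then show "d x = 0" using indep0[of "\<lambda>ks. d (fpow fs ks)"] x by auto
  qed simp
  moreover have "fpow fs ` box ?l s \<subseteq> mp.span ?T"
  proof
    fix p assume "p \<in> fpow fs ` box ?l s"
    then obtain ks where ks: "ks \<in> box ?l s" "p = fpow fs ks" by blast
    have "scale (cf p m) (monom m) \<in> mp.span ?T" if m: "m \<in> supp p" for m
    proof (intro mp.span_scale mp.span_base imageI CollectI conjI allI)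
      show "m \<in> expos n" using fpow_carrier[OF car, of ks] m ks(2) by (auto simp: carrier_iff)
      show "lk m i \<le> ?b" for i
        by (rule fpow_exponents[where fs = fs and c = c, OF c ks(1)]) (use m ks(2) in auto)
    qed
    then show "p \<in> mp.span ?T" by (subst poly_expand_scale[of p]) (rule mp.span_sum)
  qed
  ultimately have "card (fpow fs ` box ?l s) \<le> card ?T"
    using mp.independent_span_bound[of ?T] card_bounded_expos(1)[of n ?b] by blast
  also have "\<dots> \<le> card {m\<in>expos n. \<forall>i. lk m i \<le> ?b}" by (rule card_image_le[OF card_bounded_expos(1)])
  also have "\<dots> \<le> Suc ?b ^ n" by (rule card_bounded_expos(2))
  also have "\<dots> \<le> (C * Suc s) ^ n" unfolding C_def by (intro power_mono) (auto simp: algebra_simps)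
  finally have "Suc s ^ ?l \<le> C ^ n * Suc s ^ n"
    by (simp only: card_image[OF inj] card_box power_mult_distrib)
  moreover have "Suc s ^ Suc n \<le> Suc s ^ ?l" by (rule power_increasing[OF n]) simp
  ultimately have "Suc s * Suc s ^ n \<le> C ^ n * Suc s ^ n" by (simp only: power_Suc)
  then have "Suc s \<le> C ^ n" by (rule mult_right_le_imp_le) simp
  then show False by (simp add: s_def)
qed

section \<open>Families without relations of low degree\<close>

text \<open>
  No nontrivial relation with coefficients of degree \<open>s\<close>. Level 0 is linear independence over the field;
  higher levels approximate linear independence over the polynomial ring.
\<close>

definition indep_level :: "nat \<Rightarrow> nat \<Rightarrow> 'k::field mpoly list \<Rightarrow> bool" where
  "indep_level n s gs \<longleftrightarrow> (\<forall>c. (\<forall>i<length gs. homogeneous n s (c i)) \<and> (\<Sum>i<length gs. c i * gs ! i) = 0 \<longrightarrow>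
     (\<forall>i<length gs. c i = 0))"

lemma indep_levelD:
  assumes "indep_level n s gs" "\<And>i. i < length gs \<Longrightarrow> homogeneous n s (c i)"
    "(\<Sum>i<length gs. c i * gs ! i) = 0" "i < length gs"
  shows "c i = 0"
  using assms(1)[unfolded indep_level_def, THEN spec, of c] assms(2-4) by simp

definition combines :: "nat \<Rightarrow> nat \<Rightarrow> 'k::field mpoly list \<Rightarrow> (nat \<Rightarrow> 'k mpoly) \<Rightarrow> 'k mpoly \<Rightarrow> bool" where
  "combines n s gs c f \<longleftrightarrow> (\<forall>i<length gs. homogeneous n s (c i)) \<and> f = (\<Sum>i<length gs. c i * gs ! i)"

lemma combines_add: "combines n s gs c f \<Longrightarrow> combines n s gs c' f' \<Longrightarrow> combines n s gs (\<lambda>i. c i + c' i) (f + f')"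
  by (auto simp: combines_def homogeneous_add sum.distrib algebra_simps)

lemma combines_scale: "combines n s gs c f \<Longrightarrow> combines n s gs (\<lambda>i. scale a (c i)) (scale a f)"
  by (auto simp: combines_def homogeneous_scale mp.scale_sum_right scale_mult)

lemma combines_mult:
  "homogeneous n r p \<Longrightarrow> combines n s gs c f \<Longrightarrow> combines n (r + s) gs (\<lambda>i. p * c i) (p * f)"
  by (auto simp: combines_def homogeneous_mult sum_distrib_left ac_simps)

lemma combines_unique:
  assumes "indep_level n s gs" "combines n s gs c f" "combines n s gs c' f" "i < length gs"
  shows "c i = c' i"
proof -
  have zero: "p + scale (- 1) p = 0" for p :: "'a mpoly" by simp
  have "combines n s gs (\<lambda>i. c i + scale (- 1) (c' i)) (f + scale (- 1) f)"
    by (rule combines_add[OF assms(2) combines_scale[OF assms(3)]])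
  then have h: "\<forall>i<length gs. homogeneous n s (c i + scale (- 1) (c' i))"
    and "0 = (\<Sum>i<length gs. (c i + scale (- 1) (c' i)) * gs ! i)"
    unfolding combines_def zero by (rule conjunct1, rule conjunct2)
  then have "c i + scale (- 1) (c' i) = 0"
    by (intro indep_levelD[where c = "\<lambda>i. c i + scale (- 1) (c' i)", OF assms(1) _ _ assms(4)])
       (simp only: h, rule sym)
  then show ?thesis by simp
qed

lemma homogeneous_x0: "n \<ge> 1 \<Longrightarrow> homogeneous n e (monom (xpow 0 e))"
  by (intro homogeneous_monom mons_single) auto

lemma indep_level_mono:
  assumes "indep_level n s gs" "s' \<le> s" "n \<ge> 1" shows "indep_level n s' gs"
  unfolding indep_level_def
proof (intro allI impI, elim conjE)
  fix c i assume c: "\<forall>i<length gs. homogeneous n s' (c i)" and sum0: "(\<Sum>i<length gs. c i * gs ! i) = 0"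
    and i: "i < length gs"
  let ?x = "monom (xpow 0 (s - s'))"
  have "combines n s' gs c 0" using c sum0 by (simp add: combines_def)
  then have "combines n ((s - s') + s') gs (\<lambda>i. ?x * c i) (?x * 0)"
    by (intro combines_mult homogeneous_x0 assms(3))
  moreover have "combines n s gs (\<lambda>i. 0) 0" by (simp add: combines_def)
  ultimately have "?x * c i = 0"
    using combines_unique[OF assms(1) _ _ i, of "\<lambda>i. ?x * c i" 0 "\<lambda>i. 0"] assms(2) by simp
  then show "c i = 0" by simp
qed

lemma homogeneous_const: "homogeneous n 0 (scale d 1)"
  using homogeneous_scale[OF homogeneous_monom[of 0 n 0], of d] by simp

lemma indep_level_0_length:
  assumes ind: "indep_level n 0 gs" and V: "set gs \<subseteq> mp.span B" "finite B"
  shows "length gs \<le> card B"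
proof -
  have lin: "d i = 0" if "(\<Sum>i<length gs. scale (d i) (gs ! i)) = 0" "i < length gs" for d i
  proof -
    have "scale (d i) 1 = (0 :: 'a mpoly)"
      by (rule indep_levelD[OF ind homogeneous_const _ that(2)]) (use that(1) in \<open>simp add: scale_mult\<close>)
    then show ?thesis by (simp add: mp.scale_eq_0_iff)
  qed
  have dist: "distinct gs"
    unfolding distinct_conv_nth
  proof (intro allI impI notI)
    fix x y assume xy: "x < length gs" "y < length gs" "x \<noteq> y" "gs ! x = gs ! y"
    let ?d = "\<lambda>i. if i = x then 1 else if i = y then -1 else (0::'a)"
    have "(\<Sum>i<length gs. scale (?d i) (gs ! i)) = (\<Sum>i\<in>{x, y}. scale (?d i) (gs ! i))"
      by (rule sum.mono_neutral_right) (use xy in auto)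
    also have "\<dots> = 0" using xy by simp
    finally show False using lin[of ?d x] xy(1) by simp
  qed
  have bij: "bij_betw (\<lambda>i. gs ! i) {..<length gs} (set gs)" by (rule bij_betw_nth[OF dist]) auto
  have "mp.independent (set gs)"
  proof (rule mp.independent_if_scalars_zero)
    fix d x assume "(\<Sum>x\<in>set gs. scale (d x) x) = 0" and x: "x \<in> set gs"
    then have "(\<Sum>i<length gs. scale (d (gs ! i)) (gs ! i)) = 0"
      by (simp add: sum.reindex_bij_betw[OF bij, of "\<lambda>x. scale (d x) x"])
    then show "d x = 0" using lin[of "\<lambda>i. d (gs ! i)"] x by (auto simp: in_set_conv_nth)
  qed simp
  then have "card (set gs) \<le> card B" using mp.independent_span_bound[OF V(2) _ V(1)] by blast
  then show ?thesis by (simp add: distinct_card[OF dist])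
qed

text \<open>
  In a relation that involves \<open>f\<close> for the first time, the coefficient of \<open>f\<close> is not zero and serves as a
  denominator for \<open>f\<close>.
\<close>

lemma dependent_step:
  assumes ind: "indep_level n s gs" and dep: "\<not> indep_level n s (gs @ [f])"
  shows "\<exists>\<delta> c. \<delta> \<noteq> 0 \<and> homogeneous n s \<delta> \<and> combines n s gs c (\<delta> * f)"
proof -
  let ?l = "length gs"
  obtain c j where c: "\<forall>i<Suc ?l. homogeneous n s (c i)" "(\<Sum>i<Suc ?l. c i * (gs @ [f]) ! i) = 0"
    "j < Suc ?l" "c j \<noteq> 0"
    using dep unfolding indep_level_def by auto
  have "(\<Sum>i<?l. c i * (gs @ [f]) ! i) = (\<Sum>i<?l. c i * gs ! i)"
    by (rule sum.cong) (simp_all add: nth_append)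
  then have s: "(\<Sum>i<?l. c i * gs ! i) + c ?l * f = 0"
    using c(2) unfolding sum.lessThan_Suc nth_append_length by (rule subst)
  have nz: "c ?l \<noteq> 0"
  proof
    assume z: "c ?l = 0"
    have s0: "(\<Sum>i<?l. c i * gs ! i) = 0" using s unfolding z by simp
    have "c i = 0" if "i < ?l" for i
      by (rule indep_levelD[OF ind _ s0 that]) (use c(1) in simp)
    then show False using z c(3,4) by (auto simp: less_Suc_eq)
  qed
  have "combines n s gs (\<lambda>i. scale (- 1) (c i)) (scale (- 1) (\<Sum>i<?l. c i * gs ! i))"
    by (rule combines_scale) (use c(1) in \<open>simp add: combines_def\<close>)
  moreover have "scale (- 1) (\<Sum>i<?l. c i * gs ! i) = c ?l * f"
    using s by (simp add: neg_eq_iff_add_eq_0)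
  ultimately show ?thesis using nz c(1) by auto
qed

text \<open>
  The level at which a family has to be independent if at most \<open>k\<close> further elements may have to be adjoined.
  When the search stops, denominators have the degree of the next smaller bound; a product of \<open>M\<close> of them,
  together with \<open>t\<close> further degrees, must still be within the level of independence.
\<close>

primrec level_bound :: "nat \<Rightarrow> nat \<Rightarrow> nat \<Rightarrow> nat" where
  "level_bound M t 0 = t"
| "level_bound M t (Suc k) = M * level_bound M t k + t"

text \<open>
  As long as some \<open>f \<in> V\<close> is independent of the family at the next smaller level, adjoin it. Since
  independence at level 0 limits the length by the dimension, this stops after at most \<open>k\<close> steps, and then
  every \<open>f \<in> V\<close> has a denominator of degree \<open>s\<close> that is small compared with the level still available.
\<close>

lemma maximal_extension:
  fixes gs :: "'k::field mpoly list"
  assumes n: "n \<ge> 1" and M: "M \<ge> 1" and V: "V \<subseteq> mp.span B" "finite B" "card B \<le> M"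
    and gs: "set gs \<subseteq> V" "M \<le> length gs + k" "indep_level n (level_bound M t k) gs"
  shows "\<exists>rest s. set rest \<subseteq> V \<and> indep_level n (M * s + t) (gs @ rest) \<and>
    (\<forall>f\<in>V. \<exists>\<delta> c. \<delta> \<noteq> 0 \<and> homogeneous n s \<delta> \<and> combines n s (gs @ rest) c (\<delta> * f))"
  using gs
proof (induction k arbitrary: gs)
  case 0
  have "\<not> indep_level n 0 (gs @ [f])" if "f \<in> V" for f
  proof
    assume "indep_level n 0 (gs @ [f])"
    then have "length (gs @ [f]) \<le> card B" by (rule indep_level_0_length) (use 0 that V in auto)
    then show False using 0 V by simp
  qed
  moreover have "indep_level n 0 gs" by (rule indep_level_mono[OF 0(3) _ n]) simp
  ultimately have "\<forall>f\<in>V. \<exists>\<delta> c. \<delta> \<noteq> 0 \<and> homogeneous n 0 \<delta> \<and> combines n 0 gs c (\<delta> * f)"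
    using dependent_step by blast
  then show ?case using 0(3) by (intro exI[of _ "[]"] exI[of _ 0]) simp
next
  case (Suc k)
  let ?s = "level_bound M t k"
  have ind: "indep_level n ?s gs"
    by (rule indep_level_mono[OF Suc.prems(3) _ n]) (use M in \<open>simp add: trans_le_add1\<close>)
  show ?case
  proof (cases "\<exists>f\<in>V. indep_level n ?s (gs @ [f])")
    case True
    then obtain f where f: "f \<in> V" "indep_level n ?s (gs @ [f])" by blast
    have "\<exists>rest s. set rest \<subseteq> V \<and> indep_level n (M * s + t) ((gs @ [f]) @ rest) \<and>
      (\<forall>f'\<in>V. \<exists>\<delta> c. \<delta> \<noteq> 0 \<and> homogeneous n s \<delta> \<and> combines n s ((gs @ [f]) @ rest) c (\<delta> * f'))"
      by (rule Suc.IH) (use Suc.prems f in auto)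
    then obtain rest s where r: "set rest \<subseteq> V" "indep_level n (M * s + t) ((gs @ [f]) @ rest)"
      "\<forall>f'\<in>V. \<exists>\<delta> c. \<delta> \<noteq> 0 \<and> homogeneous n s \<delta> \<and> combines n s ((gs @ [f]) @ rest) c (\<delta> * f')"
      by blast
    show ?thesis
      by (rule exI[of _ "f # rest"], rule exI[of _ s]) (use r f in simp)
  next
    case False
    then have "\<forall>f\<in>V. \<exists>\<delta> c. \<delta> \<noteq> 0 \<and> homogeneous n ?s \<delta> \<and> combines n ?s gs c (\<delta> * f)"
      using dependent_step[OF ind] by blast
    then show ?thesis using Suc.prems(3) by (intro exI[of _ "[]"] exI[of _ ?s]) simp
  qed
qed

lemma common_denominator:
  assumes "finite B"
    and "\<And>f. f \<in> B \<Longrightarrow> \<exists>\<delta> c. \<delta> \<noteq> 0 \<and> homogeneous n s \<delta> \<and> combines n s gs c (\<delta> * f)"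
  shows "\<exists>\<delta>. \<delta> \<noteq> 0 \<and> homogeneous n (card B * s) \<delta> \<and>
    (\<forall>f\<in>mp.span B. \<exists>c. combines n (card B * s) gs c (\<delta> * f))"
proof -
  have "\<exists>\<delta>. \<delta> \<noteq> 0 \<and> homogeneous n (card B * s) \<delta> \<and> (\<forall>f\<in>B. \<exists>c. combines n (card B * s) gs c (\<delta> * f))"
    using assms
  proof (induction B rule: finite_induct)
    case empty
    show ?case
      by (rule exI[of _ 1]) (use homogeneous_monom[of 0 n 0] in simp)
  next
    case (insert x B)
    obtain \<delta> where d: "\<delta> \<noteq> 0" "homogeneous n (card B * s) \<delta>" "\<forall>f\<in>B. \<exists>c. combines n (card B * s) gs c (\<delta> * f)"
      using insert by auto
    obtain \<epsilon> c where e: "\<epsilon> \<noteq> 0" "homogeneous n s \<epsilon>" "combines n s gs c (\<epsilon> * x)" using insert.prems[of x] by auto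
    have deg: "card (insert x B) * s = s + card B * s" using insert by simp
    have "\<exists>c. combines n (s + card B * s) gs c (\<epsilon> * \<delta> * f)" if f: "f \<in> insert x B" for f
    proof (cases "f = x")
      case True
      have "combines n (card B * s + s) gs (\<lambda>i. \<delta> * c i) (\<delta> * (\<epsilon> * x))" by (rule combines_mult[OF d(2) e(3)])
      then show ?thesis using True by (auto simp: ac_simps)
    next
      case False
      then obtain c' where "combines n (card B * s) gs c' (\<delta> * f)" using d(3) f by auto
      then have "combines n (s + card B * s) gs (\<lambda>i. \<epsilon> * c' i) (\<epsilon> * (\<delta> * f))" by (rule combines_mult[OF e(2)])
      then show ?thesis by (auto simp: ac_simps)
    qed
    moreover have "\<epsilon> * \<delta> \<noteq> 0" using d e by simp
    moreover have "homogeneous n (s + card B * s) (\<epsilon> * \<delta>)" by (rule homogeneous_mult[OF e(2) d(2)])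
    ultimately show ?case unfolding deg by blast
  qed
  then obtain \<delta> where d: "\<delta> \<noteq> 0" "homogeneous n (card B * s) \<delta>" "\<forall>f\<in>B. \<exists>c. combines n (card B * s) gs c (\<delta> * f)"
    by blast
  have "\<exists>c. combines n (card B * s) gs c (\<delta> * f)" if "f \<in> mp.span B" for f
    using that
  proof (induction rule: mp.span_induct_alt)
    case base
    show ?case by (rule exI[of _ "\<lambda>_. 0"]) (simp add: combines_def)
  next
    case (step a x y)
    obtain c c' where "combines n (card B * s) gs c (\<delta> * x)" "combines n (card B * s) gs c' (\<delta> * y)"
      using step d(3) by blast
    then have "combines n (card B * s) gs (\<lambda>i. scale a (c i) + c' i) (scale a (\<delta> * x) + \<delta> * y)"
      by (intro combines_add combines_scale)
    moreover have "scale a (\<delta> * x) + \<delta> * y = \<delta> * (scale a x + y)" by (simp add: distrib_left scale_mult)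
    ultimately show ?case by auto
  qed
  then show ?thesis using d(1,2) by blast
qed

text \<open>
  Multiplying the denominators of a basis of \<open>V\<close> yields a common one. Its degree \<open>q\<close> stays so small that the
  family is independent even at level \<open>q + t\<close>.
\<close>

lemma low_degree_presentation:
  fixes gs :: "'k::field mpoly list"
  assumes n: "n \<ge> 1" and M: "M \<ge> 1" and V: "V \<subseteq> mp.span S" "finite S" "card S \<le> M"
    and gs: "set gs \<subseteq> V" "indep_level n (level_bound M t M) gs"
  obtains rest q \<delta> where "\<delta> \<noteq> 0" "homogeneous n q \<delta>" "indep_level n (q + t) (gs @ rest)"
    "\<And>f. f \<in> V \<Longrightarrow> \<exists>c. combines n q (gs @ rest) c (\<delta> * f)"
proof -
  obtain B where B: "B \<subseteq> V" "mp.independent B" "V \<subseteq> mp.span B" by (rule mp.maximal_independent_subset)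
  have Bc: "finite B" "card B \<le> card S" using mp.independent_span_bound[OF V(2) B(2)] B(1) V(1) by auto
  have BM: "card B \<le> M" using Bc V by simp
  obtain rest s where r: "indep_level n (M * s + t) (gs @ rest)"
    "\<forall>f\<in>V. \<exists>\<delta> c. \<delta> \<noteq> 0 \<and> homogeneous n s \<delta> \<and> combines n s (gs @ rest) c (\<delta> * f)"
    using maximal_extension[OF n M B(3) Bc(1) BM gs(1) _ gs(2)] by auto
  have "\<exists>\<delta>. \<delta> \<noteq> 0 \<and> homogeneous n (card B * s) \<delta> \<and>
    (\<forall>f\<in>mp.span B. \<exists>c. combines n (card B * s) (gs @ rest) c (\<delta> * f))"
    by (rule common_denominator[OF Bc(1)]) (use r(2) B(1) in blast)
  then obtain \<delta> where d: "\<delta> \<noteq> 0" "homogeneous n (card B * s) \<delta>"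
    "\<forall>f\<in>mp.span B. \<exists>c. combines n (card B * s) (gs @ rest) c (\<delta> * f)" by blast
  have "indep_level n (card B * s + t) (gs @ rest)"
    by (rule indep_level_mono[OF r(1) _ n]) (use BM in simp)
  then show ?thesis using that d B(3) by blast
qed

section \<open>Decomposition of the Hilbert function\<close>

text \<open>
  Packs a tuple of polynomials into a single one, in which the additional variable with index \<open>n\<close> marks the
  component. A leading monomial of the result then names a component and a monomial in it.
\<close>

definition encode :: "nat \<Rightarrow> nat \<Rightarrow> (nat \<Rightarrow> 'k::field mpoly) \<Rightarrow> 'k mpoly" where
  "encode n k c = (\<Sum>i<k. monom (xpow n i) * c i)"

lemma encode_keys: "supp (encode n k c) \<subseteq> (\<Union>i<k. (\<lambda>m. m + xpow n i) ` supp (c i))"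
proof -
  have "supp (encode n k c) \<subseteq> (\<Union>i<k. supp (monom (xpow n i) * c i))"
    unfolding encode_def by (rule Poly_Mapping.keys_sum)
  then show ?thesis by (simp add: keys_monom_mult add.commute)
qed

lemma cf_encode:
  assumes "\<And>i. i < k \<Longrightarrow> c i \<in> polys n" "i < k" "m \<in> expos n"
  shows "cf (encode n k c) (m + xpow n i) = cf (c i) m"
proof -
  have z: "cf (monom (xpow n j) * c j) (m + xpow n i) = 0" if "j < k" "j \<noteq> i" for j
  proof (rule ccontr)
    assume "\<not> ?thesis"
    then have "m + xpow n i \<in> supp (monom (xpow n j) * c j)"
      by (simp add: in_keys_iff)
    then obtain m' where m': "m' \<in> supp (c j)" "m + xpow n i = xpow n j + m'"
      by (auto simp: keys_monom_mult)
    have "m' \<in> expos n" using assms(1)[OF that(1)] m'(1) by (auto simp: carrier_iff)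
    then have "lk m n = 0" "lk m' n = 0" using assms(3) by (auto simp: expos_def in_keys_iff)
    moreover have "lk (m + xpow n i) n = lk (xpow n j + m') n" using m'(2) by simp
    ultimately show False using that(2) by (simp add: lookup_add)
  qed
  have "cf (encode n k c) (m + xpow n i)
      = (\<Sum>j<k. cf (monom (xpow n j) * c j) (m + xpow n i))"
    unfolding encode_def lookup_sum ..
  also have "\<dots> = (\<Sum>j\<in>{i}. cf (monom (xpow n j) * c j) (m + xpow n i))"
    by (rule sum.mono_neutral_right) (use assms(2) z in auto)
  also have "\<dots> = cf (c i) m" using cf_monom_mult[of "xpow n i" "c i" m] by (simp add: add.commute)
  finally show ?thesis .
qed

text \<open>
  An element \<open>f\<close> of degree \<open>\<alpha> + j\<close> has unique coefficients \<open>C j f\<close> of degree \<open>q + j\<close> in the representation of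
  \<open>\<delta> x\<^sub>0\<^sup>t f\<close> by the \<open>g\<^sub>i\<close>: the factor \<open>x\<^sub>0\<^sup>t\<close> suffices to lift \<open>f\<close> to degree \<open>\<alpha> + t\<close>, where \<open>\<delta>\<close> clears denominators.
  The leading monomials \<open>A i j\<close> of the encoded coefficients, sorted by component, count the dimension.
  Multiplication by a variable commutes with this representation, so each component grows as a set of
  monomials. Finally \<open>f\<^sub>i\<close> is represented by \<open>\<delta>\<close> times a power of \<open>x\<^sub>0\<close> in component \<open>i\<close> alone, so that its
  multiples fill the \<open>i\<close>-th component with a copy of all monomials of the complementary degree.
\<close>

lemma hilbert_decomposition:
  fixes I :: "'k::field mpoly set" and fs gs :: "'k mpoly list" and as :: "nat list"
  assumes n: "n \<ge> 1"
    and I: "0 \<in> I" "\<And>f g. f \<in> I \<Longrightarrow> g \<in> I \<Longrightarrow> f + g \<in> I" "\<And>c f. f \<in> I \<Longrightarrow> scale c f \<in> I"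
      "\<And>u f. u \<in> expos n \<Longrightarrow> f \<in> I \<Longrightarrow> monom u * f \<in> I"
    and \<delta>: "\<delta> \<noteq> 0" "homogeneous n q \<delta>" and ind: "indep_level n (q + t) gs"
    and pres: "\<And>f. f \<in> I \<Longrightarrow> homogeneous n (\<alpha> + t) f \<Longrightarrow> \<exists>c. combines n q gs c (\<delta> * f)"
    and as: "length as \<le> length gs" "\<And>i. i < length as \<Longrightarrow> as ! i \<le> t"
    and fs: "\<And>i. i < length as \<Longrightarrow> fs ! i \<in> I" "\<And>i. i < length as \<Longrightarrow> homogeneous n (\<alpha> + as ! i) (fs ! i)"
      "\<And>i. i < length as \<Longrightarrow> gs ! i = monom (xpow 0 (t - as ! i)) * fs ! i"
      "\<And>i. i < length as \<Longrightarrow> fs ! i \<noteq> 0"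
  obtains u where "\<And>j. j \<le> t \<Longrightarrow> hilbert n I (\<alpha> + j) = (\<Sum>i<length gs. u i j)"
    "\<And>i j. i < length gs \<Longrightarrow> j < t \<Longrightarrow> growth n (u i j) \<le> u i (Suc j)"
    "\<And>i j. i < length as \<Longrightarrow> j \<le> t \<Longrightarrow> pcount n (Suc j - as ! i) \<le> u i j"
proof -
  let ?k = "length gs" and ?X = "{..<n}"
  let ?x = "\<lambda>e. monom (xpow 0 e) :: 'k mpoly"
  define W where "W j = {f \<in> I. homogeneous n (\<alpha> + j) f}" for j
  have subW: "mp.subspace (W j)" for j unfolding W_def by (rule subspace_homogeneous[OF I(1-3)])
  have x0e: "xpow 0 e \<in> expos n" for e using n by (simp add: expos_def)
  have ex: "\<exists>c. combines n (q + j) gs c (\<delta> * ?x t * f)" if "f \<in> W j" "j \<le> t" for j f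
  proof -
    have f: "f \<in> I" "homogeneous n (\<alpha> + j) f" using that by (auto simp: W_def)
    have "homogeneous n (t - j + (\<alpha> + j)) (?x (t - j) * f)"
      by (rule homogeneous_mult[OF homogeneous_x0[OF n] f(2)])
    moreover have "t - j + (\<alpha> + j) = \<alpha> + t" using that(2) by simp
    ultimately have "homogeneous n (\<alpha> + t) (?x (t - j) * f)" by simp
    moreover have "?x (t - j) * f \<in> I" by (rule I(4)[OF x0e f(1)])
    ultimately obtain c where c: "combines n q gs c (\<delta> * (?x (t - j) * f))" using pres by blast
    have "combines n (j + q) gs (\<lambda>i. ?x j * c i) (?x j * (\<delta> * (?x (t - j) * f)))"
      by (rule combines_mult[OF homogeneous_x0[OF n] c])
    moreover have "?x j * (\<delta> * (?x (t - j) * f)) = \<delta> * (?x j * ?x (t - j)) * f" by (simp add: ac_simps)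
    moreover have "?x j * ?x (t - j) = ?x t" using that(2) by (simp add: monom_mult flip: single_add)
    ultimately show ?thesis by (auto simp: add.commute)
  qed
  define C where "C j f = (SOME c. combines n (q + j) gs c (\<delta> * ?x t * f))" for j f
  have C: "combines n (q + j) gs (C j f) (\<delta> * ?x t * f)" if "f \<in> W j" "j \<le> t" for j f
    unfolding C_def by (rule someI_ex[OF ex[OF that]])
  have indj: "indep_level n (q + j) gs" if "j \<le> t" for j
    by (rule indep_level_mono[OF ind _ n]) (use that in simp)
  have Cu: "C j f i = c i" if "f \<in> W j" "j \<le> t" "combines n (q + j) gs c (\<delta> * ?x t * f)" "i < ?k" for j f c i
    by (rule combines_unique[OF indj[OF that(2)] C[OF that(1,2)] that(3,4)])
  have Ccar: "C j f i \<in> polys n" if "f \<in> W j" "j \<le> t" "i < ?k" for j f i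
    using C[OF that(1,2)] that(3) unfolding combines_def by (auto intro: homogeneous_carrier)
  define \<Phi> where "\<Phi> j f = encode n ?k (C j f)" for j f
  have \<Phi>eq: "\<Phi> j f = encode n ?k c" if "f \<in> W j" "j \<le> t" "combines n (q + j) gs c (\<delta> * ?x t * f)" for j f c
    unfolding \<Phi>_def encode_def using Cu[OF that] by (intro sum.cong) auto
  have \<Phi>add: "\<Phi> j (f + g) = \<Phi> j f + \<Phi> j g" if "f \<in> W j" "g \<in> W j" "j \<le> t" for j f g
  proof -
    have "combines n (q + j) gs (\<lambda>i. C j f i + C j g i) (\<delta> * ?x t * f + \<delta> * ?x t * g)"
      by (rule combines_add[OF C C]) (use that in auto)
    then have "\<Phi> j (f + g) = encode n ?k (\<lambda>i. C j f i + C j g i)"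
      by (intro \<Phi>eq mp.subspace_add[OF subW] that) (simp add: distrib_left)
    then show ?thesis by (simp add: \<Phi>_def encode_def distrib_left sum.distrib)
  qed
  have \<Phi>sc: "\<Phi> j (scale a f) = scale a (\<Phi> j f)" if "f \<in> W j" "j \<le> t" for j f a
  proof -
    have "combines n (q + j) gs (\<lambda>i. scale a (C j f i)) (scale a (\<delta> * ?x t * f))"
      by (rule combines_scale[OF C]) (use that in auto)
    then have "\<Phi> j (scale a f) = encode n ?k (\<lambda>i. scale a (C j f i))"
      by (intro \<Phi>eq mp.subspace_scale[OF subW] that) (simp add: scale_mult)
    then show ?thesis by (simp add: \<Phi>_def encode_def mp.scale_sum_right scale_mult)
  qed
  have \<Phi>inj: "f = 0" if "f \<in> W j" "j \<le> t" "\<Phi> j f = 0" for j f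
  proof -
    have "C j f i = 0" if i: "i < ?k" for i
    proof (rule poly_mapping_eqI)
      fix m
      show "cf (C j f i) m = cf 0 m"
      proof (cases "m \<in> expos n")
        case True
        have "cf (encode n ?k (C j f)) (m + xpow n i) = cf (C j f i) m"
          by (rule cf_encode[OF Ccar i True]) (use \<open>f \<in> W j\<close> \<open>j \<le> t\<close> in auto)
        then show ?thesis using \<open>\<Phi> j f = 0\<close> by (simp add: \<Phi>_def)
      next
        case False
        then show ?thesis using Ccar[OF \<open>f \<in> W j\<close> \<open>j \<le> t\<close> i] by (auto simp: carrier_iff in_keys_iff subset_iff)
      qed
    qed
    then have "\<delta> * ?x t * f = 0" using C[OF that(1,2)] by (simp add: combines_def)
    then show ?thesis using \<delta>(1) by simp
  qed
  define \<Lambda> where "\<Lambda> j = (\<lambda>f. lm (\<Phi> j f)) ` (W j - {0})" for j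
  define A where "A i j = {m \<in> mons ?X (q + j). m + xpow n i \<in> \<Lambda> j}" for i j
  have \<Lambda>A: "\<Lambda> j = (\<Union>i\<in>{..<?k}. (\<lambda>m. m + xpow n i) ` A i j)" if j: "j \<le> t" for j
  proof
    show "(\<Union>i\<in>{..<?k}. (\<lambda>m. m + xpow n i) ` A i j) \<subseteq> \<Lambda> j" by (auto simp: A_def)
    show "\<Lambda> j \<subseteq> (\<Union>i\<in>{..<?k}. (\<lambda>m. m + xpow n i) ` A i j)"
    proof
      fix w assume w: "w \<in> \<Lambda> j"
      then obtain f where f: "f \<in> W j" "f \<noteq> 0" "w = lm (\<Phi> j f)" by (auto simp: \<Lambda>_def)
      then have "\<Phi> j f \<noteq> 0" using \<Phi>inj j by blast
      then have "w \<in> supp (encode n ?k (C j f))" using lm_in_keys f(3) unfolding \<Phi>_def by blast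
      then obtain i m where i: "i < ?k" "m \<in> supp (C j f i)" "w = m + xpow n i"
        using encode_keys[of n ?k "C j f"] by blast
      have "m \<in> mons ?X (q + j)"
        using C[OF f(1) j] i(1,2) unfolding combines_def homogeneous_iff by blast
      then have "m \<in> A i j" using w i(3) by (simp add: A_def)
      then show "w \<in> (\<Union>i\<in>{..<?k}. (\<lambda>m. m + xpow n i) ` A i j)" using i by blast
    qed
  qed
  have finA: "finite (A i j)" for i j by (simp add: A_def)
  have An: "lk m n = 0" if "m \<in> A i j" for m i j using that by (auto simp: A_def mons_def in_keys_iff)
  have "hilbert n I (\<alpha> + j) = (\<Sum>i<?k. card (A i j))" if j: "j \<le> t" for j
  proof -
    have fin: "finite (\<Lambda> j)" unfolding \<Lambda>A[OF j] using finA by simp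
    have "hilbert n I (\<alpha> + j) = mp.dim (W j)" by (simp add: hilbert_def W_def)
    also have "\<dots> = card (\<Lambda> j)"
      unfolding \<Lambda>_def by (rule dim_eq_card_lm[OF subW]) (use \<Phi>add \<Phi>sc \<Phi>inj j fin in \<open>auto simp: \<Lambda>_def\<close>)
    also have "\<dots> = (\<Sum>i<?k. card (A i j))"
      unfolding \<Lambda>A[OF j] by (rule card_layers) (use finA An in auto)
    finally show ?thesis .
  qed
  moreover have "growth n (card (A i j)) \<le> card (A i (Suc j))" if i: "i < ?k" and j: "j < t" for i j
  proof -
    have "grow ?X (A i j) \<subseteq> A i (Suc j)"
    proof
      fix w assume "w \<in> grow ?X (A i j)"
      then obtain m v where m: "m \<in> A i j" "v < n" "w = m + var v" by (auto elim: growE)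
      obtain f where f: "f \<in> W j" "f \<noteq> 0" "m + xpow n i = lm (\<Phi> j f)"
        using m(1) by (auto simp: A_def \<Lambda>_def)
      have ve: "var v \<in> expos n" and vm: "var v \<in> mons ?X 1" using m(2) by (auto simp: expos_def mons_def)
      have hv: "homogeneous n 1 (monom (var v))" by (rule homogeneous_monom[OF vm])
      have vf: "monom (var v) * f \<in> W (Suc j)"
        using f(1) I(4)[OF ve] homogeneous_mult[OF hv, of "\<alpha> + j" f] by (auto simp: W_def)
      have "combines n (1 + (q + j)) gs (\<lambda>i. monom (var v) * C j f i) (monom (var v) * (\<delta> * ?x t * f))"
        using combines_mult[OF hv C[OF f(1)]] j by simp
      then have "\<Phi> (Suc j) (monom (var v) * f) = encode n ?k (\<lambda>i. monom (var v) * C j f i)"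
        using j by (intro \<Phi>eq[OF vf]) (simp_all add: ac_simps)
      also have "\<dots> = monom (var v) * \<Phi> j f"
        by (simp add: \<Phi>_def encode_def sum_distrib_left ac_simps)
      finally have "lm (\<Phi> (Suc j) (monom (var v) * f)) = var v + lm (\<Phi> j f)"
        using lm_monom_mult[of "\<Phi> j f" "var v"] \<Phi>inj[of f j] f j by auto
      then have "w + xpow n i = lm (\<Phi> (Suc j) (monom (var v) * f))"
        unfolding m(3) f(3)[symmetric] by (simp add: ac_simps)
      moreover have "monom (var v) * f \<noteq> 0" using f(2) by simp
      ultimately have "w + xpow n i \<in> \<Lambda> (Suc j)" using vf by (auto simp: \<Lambda>_def)
      moreover have "w \<in> mons ?X (q + Suc j)"
        using mons_add_var[of m ?X "q + j" v] m by (simp add: A_def)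
      ultimately show "w \<in> A i (Suc j)" by (simp add: A_def)
    qed
    then have "card (grow ?X (A i j)) \<le> card (A i (Suc j))" by (rule card_mono[OF finA])
    moreover have "growth n (card (A i j)) \<le> card (grow ?X (A i j))"
      by (rule growth_le[of _ _ "q + j"]) (auto simp: A_def)
    ultimately show ?thesis by simp
  qed
  moreover have "pcount n (Suc j - as ! i) \<le> card (A i j)" if i: "i < length as" and j: "j \<le> t" for i j
  proof (cases "as ! i \<le> j")
    case False
    then show ?thesis by simp
  next
    case True
    let ?p = "xpow 0 (as ! i) + lm \<delta>"
    have ik: "i < ?k" using i as(1) by simp
    have "(\<lambda>m. m + ?p) ` mons ?X (j - as ! i) \<subseteq> A i j"
    proof
      fix w assume "w \<in> (\<lambda>m. m + ?p) ` mons ?X (j - as ! i)"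
      then obtain v where v: "v \<in> mons ?X (j - as ! i)" "w = v + ?p" by blast
      let ?f = "monom v * fs ! i"
      have hv: "homogeneous n (j - as ! i) (monom v)" by (rule homogeneous_monom[OF v(1)])
      have "homogeneous n (j - as ! i + (\<alpha> + as ! i)) ?f" by (rule homogeneous_mult[OF hv fs(2)[OF i]])
      then have fW: "?f \<in> W j" using True fs(1)[OF i] I(4)[OF mons_expos[OF v(1)]] by (simp add: W_def add.commute)
      define c where "c i' = (if i' = i then monom (v + xpow 0 (as ! i)) * \<delta> else 0)" for i'
      have "v + xpow 0 (as ! i) \<in> mons ?X (j - as ! i + as ! i)"
        using n by (intro mons_add[OF v(1)] mons_single) auto
      then have "homogeneous n (j + q) (monom (v + xpow 0 (as ! i)) * \<delta>)"
        using True by (intro homogeneous_mult[OF homogeneous_monom \<delta>(2)]) simp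
      then have hc: "homogeneous n (q + j) (c i')" for i' by (simp add: c_def add.commute)
      have "(\<Sum>i'<?k. c i' * gs ! i') = (\<Sum>i'\<in>{i}. c i' * gs ! i')"
        by (rule sum.mono_neutral_right) (use ik in \<open>auto simp: c_def\<close>)
      also have "\<dots> = monom (v + xpow 0 (as ! i)) * \<delta> * (?x (t - as ! i) * fs ! i)"
        by (simp add: c_def fs(3)[OF i])
      also have "\<dots> = \<delta> * (?x (as ! i) * ?x (t - as ! i)) * (monom v * fs ! i)"
        by (simp add: ac_simps flip: monom_mult)
      also have "?x (as ! i) * ?x (t - as ! i) = ?x t"
        using as(2)[OF i] by (simp add: monom_mult flip: single_add)
      finally have "combines n (q + j) gs c (\<delta> * ?x t * ?f)" using hc by (simp add: combines_def)
      then have "\<Phi> j ?f = encode n ?k c" by (rule \<Phi>eq[OF fW j])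
      also have "\<dots> = (\<Sum>i'\<in>{i}. monom (xpow n i') * c i')"
        unfolding encode_def by (rule sum.mono_neutral_right) (use ik in \<open>auto simp: c_def\<close>)
      also have "\<dots> = monom (xpow n i + (v + xpow 0 (as ! i))) * \<delta>"
        by (simp add: c_def monom_mult flip: mult.assoc)
      finally have "lm (\<Phi> j ?f) = xpow n i + (v + xpow 0 (as ! i)) + lm \<delta>"
        using lm_monom_mult[OF \<delta>(1)] by simp
      then have "w + xpow n i = lm (\<Phi> j ?f)" using v(2) by (simp add: ac_simps)
      moreover have "?f \<noteq> 0" using fs(4)[OF i] by simp
      ultimately have "w + xpow n i \<in> \<Lambda> j" using fW by (auto simp: \<Lambda>_def)
      moreover have "w \<in> mons ?X (q + j)"
      proof -
        have "lm \<delta> \<in> mons ?X q" using \<delta> lm_in_keys by (auto simp: homogeneous_iff)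
        then have "v + (xpow 0 (as ! i) + lm \<delta>) \<in> mons ?X (j - as ! i + (as ! i + q))"
          using n by (intro mons_add[OF v(1)] mons_add mons_single) auto
        then show ?thesis using v(2) True by (simp add: add.commute)
      qed
      ultimately show "w \<in> A i j" by (simp add: A_def)
    qed
    then have "card ((\<lambda>m. m + ?p) ` mons ?X (j - as ! i)) \<le> card (A i j)" by (rule card_mono[OF finA])
    then show ?thesis using True by (simp add: card_image_plus Suc_diff_le)
  qed
  ultimately show ?thesis using that[of "\<lambda>i j. card (A i j)"] by blast
qed

section \<open>Lex plus powers ideals with a given Hilbert function\<close>

lemma growth_ge:
  assumes "n \<ge> 2" shows "N \<le> growth n N"
proof -
  have n: "n \<ge> 1" using assms by simp
  have "N \<le> card (mons {..<n} N)" using card_mons_ge[OF assms, of N] by simp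
  then obtain L where L: "lexset {..<n} N L" "card L = N" using lexset_exists[of "{..<n}" N N] by auto
  have "(\<lambda>m. m + var 0) ` L \<subseteq> grow {..<n} L" using n by (auto intro!: growI)
  then have "card ((\<lambda>m. m + var 0) ` L) \<le> card (grow {..<n} L)"
    using lexset_finite[OF _ L(1)] by (intro card_mono) auto
  then show ?thesis using growth_lexset[OF n L(1)] L(2) by (simp add: card_image_plus)
qed

lemma dim_monomial_span:
  assumes "finite M"
  shows "mp.dim {f :: 'k::field mpoly. supp f \<subseteq> M} = card M"
proof -
  let ?V = "{f :: 'k mpoly. supp f \<subseteq> M}"
  have sub: "mp.subspace ?V"
    unfolding mp.subspace_def
  proof (intro conjI ballI allI)
    show "f + g \<in> ?V" if "f \<in> ?V" "g \<in> ?V" for f g using that Poly_Mapping.keys_add[of f g] by blast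
    show "scale c f \<in> ?V" if "f \<in> ?V" for c f using that keys_scale_subset[of c f] by blast
  qed simp
  have img: "(\<lambda>f. lm f) ` (?V - {0}) = M"
  proof
    show "(\<lambda>f. lm f) ` (?V - {0}) \<subseteq> M" using lm_in_keys by fastforce
    show "M \<subseteq> (\<lambda>f. lm f) ` (?V - {0})"
    proof
      fix m assume m: "m \<in> M"
      have "lm (monom m :: 'k mpoly) = m" by (simp add: lm_def)
      moreover have "(monom m :: 'k mpoly) \<in> ?V - {0}" using m by simp
      ultimately show "m \<in> (\<lambda>f. lm f) ` (?V - {0})" by (metis image_eqI)
    qed
  qed
  have "mp.dim ?V = card ((\<lambda>f. lm f) ` (?V - {0}))"
    by (rule dim_eq_card_lm[where \<Phi> = "\<lambda>f. f", OF sub]) (simp_all add: img assms)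
  then show ?thesis by (simp add: img)
qed

lemma up_closed:
  assumes "\<And>m v. m \<in> M \<Longrightarrow> v < n \<Longrightarrow> m + var v \<in> M" and "m \<in> M" "u \<in> expos n"
  shows "u + m \<in> M"
  using assms(3)
proof (induction "mdegree u" arbitrary: u)
  case 0
  then show ?case using assms(2) by (simp add: mdegree_0_iff)
next
  case (Suc d)
  have u: "u \<in> mons {..<n} (Suc d)" using Suc.hyps(2) Suc.prems by (simp add: mons_def expos_def)
  have "u \<noteq> 0" using Suc.hyps(2) by auto
  then have "{..<n} \<noteq> {}" using Suc.prems keys_eq_empty[of u] by (auto simp: expos_def)
  then have "u \<in> grow {..<n} (mons {..<n} d)" using u grow_mons[of "{..<n}" d] by blast
  then obtain u' i where u': "u' \<in> mons {..<n} d" "i \<in> {..<n}" "u = u' + var i" by (rule growE)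
  have "u' + m \<in> M" by (rule Suc.hyps(1)) (use u' in \<open>auto simp: mons_def expos_def\<close>)
  then have "u' + m + var i \<in> M" using assms(1) u'(2) by simp
  then show ?case using u'(3) by (simp add: ac_simps)
qed

lemma set_add_monomials:
  "{f. supp f \<subseteq> A} <+>\<^bsub>poly_ring n\<^esub> {f. supp f \<subseteq> B}
    = {f :: 'k::field mpoly. supp f \<subseteq> A \<union> B}"
proof
  show "{f. supp f \<subseteq> A} <+>\<^bsub>poly_ring n\<^esub> {f. supp f \<subseteq> B}
    \<subseteq> {f :: 'k mpoly. supp f \<subseteq> A \<union> B}"
  proof
    fix h :: "'k mpoly"
    assume "h \<in> {f. supp f \<subseteq> A} <+>\<^bsub>poly_ring n\<^esub> {f. supp f \<subseteq> B}"
    then obtain f g where fg: "supp f \<subseteq> A" "supp g \<subseteq> B" "h = f + g"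
      by (auto simp: set_add_def set_mult_def)
    then show "h \<in> {f. supp f \<subseteq> A \<union> B}" using Poly_Mapping.keys_add[of f g] by blast
  qed
  show "{f :: 'k mpoly. supp f \<subseteq> A \<union> B}
    \<subseteq> {f. supp f \<subseteq> A} <+>\<^bsub>poly_ring n\<^esub> {f. supp f \<subseteq> B}"
  proof
    fix h :: "'k mpoly" assume h: "h \<in> {f. supp f \<subseteq> A \<union> B}"
    define part where "part S = (\<Sum>m\<in>S. scale (cf h m) (monom m))" for S
    have keys_part: "supp (part S) \<subseteq> S" for S
    proof -
      have "supp (part S) \<subseteq> (\<Union>m\<in>S. supp (scale (cf h m) (monom m)))"
        unfolding part_def by (rule Poly_Mapping.keys_sum)
      also have "\<dots> \<subseteq> S" using keys_scale_subset by fastforce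
      finally show ?thesis .
    qed
    have "h = part (supp h)" unfolding part_def by (rule poly_expand_scale)
    also have "\<dots> = part (supp h \<inter> A) + part (supp h - A)"
      unfolding part_def by (rule sum.Int_Diff) simp
    finally have "h = part (supp h \<inter> A) + part (supp h - A)" .
    moreover have "supp (part (supp h \<inter> A)) \<subseteq> A" using keys_part by blast
    moreover have "supp (part (supp h - A)) \<subseteq> B" using keys_part h by blast
    ultimately show "h \<in> {f. supp f \<subseteq> A} <+>\<^bsub>poly_ring n\<^esub> {f. supp f \<subseteq> B}"
      by (auto simp: set_add_def set_mult_def)
  qed
qed

lemma card_mons_power:
  assumes "n \<ge> 2" "i < n"
  shows "card {m\<in>mons {..<n} d. e \<le> lk m i} = pcount n (Suc d - e)"
proof -
  have "(if i = 0 then 1 else 0) < n" "i \<noteq> (if i = 0 then 1 else 0)" using assms by auto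
  from card_mons_divisible[OF assms(2) this, of d e 0] show ?thesis by simp
qed

lemma powers_ideal_eq:
  assumes "length e \<le> n"
  shows "powers_ideal n e = {f :: 'k::field mpoly. supp f \<subseteq> {m\<in>expos n. \<exists>i<length e. e ! i \<le> lk m i}}"
proof -
  let ?M = "(\<lambda>i. xpow i (e ! i)) ` {..<length e}"
  have M: "?M \<subseteq> expos n" using assms by (auto simp: expos_def split: if_splits)
  have "{u + m | u m. u \<in> expos n \<and> m \<in> ?M} = {m\<in>expos n. \<exists>i<length e. e ! i \<le> lk m i}"
  proof
    show "{u + m | u m. u \<in> expos n \<and> m \<in> ?M} \<subseteq> {m\<in>expos n. \<exists>i<length e. e ! i \<le> lk m i}"
    proof
      fix w assume "w \<in> {u + m | u m. u \<in> expos n \<and> m \<in> ?M}"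
      then obtain u i where w: "w = u + xpow i (e ! i)" "u \<in> expos n" "i < length e" by blast
      have "w \<in> expos n" using M w by (auto intro: expos_simps)
      moreover have "e ! i \<le> lk w i" using w by (simp add: lookup_add)
      ultimately show "w \<in> {m\<in>expos n. \<exists>i<length e. e ! i \<le> lk m i}" using w(3) by blast
    qed
    show "{m\<in>expos n. \<exists>i<length e. e ! i \<le> lk m i} \<subseteq> {u + m | u m. u \<in> expos n \<and> m \<in> ?M}"
    proof
      fix w assume "w \<in> {m\<in>expos n. \<exists>i<length e. e ! i \<le> lk m i}"
      then obtain i where i: "w \<in> expos n" "i < length e" "e ! i \<le> lk w i" by blast
      let ?u = "w - xpow i (e ! i)"
      have "w = ?u + xpow i (e ! i)" using minus_plus_single[OF i(3)] by simp
      moreover have "?u \<in> expos n" using i(1) keys_minus_subset[of w] by (auto simp: expos_def)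
      ultimately show "w \<in> {u + m | u m. u \<in> expos n \<and> m \<in> ?M}" using i(2) by blast
    qed
  qed
  moreover have "(\<lambda>i. monom (xpow i (e ! i))) ` {..<length e} = (monom ` ?M :: 'k mpoly set)"
    by (simp add: image_image)
  ultimately show ?thesis unfolding powers_ideal_def using Idl_monomials[OF M] by simp
qed

text \<open>
  In degree \<open>\<alpha> + j\<close> let the lex part be the segment \<open>S j\<close> of size \<open>h j\<close>, and above degree \<open>\<alpha> + t\<close> let it
  be everything. The growth condition makes this an ideal. The segment contains the multiples of the power of
  \<open>x\<^sub>0\<close>; being short, it consists of multiples of a power of \<open>x\<^sub>0\<close> that is too high for the multiples of the
  other powers, which are moreover disjoint from each other. So the dimensions add up.
\<close>

lemma lpp_ideal_with_hilbert:
  assumes n: "n \<ge> 2" and a: "length a \<le> n" "a \<noteq> []" "sorted a" and \<alpha>: "M < \<alpha>" "t < \<alpha>"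
    and h: "\<And>j. j \<le> t \<Longrightarrow> h j \<le> M" "\<And>j. j < t \<Longrightarrow> growth n (h j) \<le> h (Suc j)"
      "\<And>j. j \<le> t \<Longrightarrow> pcount n (Suc j - a ! 0) \<le> h j"
  shows "\<exists>J :: 'k::field mpoly set. lpp_ideal n (map (\<lambda>ai. \<alpha> + ai) a) J \<and> (\<forall>d<\<alpha>. hilbert n J d = 0) \<and>
    (\<forall>j\<le>t. hilbert n J (\<alpha> + j) = h j + (\<Sum>i\<in>{1..<length a}. pcount n (Suc j - a ! i)))"
proof -
  let ?X = "{..<n}" and ?e = "map (\<lambda>ai. \<alpha> + ai) a"
  have n1: "n \<ge> 1" using n by simp
  have "\<exists>L. lexset ?X (\<alpha> + j) L \<and> card L = h j" if "j \<le> t" for j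
  proof (rule lexset_exists)
    show "h j \<le> card (mons ?X (\<alpha> + j))"
      using card_mons_ge[OF n, of "\<alpha> + j"] h(1)[OF that] \<alpha>(1) by simp
  qed simp
  then obtain S where S: "\<And>j. j \<le> t \<Longrightarrow> lexset ?X (\<alpha> + j) (S j)" "\<And>j. j \<le> t \<Longrightarrow> card (S j) = h j"
    by metis
  define mL where "mL = {m\<in>expos n. \<alpha> + t < mdegree m \<or> (\<exists>j\<le>t. mdegree m = \<alpha> + j \<and> m \<in> S j)}"
  define mP where "mP = {m\<in>expos n. \<exists>i<length a. \<alpha> + a ! i \<le> lk m i}"
  have mL_iff: "m \<in> mL \<longleftrightarrow> m \<in> S j" if "m \<in> mons ?X (\<alpha> + j)" "j \<le> t" for m j
    using that by (auto simp: mL_def mons_def expos_def)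
  have step: "m + var v \<in> mL" if m: "m \<in> mL" and v: "v < n" for m v
  proof -
    have ev: "m + var v \<in> expos n" using m v by (auto simp: mL_def expos_def keys_plus_expo)
    show ?thesis
    proof (cases "\<alpha> + t < mdegree (m + var v)")
      case True
      then show ?thesis using ev by (simp add: mL_def)
    next
      case False
      then obtain j where j: "j < t" "mdegree m = \<alpha> + j" "m \<in> S j" using m by (auto simp: mL_def)
      have "grow ?X (S j) \<subseteq> S (Suc j)"
      proof (rule lexset_subset)
        show "lexset ?X (\<alpha> + Suc j) (grow ?X (S j))" using grow_lexset[OF _ S(1)[of j]] j(1) by simp
        show "lexset ?X (\<alpha> + Suc j) (S (Suc j))" using S(1)[of "Suc j"] j(1) by simp
        show "card (grow ?X (S j)) \<le> card (S (Suc j))"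
          using growth_lexset[OF n1 S(1)[of j]] S(2)[of j] S(2)[of "Suc j"] h(2)[OF j(1)] j(1) by simp
      qed simp
      then have "m + var v \<in> S (Suc j)" using growI[OF j(3), of v ?X] v by blast
      moreover have "mdegree (m + var v) = \<alpha> + Suc j" using j(2) by simp
      ultimately show ?thesis using ev j(1) unfolding mL_def by (auto intro!: exI[of _ "Suc j"])
    qed
  qed
  let ?L = "idl n (monom ` mL) :: 'k mpoly set"
  have mL_expos: "mL \<subseteq> expos n" by (auto simp: mL_def)
  have "{u + m | u m. u \<in> expos n \<and> m \<in> mL} = mL"
  proof
    show "{u + m | u m. u \<in> expos n \<and> m \<in> mL} \<subseteq> mL" using up_closed[of mL n, OF step] by blast
    show "mL \<subseteq> {u + m | u m. u \<in> expos n \<and> m \<in> mL}"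
    proof
      fix m assume "m \<in> mL"
      moreover have "m = 0 + m" by simp
      ultimately show "m \<in> {u + m | u m. u \<in> expos n \<and> m \<in> mL}" using expos_simps(1) by blast
    qed
  qed
  then have L: "?L = {f. supp f \<subseteq> mL}" using Idl_monomials[OF mL_expos] by simp
  have lex: "lex_ideal n ?L"
    unfolding lex_ideal_def
  proof (intro conjI ballI impI)
    show "monomial_ideal n ?L" unfolding monomial_ideal_def using mL_expos by blast
    fix p q assume p: "p \<in> expos n" and q: "q \<in> expos n" and "mdegree p = mdegree q \<and> q < p \<and> monom q \<in> ?L"
    then have d: "mdegree p = mdegree q" "q < p" and qM: "q \<in> mL" by (auto simp: L)
    have "p \<in> mL"
    proof (cases "\<alpha> + t < mdegree q")
      case True then show ?thesis using p d by (simp add: mL_def)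
    next
      case False
      then obtain j where j: "j \<le> t" "mdegree q = \<alpha> + j" "q \<in> S j" using qM by (auto simp: mL_def)
      have pm: "p \<in> mons ?X (\<alpha> + j)" using p d(1) j(2) by (simp add: mons_def expos_def)
      have "p \<in> S j" by (rule lexsetD[OF S(1)[OF j(1)] j(3) pm d(2)])
      then show ?thesis using mL_iff[OF pm j(1)] by simp
    qed
    then show "monom p \<in> ?L" by (simp add: L)
  qed
  define J where "J = ?L <+>\<^bsub>poly_ring n\<^esub> (powers_ideal n ?e :: 'k mpoly set)"
  have "powers_ideal n ?e = {f :: 'k mpoly. supp f \<subseteq> mP}"
  proof -
    have "{m\<in>expos n. \<exists>i<length ?e. ?e ! i \<le> lk m i} = mP" by (auto simp: mP_def)
    then show ?thesis using powers_ideal_eq[of ?e n] a(1) by simp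
  qed
  then have J: "J = {f. supp f \<subseteq> mL \<union> mP}" unfolding J_def L by (simp add: set_add_monomials)
  have "sorted ?e" using a(3) by (simp add: sorted_map)
  then have lpp: "lpp_ideal n ?e J" unfolding lpp_ideal_def using a(1) lex J_def by auto
  have hil: "hilbert n J d = card ((mL \<union> mP) \<inter> mons ?X d)" for d
  proof -
    have "{f \<in> J. homogeneous n d f} = {f. supp f \<subseteq> (mL \<union> mP) \<inter> mons ?X d}"
      by (auto simp: J homogeneous_iff)
    then have "hilbert n J d = mp.dim {f :: 'k mpoly. supp f \<subseteq> (mL \<union> mP) \<inter> mons ?X d}"
      unfolding hilbert_def by (rule arg_cong)
    also have "\<dots> = card ((mL \<union> mP) \<inter> mons ?X d)" by (rule dim_monomial_span) simp
    finally show ?thesis .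
  qed
  have low: "hilbert n J d = 0" if d: "d < \<alpha>" for d
  proof -
    have "\<alpha> \<le> mdegree m" if "m \<in> mP" for m
    proof -
      obtain i where "\<alpha> + a ! i \<le> lk m i" using \<open>m \<in> mP\<close> by (auto simp: mP_def)
      then show ?thesis using lk_le_mdegree[of m i] by simp
    qed
    moreover have "\<alpha> \<le> mdegree m" if "m \<in> mL" for m using that by (auto simp: mL_def)
    ultimately have "(mL \<union> mP) \<inter> mons ?X d = {}" using d by (fastforce simp: mons_def)
    then show ?thesis unfolding hil by simp
  qed
  have "hilbert n J (\<alpha> + j) = h j + (\<Sum>i\<in>{1..<length a}. pcount n (Suc j - a ! i))" if j: "j \<le> t" for j
  proof -
    let ?d = "\<alpha> + j"
    define N where "N i = {m\<in>mons ?X ?d. \<alpha> + a ! i \<le> lk m i}" for i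
    have finN: "finite (N i)" for i by (simp add: N_def)
    have Sm: "S j \<subseteq> mons ?X ?d" using S(1)[OF j] by (simp add: lexset_def)
    have finS: "finite (S j)" by (rule lexset_finite[OF _ S(1)[OF j]]) simp
    have N0: "N 0 \<subseteq> S j"
    proof
      fix m assume "m \<in> N 0"
      then have m: "m \<in> mons ?X ?d" "\<alpha> + a ! 0 \<le> lk m 0" by (auto simp: N_def)
      have "lk m 0 \<le> ?d" using lk_le_mdegree[of m 0] m(1) by (simp add: mons_def)
      then have aj: "a ! 0 \<le> j" using m(2) by simp
      let ?m = "m - xpow 0 (\<alpha> + a ! 0)"
      have mm: "?m \<in> mons ?X (j - a ! 0)" using mons_minus_single[OF m] by simp
      have "?m + xpow 0 (?d - (j - a ! 0)) \<in> S j"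
      proof (rule lexset_top_block[OF n1 S(1)[OF j] _ _ mm])
        show "card (mons ?X (j - a ! 0)) \<le> card (S j)"
          using h(3)[OF j] aj S(2)[OF j] by (simp add: Suc_diff_le)
      qed simp
      moreover have "?d - (j - a ! 0) = \<alpha> + a ! 0" using aj by simp
      ultimately show "m \<in> S j" using minus_plus_single[OF m(2)] by simp
    qed
    have Sx0: "?d - M \<le> lk m 0" if m: "m \<in> S j" for m
    proof -
      have all: "lexset ?X M (mons ?X M)" by (simp add: lexset_def)
      have "lexset ?X (M + (?d - M)) ((\<lambda>m. m + xpow 0 (?d - M)) ` mons ?X M)"
        by (rule lexset_shift[OF all n1])
      then have B: "lexset ?X ?d ((\<lambda>m. m + xpow 0 (?d - M)) ` mons ?X M)"
        using \<alpha>(1) by simp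
      have "S j \<subseteq> (\<lambda>m. m + xpow 0 (?d - M)) ` mons ?X M"
      proof (rule lexset_subset[OF _ S(1)[OF j] B])
        show "card (S j) \<le> card ((\<lambda>m. m + xpow 0 (?d - M)) ` mons ?X M)"
          using S(2)[OF j] h(1)[OF j] card_mons_ge[OF n, of M] by (simp add: card_image_plus)
      qed simp
      then obtain m' where "m = m' + xpow 0 (?d - M)" using m by blast
      then show ?thesis by (simp add: lookup_add)
    qed
    have disjS: "S j \<inter> N i = {}" if i: "1 \<le> i" for i
    proof (rule equals0I)
      fix m assume "m \<in> S j \<inter> N i"
      then have "?d - M \<le> lk m 0" "\<alpha> \<le> lk m i" "mdegree m = ?d"
        using Sx0 by (auto simp: N_def mons_def)
      moreover have "lk m 0 + lk m i \<le> mdegree m" by (rule lk_sum_le_mdegree) (use i in simp)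
      ultimately show False using \<alpha>(1) by simp
    qed
    have disjN: "N i \<inter> N i' = {}" if i: "i \<noteq> i'" for i i'
    proof (rule equals0I)
      fix m assume "m \<in> N i \<inter> N i'"
      then have "\<alpha> \<le> lk m i" "\<alpha> \<le> lk m i'" "mdegree m = ?d" by (auto simp: N_def mons_def)
      moreover have "lk m i + lk m i' \<le> mdegree m" by (rule lk_sum_le_mdegree[OF i])
      ultimately show False using \<alpha>(2) j by simp
    qed
    have "(mL \<union> mP) \<inter> mons ?X ?d = S j \<union> (\<Union>i\<in>{..<length a}. N i)"
    proof -
      have "mL \<inter> mons ?X ?d = S j" using mL_iff[OF _ j] Sm by blast
      moreover have "mP \<inter> mons ?X ?d = (\<Union>i\<in>{..<length a}. N i)"
        by (auto simp: mP_def N_def intro: mons_expos)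
      ultimately show ?thesis by blast
    qed
    also have "\<dots> = S j \<union> (\<Union>i\<in>{1..<length a}. N i)"
    proof -
      have "{..<length a} = insert 0 {1..<length a}" using a(2) by auto
      then show ?thesis unfolding UN_insert using N0 by (simp add: Un_absorb2 flip: Un_assoc)
    qed
    finally have "hilbert n J ?d = card (S j \<union> (\<Union>i\<in>{1..<length a}. N i))" by (simp add: hil)
    also have "\<dots> = card (S j) + card (\<Union>i\<in>{1..<length a}. N i)"
    proof (rule card_Un_disjoint[OF finS])
      show "finite (\<Union>i\<in>{1..<length a}. N i)" using finN by simp
      show "S j \<inter> (\<Union>i\<in>{1..<length a}. N i) = {}"
        unfolding Int_UN_distrib using disjS by simp
    qed
    also have "card (\<Union>i\<in>{1..<length a}. N i) = (\<Sum>i\<in>{1..<length a}. card (N i))"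
      by (rule card_UN_disjoint) (use finN disjN in auto)
    also have "\<dots> = (\<Sum>i\<in>{1..<length a}. pcount n (Suc j - a ! i))"
    proof (rule sum.cong)
      fix i assume "i \<in> {1..<length a}"
      then have i: "i < n" using a(1) by simp
      show "card (N i) = pcount n (Suc j - a ! i)"
        unfolding N_def using card_mons_power[OF n i, of ?d "\<alpha> + a ! i"] by simp
    qed simp
    finally show ?thesis using S(2)[OF j] by simp
  qed
  then show ?thesis by (intro exI[of _ J] conjI allI impI lpp low)
qed

section \<open>Ideals of a given type\<close>

text \<open>
  The degree-\<open>E\<close> part is spanned by at most \<open>M\<close> monomial multiples of generators. The members of the regular
  sequence that occur up to degree \<open>E\<close>, lifted to degree \<open>E\<close> by powers of \<open>x\<^sub>0\<close>, are independent at a level below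
  the initial degree; this starts the construction of a presentation. The components of
  the resulting decomposition are merged by \<open>growth_sum\<close>, where the \<open>i\<close>-th one, for \<open>i\<close> from 1 on, gives up the
  monomials that are accounted for by the \<open>i\<close>-th power.
\<close>

lemma hilbert_function_of_type:
  fixes I :: "'k::field mpoly set"
  assumes n: "n \<ge> 2" and a: "a \<noteq> []" and b: "length b = t + 1" and type: "ideal_of_type n a b I"
    and M: "M = Suc (\<Sum>j\<le>t. b ! j * card (mons {..<n} (t - j)))"
    and big: "level_bound M t M + t < initial_degree n I"
  shows "\<exists>h. (\<forall>j\<le>t. hilbert n I (initial_degree n I + j) = h j + (\<Sum>i\<in>{1..<length a}. pcount n (Suc j - a ! i)))
    \<and> (\<forall>j\<le>t. h j \<le> M) \<and> (\<forall>j<t. growth n (h j) \<le> h (Suc j)) \<and> (\<forall>j\<le>t. pcount n (Suc j - a ! 0) \<le> h j)"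
    and "length a \<le> n" "sorted a" "\<And>d. d < initial_degree n I \<Longrightarrow> hilbert n I d = 0"
proof -
  let ?X = "{..<n}"
  define \<alpha> where "\<alpha> = initial_degree n I"
  have n1: "n \<ge> 1" using n by simp
  obtain fs where fs: "length fs = length a" "set fs \<subseteq> I" "regular_sequence n fs"
    "\<forall>i<length a. form n (\<alpha> + a ! i) (fs ! i)" "sorted (map (\<lambda>ai. \<alpha> + ai) a)"
    using type unfolding ideal_of_type_def \<alpha>_def by blast
  obtain G where G: "min_gens n I G" "\<forall>j<length b. card {g \<in> G. form n (\<alpha> + j) g} = b ! j"
    using type unfolding ideal_of_type_def \<alpha>_def by blast
  show len: "length a \<le> n" using regular_sequence_length[OF fs(3)] fs(1) by simp
  show sa: "sorted a" using fs(5) by (simp add: sorted_iff_nth_mono)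
  have finG: "finite G" and formG: "\<And>g. g \<in> G \<Longrightarrow> \<exists>d. form n d g" and IG: "I = idl n G"
    using G(1) by (auto simp: min_gens_def)
  have carG: "G \<subseteq> polys n" using formG by (auto simp: form_def intro: homogeneous_carrier)
  have degG: "\<alpha> \<le> d" if "g \<in> G" "form n d g" for g d
    unfolding \<alpha>_def initial_degree_def by (rule Least_le) (use G(1) that in blast)
  have I0: "0 \<in> I" unfolding IG by (rule Idl_0[OF carG])
  have Iadd: "f + g \<in> I" if "f \<in> I" "g \<in> I" for f g using that unfolding IG by (rule Idl_add[OF carG])
  have Isc: "scale c f \<in> I" if "f \<in> I" for c f using that unfolding IG by (rule Idl_scale[OF carG])
  have Imon: "monom u * f \<in> I" if "u \<in> expos n" "f \<in> I" for u f
    using Idl_mult[OF carG carrier_closed(4)[OF that(1)]] that(2) unfolding IG by blast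
  define V where "V d = {f \<in> I. homogeneous n d f}" for d
  have Vspan: "V d \<subseteq> mp.span (monomial_multiples n G d)" for d
    using Idl_homogeneous_span[OF formG] by (auto simp: V_def IG)
  show "hilbert n I d = 0" if "d < initial_degree n I" for d
  proof -
    have "monomial_multiples n G d = {}" using degG that unfolding monomial_multiples_def \<alpha>_def by fastforce
    then have "mp.dim (V d) \<le> card ({} :: 'k mpoly set)" using Vspan[of d] by (intro mp.dim_le_card) auto
    then show ?thesis by (simp add: hilbert_def V_def)
  qed
  let ?E = "\<alpha> + t"
  define U where "U j = (\<Union>g\<in>{g \<in> G. form n (\<alpha> + j) g}. (\<lambda>u. monom u * g) ` mons ?X (t - j))" for j
  define T where "T = monomial_multiples n G ?E"
  have "T \<subseteq> (\<Union>j\<in>{..t}. U j)"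
  proof
    fix x assume "x \<in> T"
    then obtain u g e where x: "x = monom u * g" "u \<in> expos n" "g \<in> G" "form n e g" "mdegree u + e = ?E"
      by (auto simp: T_def monomial_multiples_def)
    have "\<alpha> \<le> e" by (rule degG[OF x(3,4)])
    then have "e = \<alpha> + (e - \<alpha>)" "e - \<alpha> \<le> t" "mdegree u = t - (e - \<alpha>)" using x(5) by auto
    then show "x \<in> (\<Union>j\<in>{..t}. U j)"
      using x unfolding U_def by (intro UN_I[of "e - \<alpha>"] UN_I[of g] imageI) (auto simp: mons_def expos_def)
  qed
  moreover have finU: "finite (U j)" for j
    using finG by (simp add: U_def)
  ultimately have finT: "finite T" and "card T \<le> card (\<Union>j\<in>{..t}. U j)"
    by (auto intro: finite_subset card_mono)
  note this(2)
  also have "card (\<Union>j\<in>{..t}. U j) \<le> (\<Sum>j\<le>t. card (U j))"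
    by (rule card_UN_le) simp
  also have "\<dots> \<le> (\<Sum>j\<le>t. b ! j * card (mons ?X (t - j)))"
  proof (rule sum_mono)
    fix j assume "j \<in> {..t}"
    then have bj: "card {g \<in> G. form n (\<alpha> + j) g} = b ! j" using G(2) b by simp
    have "card (U j) \<le> (\<Sum>g\<in>{g \<in> G. form n (\<alpha> + j) g}. card ((\<lambda>u. monom u * g) ` mons ?X (t - j)))"
      unfolding U_def by (rule card_UN_le) (use finG in simp)
    also have "\<dots> \<le> (\<Sum>g\<in>{g \<in> G. form n (\<alpha> + j) g}. card (mons ?X (t - j)))"
      by (rule sum_mono) (rule card_image_le, simp)
    also have "\<dots> = b ! j * card (mons ?X (t - j))" by (simp add: bj)
    finally show "card (U j) \<le> b ! j * card (mons ?X (t - j))" .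
  qed
  finally have cT: "card T \<le> M" unfolding M by simp
  have VT: "V ?E \<subseteq> mp.span T" unfolding T_def by (rule Vspan)
  \<comment> \<open>The members of the regular sequence that lie in degrees up to \<open>E\<close>; the others have larger degree.\<close>
  define as where "as = takeWhile (\<lambda>x. x \<le> t) a"
  let ?l = "length as"
  have ll: "?l \<le> length a" unfolding as_def by (rule length_takeWhile_le)
  have asn: "as ! i = a ! i" if "i < ?l" for i using that unfolding as_def by (rule takeWhile_nth)
  have ast: "as ! i \<le> t" if "i < ?l" for i
    using nth_mem[OF that] set_takeWhileD unfolding as_def by fastforce
  have agt: "t < a ! i" if "?l \<le> i" "i < length a" for i
  proof -
    have "?l < length a" using that by simp
    then have "\<not> a ! ?l \<le> t" unfolding as_def by (rule nth_length_takeWhile)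
    moreover have "a ! ?l \<le> a ! i" by (rule sorted_nth_mono[OF sa that])
    ultimately show ?thesis by simp
  qed
  have fsI: "fs ! i \<in> I" "homogeneous n (\<alpha> + as ! i) (fs ! i)" "fs ! i \<noteq> 0" if "i < ?l" for i
    using that ll fs(1,2,4) asn[OF that] by (auto simp: form_def)
  let ?x = "\<lambda>e. monom (xpow 0 e) :: 'k mpoly"
  define gs where "gs = map (\<lambda>i. ?x (t - as ! i) * fs ! i) [0..<?l]"
  have lgs: "length gs = ?l" by (simp add: gs_def)
  have gsn: "gs ! i = ?x (t - as ! i) * fs ! i" if "i < ?l" for i using that by (simp add: gs_def)
  have x0e: "xpow 0 e \<in> expos n" for e using n by (simp add: expos_def)
  have gsV: "set gs \<subseteq> V ?E"
  proof
    fix g assume "g \<in> set gs"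
    then obtain i where i: "i < ?l" "g = ?x (t - as ! i) * fs ! i" by (auto simp: gs_def)
    have "homogeneous n (t - as ! i + (\<alpha> + as ! i)) g"
      unfolding i(2) by (rule homogeneous_mult[OF homogeneous_x0[OF n1] fsI(2)[OF i(1)]])
    moreover have "t - as ! i + (\<alpha> + as ! i) = ?E" using ast[OF i(1)] by simp
    moreover have "g \<in> I" unfolding i(2) by (rule Imon[OF x0e fsI(1)[OF i(1)]])
    ultimately show "g \<in> V ?E" by (simp add: V_def)
  qed
  let ?s = "level_bound M t M"
  have ind: "indep_level n ?s gs"
    unfolding indep_level_def
  proof (intro allI impI, elim conjE)
    fix c i assume c: "\<forall>i<length gs. homogeneous n ?s (c i)" and s0: "(\<Sum>i<length gs. c i * gs ! i) = 0"
      and i: "i < length gs"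
    define p where "p i = c i * ?x (t - as ! i)" for i
    have hp: "homogeneous n (?s + (t - as ! i)) (p i)" if "i < ?l" for i
      unfolding p_def using c that lgs by (intro homogeneous_mult homogeneous_x0[OF n1]) auto
    have "p i = 0"
    proof (rule regular_sequence_low_syzygy[OF fs(3), of ?l \<alpha> p i])
      show "\<alpha> \<le> mdegree m" if "i < ?l" "m \<in> supp (fs ! i)" for i m
        using fsI(2)[OF that(1)] that(2) by (auto simp: homogeneous_def)
      show "?l \<le> length fs" using ll fs(1) by simp
      show "p i \<in> polys n" if "i < ?l" for i by (rule homogeneous_carrier[OF hp[OF that]])
      show "mdegree m < \<alpha>" if "i < ?l" "m \<in> supp (p i)" for i m
        using hp[OF that(1)] that(2) big by (auto simp: homogeneous_def \<alpha>_def)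
      show "(\<Sum>i<?l. p i * fs ! i) = 0"
        using s0 gsn by (simp add: lgs p_def mult.assoc)
      show "i < ?l" using i lgs by simp
    qed
    then show "c i = 0" by (simp add: p_def)
  qed
  have M1: "M \<ge> 1" using M by simp
  obtain rest q \<delta> where pres: "\<delta> \<noteq> 0" "homogeneous n q \<delta>" "indep_level n (q + t) (gs @ rest)"
    "\<And>f. f \<in> V ?E \<Longrightarrow> \<exists>c. combines n q (gs @ rest) c (\<delta> * f)"
    by (rule low_degree_presentation[OF n1 M1 VT finT cT gsV ind]) blast
  let ?k = "length (gs @ rest)"
  obtain u where u: "\<And>j. j \<le> t \<Longrightarrow> hilbert n I (\<alpha> + j) = (\<Sum>i<?k. u i j)"
    "\<And>i j. i < ?k \<Longrightarrow> j < t \<Longrightarrow> growth n (u i j) \<le> u i (Suc j)"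
    "\<And>i j. i < ?l \<Longrightarrow> j \<le> t \<Longrightarrow> pcount n (Suc j - as ! i) \<le> u i j"
  proof (rule hilbert_decomposition[OF n1 I0 Iadd Isc Imon pres(1-3), of \<alpha> as fs])
    show "\<exists>c. combines n q (gs @ rest) c (\<delta> * f)" if "f \<in> I" "homogeneous n (\<alpha> + t) f" for f
      using pres(4)[of f] that by (simp add: V_def)
    show "(gs @ rest) ! i = ?x (t - as ! i) * fs ! i" if "i < ?l" for i
      using that gsn lgs by (simp add: nth_append)
  qed (use ast fsI lgs in auto)
  \<comment> \<open>Components beyond the regular sequence have the trivial lower bound \<open>pcount n 0 = 0\<close>.\<close>
  define e where "e j i = (if i < ?l then Suc j - a ! i else 0)" for j i
  have ue: "pcount n (e j i) \<le> u i j" if "j \<le> t" for i j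
    using u(3)[of i j] that asn[of i] by (auto simp: e_def)
  have lk: "?l \<le> ?k" using lgs by simp
  have esum: "(\<Sum>i\<in>{1..<?k}. pcount n (e j i)) = (\<Sum>i\<in>{1..<length a}. pcount n (Suc j - a ! i))" if "j \<le> t" for j
  proof -
    have "(\<Sum>i\<in>{1..<?k}. pcount n (e j i)) = (\<Sum>i\<in>{1..<?l}. pcount n (e j i))"
      by (rule sum.mono_neutral_right) (use lk in \<open>auto simp: e_def\<close>)
    also have "\<dots> = (\<Sum>i\<in>{1..<?l}. pcount n (Suc j - a ! i))" by (rule sum.cong) (auto simp: e_def)
    also have "\<dots> = (\<Sum>i\<in>{1..<length a}. pcount n (Suc j - a ! i))"
    proof (rule sum.mono_neutral_left)
      show "\<forall>i\<in>{1..<length a} - {1..<?l}. pcount n (Suc j - a ! i) = 0"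
      proof
        fix i assume "i \<in> {1..<length a} - {1..<?l}"
        then have "t < a ! i" using agt[of i] by auto
        then have "Suc j - a ! i = 0" using that by simp
        then show "pcount n (Suc j - a ! i) = 0" by simp
      qed
    qed (use ll in auto)
    finally show ?thesis .
  qed
  have e0: "pcount n (e j 0) = pcount n (Suc j - a ! 0)" if "j \<le> t" for j
  proof (cases "?l = 0")
    case True
    then have "t < a ! 0" using agt[of 0] a by simp
    then have "Suc j - a ! 0 = 0" using that by simp
    then show ?thesis using True by (simp add: e_def)
  next
    case False
    then show ?thesis by (simp add: e_def)
  qed
  have uM: "(\<Sum>i<?k. u i j) \<le> M" if "j \<le> t" for j
    using that
  proof (induction "t - j" arbitrary: j)
    case 0
    have "(\<Sum>i<?k. u i t) = mp.dim (V ?E)" using u(1)[of t] by (simp add: hilbert_def V_def)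
    also have "\<dots> \<le> card T" by (rule mp.dim_le_card[OF VT finT])
    finally show ?case using 0 cT by simp
  next
    case (Suc d)
    then have j: "j < t" by simp
    have "(\<Sum>i<?k. u i j) \<le> (\<Sum>i<?k. u i (Suc j))"
      by (rule sum_mono) (use u(2)[OF _ j] growth_ge[OF n] order_trans in blast)
    also have "\<dots> \<le> M" by (rule Suc.hyps(1)) (use Suc.hyps(2) j in auto)
    finally show ?case .
  qed
  define h where "h j = (\<Sum>i<?k. u i j) - (\<Sum>i\<in>{1..<?k}. pcount n (e j i))" for j
  have tot: "pcount n (e j 0) + (\<Sum>i\<in>{1..<?k}. pcount n (e j i)) \<le> (\<Sum>i<?k. u i j)" if "j \<le> t" for j
  proof (cases "?k = 0")
    case True
    then have "?l = 0" using lk by simp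
    then show ?thesis using True by (simp add: e_def)
  next
    case False
    then have "{..<?k} = insert 0 {1..<?k}" by auto
    then have "pcount n (e j 0) + (\<Sum>i\<in>{1..<?k}. pcount n (e j i)) = (\<Sum>i<?k. pcount n (e j i))" by simp
    also have "\<dots> \<le> (\<Sum>i<?k. u i j)" by (rule sum_mono) (rule ue[OF that])
    finally show ?thesis .
  qed
  have h1: "h j + (\<Sum>i\<in>{1..<?k}. pcount n (e j i)) = (\<Sum>i<?k. u i j)" if "j \<le> t" for j
    using tot[OF that] unfolding h_def by simp
  have h2: "growth n (h j) \<le> h (Suc j)" if j: "j < t" for j
  proof (cases "?k = 0")
    case True
    then show ?thesis by (simp add: h_def)
  next
    case False
    have "\<exists>H H'. H + (\<Sum>i\<in>{1..<?k}. pcount n (e j i)) = (\<Sum>i<?k. u i j) \<and>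
      H' + (\<Sum>i\<in>{1..<?k}. pcount n (e (Suc j) i)) = (\<Sum>i<?k. u i (Suc j)) \<and>
      growth n H \<le> H' \<and> pcount n (e j 0) \<le> H \<and> pcount n (e (Suc j) 0) \<le> H'"
    proof (rule growth_sum[OF n])
      show "0 < ?k" using False by simp
      show "growth n (u i j) \<le> u i (Suc j)" if "i < ?k" for i by (rule u(2)[OF that j])
      show "pcount n (e j i) \<le> u i j" for i by (rule ue) (use j in simp)
      show "pcount n (e (Suc j) i) \<le> u i (Suc j)" for i by (rule ue) (use j in simp)
      have mono: "a ! 0 \<le> a ! i" if "i < ?l" for i
        by (rule sorted_nth_mono[OF sa]) (use that ll in auto)
      show "e j i \<le> e j 0" for i
      proof (cases "i < ?l")
        case True
        then have "0 < ?l" by auto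
        then show ?thesis using mono[OF True] True by (simp add: e_def diff_le_mono2)
      qed (simp add: e_def)
      show "e (Suc j) i \<le> e (Suc j) 0" for i
      proof (cases "i < ?l")
        case True
        then have "0 < ?l" by auto
        then show ?thesis using mono[OF True] True by (simp add: e_def diff_le_mono2)
      qed (simp add: e_def)
      show "e (Suc j) i = Suc (e j i) \<or> e j i = 0 \<and> e (Suc j) i = 0" for i
        by (cases "i < ?l"; cases "a ! i \<le> Suc j") (simp_all add: e_def Suc_diff_le)
    qed
    then obtain H H' where H: "H + (\<Sum>i\<in>{1..<?k}. pcount n (e j i)) = (\<Sum>i<?k. u i j)"
      "H' + (\<Sum>i\<in>{1..<?k}. pcount n (e (Suc j) i)) = (\<Sum>i<?k. u i (Suc j))" "growth n H \<le> H'" by blast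
    have "H = h j" unfolding h_def H(1)[symmetric] by (rule add_diff_cancel_right'[symmetric])
    moreover have "H' = h (Suc j)" unfolding h_def H(2)[symmetric] by (rule add_diff_cancel_right'[symmetric])
    ultimately show ?thesis using H(3) by simp
  qed
  have "hilbert n I (\<alpha> + j) = h j + (\<Sum>i\<in>{1..<length a}. pcount n (Suc j - a ! i))" if "j \<le> t" for j
    using u(1)[OF that] h1[OF that] esum[OF that] by simp
  moreover have "h j \<le> M" if "j \<le> t" for j using uM[OF that] unfolding h_def by linarith
  moreover have "pcount n (Suc j - a ! 0) \<le> h j" if "j \<le> t" for j
    using tot[OF that] h1[OF that] e0[OF that] by linarith
  ultimately show "\<exists>h. (\<forall>j\<le>t. hilbert n I (initial_degree n I + j) = h j + (\<Sum>i\<in>{1..<length a}. pcount n (Suc j - a ! i)))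
    \<and> (\<forall>j\<le>t. h j \<le> M) \<and> (\<forall>j<t. growth n (h j) \<le> h (Suc j)) \<and> (\<forall>j\<le>t. pcount n (Suc j - a ! 0) \<le> h j)"
    using h2 unfolding \<alpha>_def by blast
qed

theorem theorem1p5:
  fixes n l t :: nat and a b :: "nat list"
  assumes "n \<ge> 3" and "l \<ge> 1" and "length a = l" and "length b = t + 1"
  shows "\<exists>D::nat. \<forall>I :: 'k::field_char_0 mpoly set.
    homogeneous_ideal n I \<and> ideal_of_type n a b I \<and> initial_degree n I \<ge> D \<longrightarrow>
    (\<exists>J :: 'k mpoly set. lpp_ideal n (map (\<lambda>ai. initial_degree n I + ai) a) J \<and>
      (\<forall>d \<le> initial_degree n I + t. hilbert n J d = hilbert n I d))"
proof -
  define M where "M = Suc (\<Sum>j\<le>t. b ! j * card (mons {..<n} (t - j)))"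
  show ?thesis
  \<comment> \<open>From this degree on, the regular sequence has no relation that the presentation could see, and
    segments of \<open>M\<close> monomials keep away from the powers of all variables but the first.\<close>
  proof (intro exI[of _ "level_bound M t M + t + M + 1"] allI impI, elim conjE)
    fix I :: "'k mpoly set"
    let ?\<alpha> = "initial_degree n I"
    assume type: "ideal_of_type n a b I" and big: "level_bound M t M + t + M + 1 \<le> ?\<alpha>"
    have n: "n \<ge> 2" and a: "a \<noteq> []" using assms by auto
    have lev: "level_bound M t M + t < ?\<alpha>" "M < ?\<alpha>" "t < ?\<alpha>" using big by auto
    note facts = hilbert_function_of_type[OF n a assms(4) type M_def lev(1)]
    obtain h where h: "\<And>j. j \<le> t \<Longrightarrow> hilbert n I (?\<alpha> + j) = h j + (\<Sum>i\<in>{1..<length a}. pcount n (Suc j - a ! i))"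
      "\<And>j. j \<le> t \<Longrightarrow> h j \<le> M" "\<And>j. j < t \<Longrightarrow> growth n (h j) \<le> h (Suc j)"
      "\<And>j. j \<le> t \<Longrightarrow> pcount n (Suc j - a ! 0) \<le> h j"
      using facts(1) by blast
    obtain J :: "'k mpoly set" where J: "lpp_ideal n (map (\<lambda>ai. ?\<alpha> + ai) a) J" "\<forall>d<?\<alpha>. hilbert n J d = 0"
      "\<forall>j\<le>t. hilbert n J (?\<alpha> + j) = h j + (\<Sum>i\<in>{1..<length a}. pcount n (Suc j - a ! i))"
      using lpp_ideal_with_hilbert[OF n facts(2) a facts(3) lev(2,3) h(2-4)] by blast
    have eq: "hilbert n J d = hilbert n I d" if "d \<le> ?\<alpha> + t" for d
    proof (cases "d < ?\<alpha>")
      case True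
      then show ?thesis using J(2) facts(4) by simp
    next
      case False
      then obtain j where "d = ?\<alpha> + j" by (metis le_add_diff_inverse not_less)
      then show ?thesis using J(3) h(1) that by simp
    qed
    show "\<exists>J :: 'k mpoly set. lpp_ideal n (map (\<lambda>ai. ?\<alpha> + ai) a) J \<and> (\<forall>d\<le>?\<alpha> + t. hilbert n J d = hilbert n I d)"
      by (intro exI[of _ J] conjI J(1) allI impI eq)
  qed
qed

end
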